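(* Let $K$ be a perfect field, let $r\geq 2$, $1\leq s\leq m$, $1\leq t\leq n$ be integers, and let $X_q=(x^q_{i,j})$, $1\leq q\leq r$, be $m\times n$ matrices of distinct indeterminates. Let $R=K[x^q_{i,j}\mid 1\leq i\leq m,\ 1\leq j\leq n,\ 1\leq q\leq r]$ with the standard grading. Let $J_r\subseteq R$ be the ideal generated by the $s$-minors of the $m\times rn$ horizontal concatenation $(X_1\ \cdots\ X_r)$ together with the $t$-minors of the $rm\times n$ vertical concatenation of $X_1,\ldots,X_r$, and let $V_r$ be the variety defined by $J_r$ (a double determinantal variety). Assume without loss of generality that $s\leq t$. Then $$\operatorname{height}(J_r)=(m-s+1)(n-s+1)+(r-1)\,n\,(m-s+1)+(n-t+1)\sum_{q=2}^r\Bigl((s-1)-\max\{0,\ t-(s-1)(q-1)-1\}\Bigr).$$ In particular, considering $V_r$ as a projective variety, $$\dim(V_r)=(s-1)(m+n-s+1)+(t-1)\sum_{q=2}^r\Bigl((s-1)-\max\{0,\ t-(s-1)(q-1)-1\}\Bigr)+n\sum_{q=2}^r\max\{0,\ t-(s-1)(q-1)-1\}.$$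
   Context: For a positive integer $k$, a $k$-minor of a matrix is the determinant of a $k\times k$ submatrix. The vertical concatenation of $X_1,\ldots,X_r$ is the $rm\times n$ matrix with $X_1$ on top and $X_r$ at the bottom.
   Formalization: Each max{0, t-(s-1)(q-1)-1} is replaced by its minimum with s-1, since the printed height fails for m=s=1, n=r=t=2 (gives 3, true value 4); dim(V_r) is the Krull dimension of the homogeneous coordinate ring R/J_r (affine cone), one more than the projective dimension. *)

theory Defs
  imports
    "HOL-Algebra.QuotRing"
    "HOL-Library.Poly_Mapping"
    "HOL-Library.Extended_Nat"
    "Jordan_Normal_Form.Determinant"
    "Jordan_Normal_Form.DL_Submatrix"
begin

definition perfect_field :: "'k::field itself \<Rightarrow> bool" where
  "perfect_field _ \<longleftrightarrow> CHAR('k) = 0 \<or> (\<forall>a::'k. \<exists>b. b ^ CHAR('k) = a)"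

text \<open>
  \<open>mpoly_ring V\<close> is the polynomial ring over \<open>'k\<close> in the set \<open>V\<close> of variables. A polynomial maps
  exponent vectors to coefficients, and it belongs to the carrier if every monomial in its support
  only involves variables from \<open>V\<close>.
\<close>
definition mpoly_ring :: "'v set \<Rightarrow> (('v \<Rightarrow>\<^sub>0 nat) \<Rightarrow>\<^sub>0 'k::field) ring" where
  "mpoly_ring V =
     \<lparr>carrier = {p. \<forall>\<mu>\<in>Poly_Mapping.keys p. Poly_Mapping.keys \<mu> \<subseteq> V},
      monoid.mult = (*), monoid.one = 1, ring.zero = 0, ring.add = (+)\<rparr>"

definition mpoly_var :: "'v \<Rightarrow> ('v \<Rightarrow>\<^sub>0 nat) \<Rightarrow>\<^sub>0 'k::field" where
  "mpoly_var v = Poly_Mapping.single (Poly_Mapping.single v 1) 1"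

lemma mpoly_ring_cring: "cring (mpoly_ring V :: (('v \<Rightarrow>\<^sub>0 nat) \<Rightarrow>\<^sub>0 'k::field) ring)"
proof -
  let ?R = "mpoly_ring V :: (('v \<Rightarrow>\<^sub>0 nat) \<Rightarrow>\<^sub>0 'k) ring"
  have mem: "p \<in> carrier ?R \<longleftrightarrow>
      (\<forall>\<mu>\<in>Poly_Mapping.keys p. Poly_Mapping.keys \<mu> \<subseteq> V)" for p
    by (simp add: mpoly_ring_def)
  have ops: "x \<otimes>\<^bsub>?R\<^esub> y = x * y" "x \<oplus>\<^bsub>?R\<^esub> y = x + y" "\<one>\<^bsub>?R\<^esub> = 1" "\<zero>\<^bsub>?R\<^esub> = 0" for x y
    by (simp_all add: mpoly_ring_def)
  have add: "p + q \<in> carrier ?R" if "p \<in> carrier ?R" "q \<in> carrier ?R" for p q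
    using that subsetD[OF Poly_Mapping.keys_add[of p q]] unfolding mem by blast
  have mult: "p * q \<in> carrier ?R" if pq: "p \<in> carrier ?R" "q \<in> carrier ?R" for p q
    unfolding mem
  proof
    fix \<mu> assume "\<mu> \<in> Poly_Mapping.keys (p * q)"
    then obtain \<alpha> \<beta> where ab: "\<mu> = \<alpha> + \<beta>" "\<alpha> \<in> Poly_Mapping.keys p" "\<beta> \<in> Poly_Mapping.keys q"
      using subsetD[OF keys_mult[of p q]] by blast
    then have "Poly_Mapping.keys \<alpha> \<subseteq> V" "Poly_Mapping.keys \<beta> \<subseteq> V"
      using pq unfolding mem by blast+
    then show "Poly_Mapping.keys \<mu> \<subseteq> V"
      using Poly_Mapping.keys_add[of \<alpha> \<beta>] unfolding ab(1) by (meson order_trans Un_least)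
  qed
  have zero: "0 \<in> carrier ?R" and one: "1 \<in> carrier ?R"
    unfolding mem by simp_all
  have minus: "- p \<in> carrier ?R" if "p \<in> carrier ?R" for p
    using that unfolding mem by simp
  show ?thesis
  proof (intro cringI abelian_groupI comm_monoidI, unfold ops)
    fix p assume "p \<in> carrier ?R"
    then show "\<exists>q\<in>carrier ?R. q + p = 0"
      using minus by (intro bexI[of _ "- p"]) simp_all
  qed (rule add mult zero one add.assoc add.commute mult.assoc mult.commute
         add_0_left mult_1_left distrib_right; assumption?)+
qed

definition horizontal_concat :: "nat \<Rightarrow> nat \<Rightarrow> nat \<Rightarrow> (nat \<Rightarrow> 'a mat) \<Rightarrow> 'a mat" where
  "horizontal_concat m n r X = mat m (r * n) (\<lambda>(i, c). X (c div n) $$ (i, c mod n))"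

definition vertical_concat :: "nat \<Rightarrow> nat \<Rightarrow> nat \<Rightarrow> (nat \<Rightarrow> 'a mat) \<Rightarrow> 'a mat" where
  "vertical_concat m n r X = mat (r * m) n (\<lambda>(i, j). X (i div m) $$ (i mod m, j))"

definition minors :: "nat \<Rightarrow> 'a::comm_ring_1 mat \<Rightarrow> 'a set" where
  "minors k A = {det (submatrix A I J) | I J.
     I \<subseteq> {..<dim_row A} \<and> J \<subseteq> {..<dim_col A} \<and> card I = k \<and> card J = k}"

text \<open>Blocks, rows and columns are numbered from 0, so \<open>(q, i, j)\<close> is the variable in row \<open>i\<close> and
  column \<open>j\<close> of the \<open>q\<close>-th of the matrices number \<open>0, ..., r - 1\<close>.\<close>

definition generic_matrix ::
    "nat \<Rightarrow> nat \<Rightarrow> nat \<Rightarrow> ((nat \<times> nat \<times> nat \<Rightarrow>\<^sub>0 nat) \<Rightarrow>\<^sub>0 'k::field) mat" where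
  "generic_matrix m n q = mat m n (\<lambda>(i, j). mpoly_var (q, i, j))"

definition generic_ring ::
    "nat \<Rightarrow> nat \<Rightarrow> nat \<Rightarrow> ((nat \<times> nat \<times> nat \<Rightarrow>\<^sub>0 nat) \<Rightarrow>\<^sub>0 'k::field) ring" where
  "generic_ring m n r = mpoly_ring ({..<r} \<times> {..<m} \<times> {..<n})"

definition double_det_ideal ::
    "nat \<Rightarrow> nat \<Rightarrow> nat \<Rightarrow> nat \<Rightarrow> nat \<Rightarrow>
      ((nat \<times> nat \<times> nat \<Rightarrow>\<^sub>0 nat) \<Rightarrow>\<^sub>0 'k::field) set" where
  "double_det_ideal m n r s t =
     Idl\<^bsub>generic_ring m n r\<^esub>
       (minors s (horizontal_concat m n r (generic_matrix m n)) \<union>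
        minors t (vertical_concat m n r (generic_matrix m n)))"

text \<open>Supremum of the lengths \<open>k\<close> of the strict chains \<open>P 0 \<subset> \<dots> \<subset> P k\<close> in a set of subsets.\<close>
definition chain_dim :: "'a set set \<Rightarrow> enat" where
  "chain_dim \<P> = Sup {enat k | k. \<exists>P. (\<forall>i\<le>k. P i \<in> \<P>) \<and> (\<forall>i<k. P i \<subset> P (Suc i))}"

definition prime_height :: "('a, 'b) ring_scheme \<Rightarrow> 'a set \<Rightarrow> enat" where
  "prime_height R P = chain_dim {Q. primeideal Q R \<and> Q \<subseteq> P}"

definition ideal_height :: "('a, 'b) ring_scheme \<Rightarrow> 'a set \<Rightarrow> enat" where
  "ideal_height R I = (INF P\<in>{P. primeideal P R \<and> I \<subseteq> P}. prime_height R P)"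

text \<open>
  The field need not be algebraically closed (it may even be finite), so the variety defined by an
  ideal \<open>I\<close> of \<open>R\<close> is its zero locus in the prime spectrum. Irreducible closed subsets correspond to
  primes, so \<open>chain_dim (zero_locus R I)\<close> is its Krull dimension. For a homogeneous ideal this is
  the dimension of the homogeneous coordinate ring, equivalently of the affine cone; as a closed
  subset of projective space the variety has dimension one less.
\<close>
definition zero_locus :: "('a, 'b) ring_scheme \<Rightarrow> 'a set \<Rightarrow> 'a set set" where
  "zero_locus R I = {P. primeideal P R \<and> I \<subseteq> P}"

text \<open>
  The maximum below counts the independent rows which the \<open>q\<close>-th matrix still has to contribute to
  reach rank \<open>t - 1\<close> in the vertical concatenation. A matrix of rank \<open>s - 1\<close> cannot contribute more
  than \<open>s - 1\<close> rows, so the count is capped there. The formulas without the cap agree with the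
  capped ones for \<open>t - 1 \<le> 2 (s - 1)\<close>, but are wrong otherwise: for \<open>m = s = 1\<close> and
  \<open>n = r = t = 2\<close> the ideal is generated by all four variables, whereas the uncapped formula
  for the height gives 3.
\<close>
lemma cap_superfluous:
  fixes s t q :: nat
  assumes "1 \<le> s" "2 \<le> q" "int t - 1 \<le> 2 * (int s - 1)"
  shows "min (int s - 1) (max 0 (int t - (int s - 1) * (int q - 1) - 1)) =
         max 0 (int t - (int s - 1) * (int q - 1) - 1)"
proof -
  define y where "y = (int s - 1) * (int q - 1)"
  have "int s - 1 \<le> y"
    unfolding y_def using assms mult_left_mono[of 1 "int q - 1" "int s - 1"] by simp
  then have "max 0 (int t - y - 1) \<le> int s - 1"
    using assms by simp
  then have "max 0 (int t - (int s - 1) * (int q - 1) - 1) \<le> int s - 1"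
    unfolding y_def .
  then show ?thesis by (rule min_absorb2)
qed

end

(*
  A prime P of R containing J_r is stratified by the rank rho < s of the horizontal concatenation
  modulo P and by the rank sigma < t, sigma <= r rho, of the vertical concatenation of rho rows
  whose minors detect rho. By Cramer's rule every variable is, up to two minors outside P, a
  polynomial in (m - rho) rho + (n - sigma) sigma + r rho sigma elements of R/P, and this number is
  largest for rho = s - 1 and sigma = min (t - 1, r (s - 1)). Counting monomials then bounds the
  length of algebraically independent families modulo P. A strict chain of k primes above P yields
  such a family of length k (choose f_i in P_(i+1) but not in P_i), which bounds the dimension from
  above. Conversely, the primes generated by the contractions of P to the subrings of the first i
  variables, i <= N, form a chain below P, and the variables at which it does not grow are
  algebraically independent modulo P; this bounds the height from below by N minus the dimension.

  The remaining two bounds come from one prime, the kernel of the parametrization X_q = A Y_q B in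
  which A and B start with identity blocks. Setting the parameters to zero one at a time gives a
  chain of the required length above it: the entries of A and B are, up to a minor of the generic
  Y_q, in the image of the parametrization, so they have to be killed before the entries of Y_q.
*)
theory Submission
  imports Defs "HOL-Library.Product_Lexorder"
begin

section \<open>Substitution homomorphisms\<close>

text \<open>Write N for the number r m n of variables and d for the maximal value of the count.
  Everything rests on one invariant of a prime: how many elements can be algebraically independent
  modulo it. It is bounded by growth instead of by transcendence degree: if k elements are
  independent, their (D + 1)^k monomials span, modulo the prime, a space of dimension at most a
  constant times D^d for every D \<ge> 1, so k \<le> d. Fractions are avoided by multiplying with
  powers of the two minors; the powers needed grow only linearly in D.

  Without rank conditions the same count shows that no chain of primes is longer than N. This is why
  one prime serves for two bounds: the chain of length d above it bounds the dimension from below,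
  and a chain below it, continued by that chain, has length at most N, so its height is at most N -
  d.

  Primes are first treated as subsets of the type of polynomials in all index triples.\<close>

abbreviation mpoly_const :: "'k::field \<Rightarrow> ('v \<Rightarrow>\<^sub>0 nat) \<Rightarrow>\<^sub>0 'k" where
  "mpoly_const \<equiv> Poly_Mapping.single 0"

definition peval :: "('k::comm_ring_1 \<Rightarrow> 'a::comm_ring_1) \<Rightarrow> ('v \<Rightarrow> 'a) \<Rightarrow>
    (('v \<Rightarrow>\<^sub>0 nat) \<Rightarrow>\<^sub>0 'k) \<Rightarrow> 'a" where
  "peval h \<phi> p = (\<Sum>\<mu>\<in>Poly_Mapping.keys p. h (Poly_Mapping.lookup p \<mu>) *
     (\<Prod>v\<in>Poly_Mapping.keys \<mu>. \<phi> v ^ Poly_Mapping.lookup \<mu> v))"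

lemma peval_zero [simp]: "peval h \<phi> 0 = 0"
  by (simp add: peval_def)

lemma mpoly_sum_monomials:
  "(\<Sum>\<mu>\<in>Poly_Mapping.keys p. Poly_Mapping.single \<mu> (Poly_Mapping.lookup p \<mu>)) = p"
proof (rule poly_mapping_eqI)
  fix \<nu>
  show "Poly_Mapping.lookup (\<Sum>\<mu>\<in>Poly_Mapping.keys p. Poly_Mapping.single \<mu> (Poly_Mapping.lookup p \<mu>)) \<nu> = Poly_Mapping.lookup p \<nu>"
    by (simp add: lookup_sum lookup_single when_def in_keys_iff)
qed

lemma mpoly_induct [case_names zero monomial add]:
  fixes p :: "'b \<Rightarrow>\<^sub>0 'c::comm_monoid_add"
  assumes "P 0" "\<And>\<mu> c. P (Poly_Mapping.single \<mu> c)" "\<And>p q. P p \<Longrightarrow> P q \<Longrightarrow> P (p + q)"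
  shows "P p"
proof -
  have "P (\<Sum>\<mu>\<in>S. Poly_Mapping.single \<mu> (Poly_Mapping.lookup p \<mu>))" if "finite S" for S
    using that by induction (auto intro: assms)
  then show ?thesis using mpoly_sum_monomials[of p] finite_keys[of p] by metis
qed

lemma comm_ring_hom_single0:
  "comm_ring_hom (Poly_Mapping.single 0 :: 'c::comm_ring_1 \<Rightarrow> ('v::comm_monoid_add) \<Rightarrow>\<^sub>0 'c)"
  by unfold_locales (auto simp: single_add mult_single)

lemma comm_ring_hom_mpoly_const: "comm_ring_hom (mpoly_const :: 'k::field \<Rightarrow> ('v \<Rightarrow>\<^sub>0 nat) \<Rightarrow>\<^sub>0 'k)"
  by (rule comm_ring_hom_single0)

lemma single_eq_var_prod:
  "Poly_Mapping.single \<mu> c =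
     (mpoly_const c :: ('v \<Rightarrow>\<^sub>0 nat) \<Rightarrow>\<^sub>0 'k::field) *
     (\<Prod>v\<in>Poly_Mapping.keys \<mu>. mpoly_var v ^ Poly_Mapping.lookup \<mu> v)"
proof -
  have pow: "(mpoly_var v :: ('v \<Rightarrow>\<^sub>0 nat) \<Rightarrow>\<^sub>0 'k) ^ k =
      Poly_Mapping.single (Poly_Mapping.single v k) 1" for v k
    by (induction k) (auto simp: mpoly_var_def mult_single single_add[symmetric])
  have "(\<Prod>v\<in>S. Poly_Mapping.single (f v) (1::'k)) = Poly_Mapping.single (sum f S) 1"
    if "finite S" for S and f :: "'v \<Rightarrow> 'v \<Rightarrow>\<^sub>0 nat"
    using that by induction (auto simp: mult_single)
  then show ?thesis
    by (simp add: pow mpoly_sum_monomials mult_single)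
qed

lemma peval_mono_superset:
  fixes \<phi> :: "'v \<Rightarrow> 'a::comm_ring_1"
  assumes "finite S" "Poly_Mapping.keys \<mu> \<subseteq> S"
  shows "(\<Prod>v\<in>Poly_Mapping.keys \<mu>. \<phi> v ^ Poly_Mapping.lookup \<mu> v) = (\<Prod>v\<in>S. \<phi> v ^ Poly_Mapping.lookup \<mu> v)"
  by (rule prod.mono_neutral_left) (use assms in \<open>auto simp: in_keys_iff\<close>)

lemma peval_mono_add:
  fixes \<phi> :: "'v \<Rightarrow> 'a::comm_ring_1"
  shows "(\<Prod>v\<in>Poly_Mapping.keys (\<mu> + \<nu>). \<phi> v ^ Poly_Mapping.lookup (\<mu> + \<nu>) v) =
   (\<Prod>v\<in>Poly_Mapping.keys \<mu>. \<phi> v ^ Poly_Mapping.lookup \<mu> v) * (\<Prod>v\<in>Poly_Mapping.keys \<nu>. \<phi> v ^ Poly_Mapping.lookup \<nu> v)"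
proof -
  let ?S = "Poly_Mapping.keys \<mu> \<union> Poly_Mapping.keys \<nu>"
  have "Poly_Mapping.keys (\<mu> + \<nu>) \<subseteq> ?S" by (rule Poly_Mapping.keys_add)
  then have "(\<Prod>v\<in>Poly_Mapping.keys (\<mu> + \<nu>). \<phi> v ^ Poly_Mapping.lookup (\<mu> + \<nu>) v) =
      (\<Prod>v\<in>?S. \<phi> v ^ Poly_Mapping.lookup (\<mu> + \<nu>) v)"
    by (intro peval_mono_superset) auto
  then show ?thesis
    by (simp add: peval_mono_superset[of ?S \<mu>] peval_mono_superset[of ?S \<nu>]
        lookup_add power_add prod.distrib)
qed

context
  fixes h :: "'k::comm_ring_1 \<Rightarrow> 'a::comm_ring_1" and \<phi> :: "'v \<Rightarrow> 'a"
  assumes h: "comm_ring_hom h"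
begin

interpretation h: comm_ring_hom h by (rule h)

lemma peval_superset:
  assumes "finite S" "Poly_Mapping.keys p \<subseteq> S"
  shows "peval h \<phi> p = (\<Sum>\<mu>\<in>S. h (Poly_Mapping.lookup p \<mu>) * (\<Prod>v\<in>Poly_Mapping.keys \<mu>. \<phi> v ^ Poly_Mapping.lookup \<mu> v))"
  unfolding peval_def
  by (rule sum.mono_neutral_left) (use assms in \<open>auto simp: in_keys_iff\<close>)

lemma peval_add: "peval h \<phi> (p + q) = peval h \<phi> p + peval h \<phi> q"
proof -
  let ?S = "Poly_Mapping.keys p \<union> Poly_Mapping.keys q"
  have "Poly_Mapping.keys (p + q) \<subseteq> ?S" by (rule Poly_Mapping.keys_add)
  then show ?thesis
    by (simp add: peval_superset[of ?S p] peval_superset[of ?S q] peval_superset[of ?S "p + q"]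
        lookup_add h.hom_add algebra_simps sum.distrib)
qed

lemma peval_single:
  "peval h \<phi> (Poly_Mapping.single \<mu> c) = h c * (\<Prod>v\<in>Poly_Mapping.keys \<mu>. \<phi> v ^ Poly_Mapping.lookup \<mu> v)"
  by (subst peval_superset[of "{\<mu>}"]) auto

lemma peval_mult: "peval h \<phi> (p * q) = peval h \<phi> p * peval h \<phi> q"
proof (induction p rule: mpoly_induct)
  case (monomial \<mu> c)
  show ?case
  proof (induction q rule: mpoly_induct)
    case (monomial \<nu> d)
    then show ?case
      by (simp add: mult_single peval_single peval_mono_add h.hom_mult algebra_simps)
  qed (auto simp: peval_add distrib_left)
qed (auto simp: peval_add distrib_right)

lemma comm_ring_hom_peval: "comm_ring_hom (peval h \<phi>)"
proof
  show "peval h \<phi> 1 = 1"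
    by (simp flip: single_one add: peval_single h.hom_one)
qed (auto simp: peval_add peval_mult)

lemma peval_single_var: "peval h \<phi> (Poly_Mapping.single (Poly_Mapping.single v 1) 1) = \<phi> v"
  by (simp add: peval_single h.hom_one)

lemma peval_const: "peval h \<phi> (Poly_Mapping.single 0 c) = h c"
  by (simp add: peval_single)

end

lemma peval_var:
  fixes h :: "'k::field \<Rightarrow> 'a::comm_ring_1"
  shows "comm_ring_hom h \<Longrightarrow> peval h \<phi> (mpoly_var v) = \<phi> v"
  unfolding mpoly_var_def by (rule peval_single_var)

lemma hom_peval:
  assumes "comm_ring_hom g"
  shows "g (peval h \<phi> p) = peval (g \<circ> h) (g \<circ> \<phi>) p"
proof -
  interpret comm_ring_hom g by fact
  show ?thesis by (simp add: peval_def hom_sum hom_mult hom_prod hom_power)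
qed

lemma peval_id: "peval mpoly_const mpoly_var p = p"
proof (induction p rule: mpoly_induct)
  case (monomial \<mu> c)
  then show ?case by (simp add: peval_single[OF comm_ring_hom_mpoly_const] flip: single_eq_var_prod)
qed (auto simp: peval_add[OF comm_ring_hom_mpoly_const])

lemma peval_cong:
  assumes "\<And>\<mu> v. \<mu> \<in> Poly_Mapping.keys p \<Longrightarrow> v \<in> Poly_Mapping.keys \<mu> \<Longrightarrow> \<phi> v = \<psi> v"
  shows "peval h \<phi> p = peval h \<psi> p"
  unfolding peval_def by (intro sum.cong prod.cong arg_cong2[where f = "(*)"] refl) (simp add: assms)

section \<open>Ideals and primes of commutative rings given by types\<close>

text \<open>Ideals are subsets of a whole type here, so that congruences modulo \<open>Q\<close> use
  the type class operations and preimages under homomorphisms need no carrier. The carrier-based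
  \<open>primeideal\<close> enters only at the transfer to the ring of the generic matrices.\<close>

locale ideal_set =
  fixes Q :: "'a::comm_ring_1 set"
  assumes zero: "0 \<in> Q"
    and add: "a \<in> Q \<Longrightarrow> b \<in> Q \<Longrightarrow> a + b \<in> Q"
    and mult: "a \<in> Q \<Longrightarrow> b * a \<in> Q"
begin

lemma mult': "a \<in> Q \<Longrightarrow> a * b \<in> Q"
  using mult[of a b] by (simp add: mult.commute)

lemma uminus: "a \<in> Q \<Longrightarrow> - a \<in> Q"
  using mult[of a "-1"] by simp

lemma diff: "a \<in> Q \<Longrightarrow> b \<in> Q \<Longrightarrow> a - b \<in> Q"
  using add[of a "-b"] uminus[of b] by simp

lemma sum: "(\<And>i. i \<in> A \<Longrightarrow> f i \<in> Q) \<Longrightarrow> sum f A \<in> Q"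
  by (induction A rule: infinite_finite_induct) (auto intro: zero add)

lemma add_cancel: "a \<in> Q \<Longrightarrow> a + b \<in> Q \<longleftrightarrow> b \<in> Q"
  using add[of a b] diff[of "a + b" a] by auto

lemma diff_cong: "a - b \<in> Q \<Longrightarrow> a \<in> Q \<longleftrightarrow> b \<in> Q"
  using add[of "a - b" b] diff[of a "a - b"] by auto

lemma diff_trans: "a - b \<in> Q \<Longrightarrow> b - c \<in> Q \<Longrightarrow> a - c \<in> Q"
  using add[of "a - b" "b - c"] by simp

lemma diff_mult: "a - b \<in> Q \<Longrightarrow> c - d \<in> Q \<Longrightarrow> a * c - b * d \<in> Q"
  using add[OF mult'[of "a - b" c] mult[of "c - d" b]] by (simp add: algebra_simps)

end

locale prime_set = ideal_set +
  assumes one_notin: "1 \<notin> Q"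
    and prime: "a * b \<in> Q \<Longrightarrow> a \<in> Q \<or> b \<in> Q"
begin

lemma power_notin: "a \<notin> Q \<Longrightarrow> a ^ k \<notin> Q"
  by (induction k) (use one_notin prime in auto)

lemma mult_notin: "a \<notin> Q \<Longrightarrow> b \<notin> Q \<Longrightarrow> a * b \<notin> Q"
  using prime by blast

end

lemma prime_set_zero: "prime_set {0 :: 'a::idom}"
  by unfold_locales auto

lemma prime_set_vimage:
  assumes "comm_ring_hom g" "prime_set Q"
  shows "prime_set (g -` Q)"
proof -
  interpret comm_ring_hom g by fact
  interpret prime_set Q by fact
  show ?thesis
    by unfold_locales (auto simp: hom_add hom_mult zero add mult one_notin prime)
qed

section \<open>Coefficientwise primes in polynomial rings\<close>

lemma lookup_times_sum:
  "Poly_Mapping.lookup (F * G) \<mu> =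
    (\<Sum>(\<alpha>, \<beta>)\<in>{(\<alpha>, \<beta>)\<in>Poly_Mapping.keys F \<times> Poly_Mapping.keys G. \<alpha> + \<beta> = \<mu>}.
      Poly_Mapping.lookup F \<alpha> * Poly_Mapping.lookup G \<beta>)"
proof -
  let ?K = "Poly_Mapping.keys F \<times> Poly_Mapping.keys G"
  have "F * G = (\<Sum>(\<alpha>, \<beta>)\<in>?K. Poly_Mapping.single (\<alpha> + \<beta>) (Poly_Mapping.lookup F \<alpha> * Poly_Mapping.lookup G \<beta>))"
    by (subst (1) mpoly_sum_monomials[of F, symmetric], subst (1) mpoly_sum_monomials[of G, symmetric])
       (simp add: sum_product mult_single sum.cartesian_product)
  then have "Poly_Mapping.lookup (F * G) \<mu> =
      (\<Sum>(\<alpha>, \<beta>)\<in>?K. if \<alpha> + \<beta> = \<mu> then Poly_Mapping.lookup F \<alpha> * Poly_Mapping.lookup G \<beta> else 0)"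
    by (simp add: lookup_sum lookup_single when_def case_prod_beta)
  also have "\<dots> = (\<Sum>x\<in>{x\<in>?K. fst x + snd x = \<mu>}. Poly_Mapping.lookup F (fst x) * Poly_Mapping.lookup G (snd x))"
    by (simp add: case_prod_beta sum.inter_filter)
  also have "{x\<in>?K. fst x + snd x = \<mu>} = {(\<alpha>, \<beta>)\<in>?K. \<alpha> + \<beta> = \<mu>}" by auto
  finally show ?thesis by (simp add: case_prod_beta)
qed

text \<open>The order on monomials singles out, in a product of two polynomials, a coefficient which
  modulo \<open>Q\<close> is the product of the two top coefficients lying outside \<open>Q\<close>.\<close>
lemma prime_set_coeffs:
  fixes Q :: "'a::comm_ring_1 set"
  assumes "prime_set Q"
  shows "prime_set {F :: ('m::{ordered_cancel_comm_monoid_add,linorder}) \<Rightarrow>\<^sub>0 'a. \<forall>\<mu>. Poly_Mapping.lookup F \<mu> \<in> Q}"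
    (is "prime_set ?S")
proof -
  interpret prime_set Q by fact
  show ?thesis
  proof
    fix F G :: "'m \<Rightarrow>\<^sub>0 'a"
    assume FG: "F * G \<in> ?S"
    show "F \<in> ?S \<or> G \<in> ?S"
    proof (rule ccontr)
      assume "\<not> ?thesis"
      then have ne: "{\<mu>. Poly_Mapping.lookup F \<mu> \<notin> Q} \<noteq> {}" "{\<mu>. Poly_Mapping.lookup G \<mu> \<notin> Q} \<noteq> {}" by auto
      have sub: "{\<mu>. Poly_Mapping.lookup F \<mu> \<notin> Q} \<subseteq> Poly_Mapping.keys F" "{\<mu>. Poly_Mapping.lookup G \<mu> \<notin> Q} \<subseteq> Poly_Mapping.keys G"
        using zero by (auto simp: in_keys_iff)
      then have fin: "finite {\<mu>. Poly_Mapping.lookup F \<mu> \<notin> Q}" "finite {\<mu>. Poly_Mapping.lookup G \<mu> \<notin> Q}"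
        using finite_subset finite_keys by blast+
      define \<alpha> where "\<alpha> = Max {\<mu>. Poly_Mapping.lookup F \<mu> \<notin> Q}"
      define \<beta> where "\<beta> = Max {\<mu>. Poly_Mapping.lookup G \<mu> \<notin> Q}"
      have \<alpha>: "Poly_Mapping.lookup F \<alpha> \<notin> Q" and \<beta>: "Poly_Mapping.lookup G \<beta> \<notin> Q"
        using Max_in[OF fin(1) ne(1)] Max_in[OF fin(2) ne(2)] by (auto simp: \<alpha>_def \<beta>_def)
      have \<alpha>': "\<mu> \<le> \<alpha>" if "Poly_Mapping.lookup F \<mu> \<notin> Q" for \<mu> using Max_ge[OF fin(1)] that by (auto simp: \<alpha>_def)
      have \<beta>': "\<mu> \<le> \<beta>" if "Poly_Mapping.lookup G \<mu> \<notin> Q" for \<mu> using Max_ge[OF fin(2)] that by (auto simp: \<beta>_def)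
      let ?K = "{(a, b)\<in>Poly_Mapping.keys F \<times> Poly_Mapping.keys G. a + b = \<alpha> + \<beta>}"
      have finK: "finite ?K" by (rule finite_subset[of _ "Poly_Mapping.keys F \<times> Poly_Mapping.keys G"]) auto
      have mem: "(\<alpha>, \<beta>) \<in> ?K" using sub \<alpha> \<beta> by auto
      have *: "(\<Sum>(a, b)\<in>?K - {(\<alpha>, \<beta>)}. Poly_Mapping.lookup F a * Poly_Mapping.lookup G b) \<in> Q"
      proof (rule sum)
        fix x assume x: "x \<in> ?K - {(\<alpha>, \<beta>)}"
        obtain a b where [simp]: "x = (a, b)" by (cases x)
        have ab: "a \<in> Poly_Mapping.keys F" "b \<in> Poly_Mapping.keys G" "a + b = \<alpha> + \<beta>" "(a, b) \<noteq> (\<alpha>, \<beta>)"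
          using x by auto
        \<comment> \<open>If both coefficients lay outside \<open>Q\<close>, both indices would be
          at most the maxima, and equality of the sums would force the excluded pair.\<close>
        have "Poly_Mapping.lookup F a \<in> Q \<or> Poly_Mapping.lookup G b \<in> Q"
        proof (rule ccontr)
          assume "\<not> ?thesis"
          then have le: "a \<le> \<alpha>" "b \<le> \<beta>" using \<alpha>' \<beta>' by auto
          have "a = \<alpha>"
          proof (rule ccontr)
            assume "a \<noteq> \<alpha>"
            then have "a < \<alpha>" using le by simp
            then have "a + b < \<alpha> + \<beta>" using le add_less_le_mono by blast
            then show False using ab by simp
          qed
          then show False using ab by simp
        qed
        then show "(case x of (a, b) \<Rightarrow> Poly_Mapping.lookup F a * Poly_Mapping.lookup G b) \<in> Q"
          using mult mult' by auto
      qed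
      then have "Poly_Mapping.lookup F \<alpha> * Poly_Mapping.lookup G \<beta> \<in> Q"
      proof -
        have "Poly_Mapping.lookup (F * G) (\<alpha> + \<beta>) \<in> Q" using FG by blast
        then show ?thesis
          using add_cancel[OF *, of "Poly_Mapping.lookup F \<alpha> * Poly_Mapping.lookup G \<beta>"]
          unfolding lookup_times_sum sum.remove[OF finK mem] by (simp add: add.commute)
      qed
      then show False using prime \<alpha> \<beta> by blast
    qed
  next
    show "1 \<notin> ?S" using one_notin by (auto simp: lookup_one intro!: exI[of _ 0])
  next
    fix F G :: "'m \<Rightarrow>\<^sub>0 'a" assume "F \<in> ?S"
    then show "G * F \<in> ?S"
      by (auto simp: lookup_times_sum case_prod_beta intro!: sum mult)
  qed (auto simp: lookup_add zero add)
qed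

section \<open>Algebraic independence modulo a prime\<close>

fun pmon :: "nat list \<Rightarrow> 'a::comm_ring_1 list \<Rightarrow> 'a" where
  "pmon (a # \<alpha>) (f # fs) = f ^ a * pmon \<alpha> fs"
| "pmon _ _ = 1"

text \<open>Bounding each exponent instead of the total degree makes the number of exponent vectors
  exactly (D + 1)^k and lets a sum split off the first exponent.\<close>

definition expts :: "nat \<Rightarrow> nat \<Rightarrow> nat list set" where
  "expts k D = {\<alpha>. set \<alpha> \<subseteq> {..D} \<and> length \<alpha> = k}"

lemma finite_expts [simp]: "finite (expts k D)"
  unfolding expts_def by (rule finite_lists_length_eq) simp

lemma card_expts: "card (expts k D) = (D + 1) ^ k"
  unfolding expts_def by (subst card_lists_length_eq) auto

lemma expts_0 [simp]: "expts 0 D = {[]}"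
  by (auto simp: expts_def)

lemma expts_Suc: "expts (Suc k) D = (\<lambda>(a, \<alpha>). a # \<alpha>) ` ({..D} \<times> expts k D)"
  by (auto simp: expts_def length_Suc_conv image_iff)

lemma sum_expts_Suc:
  "(\<Sum>\<alpha>\<in>expts (Suc k) D. F \<alpha>) = (\<Sum>a\<le>D. \<Sum>\<alpha>\<in>expts k D. F (a # \<alpha>))"
proof -
  have "inj_on (\<lambda>(a, \<alpha>). a # \<alpha>) ({..D} \<times> expts k D)" by (auto simp: inj_on_def)
  then show ?thesis
    unfolding expts_Suc sum.cartesian_product
    by (subst sum.reindex) (auto simp: case_prod_beta comp_def)
qed

definition lcomb :: "nat \<Rightarrow> (nat list \<Rightarrow> 'k::field) \<Rightarrow>
    (('v \<Rightarrow>\<^sub>0 nat) \<Rightarrow>\<^sub>0 'k) list \<Rightarrow> ('v \<Rightarrow>\<^sub>0 nat) \<Rightarrow>\<^sub>0 'k" where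
  "lcomb D b fs = (\<Sum>\<alpha>\<in>expts (length fs) D. mpoly_const (b \<alpha>) * pmon \<alpha> fs)"

text \<open>Independence over the field of the residue classes modulo \<open>P\<close>, without
  forming the quotient. As \<open>D\<close> varies, \<open>lcomb\<close> reaches every polynomial in
  the listed elements.\<close>

definition alg_indep_mod ::
    "(('v \<Rightarrow>\<^sub>0 nat) \<Rightarrow>\<^sub>0 'k::field) set \<Rightarrow> (('v \<Rightarrow>\<^sub>0 nat) \<Rightarrow>\<^sub>0 'k) list \<Rightarrow> bool" where
  "alg_indep_mod P fs \<longleftrightarrow> (\<forall>D b. lcomb D b fs \<in> P \<longrightarrow> (\<forall>\<alpha>\<in>expts (length fs) D. b \<alpha> = 0))"

lemma lcomb_Cons:
  "lcomb D b (f # fs) = (\<Sum>a\<le>D. f ^ a * lcomb D (\<lambda>\<alpha>. b (a # \<alpha>)) fs)"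
  by (simp add: lcomb_def sum_expts_Suc sum_distrib_left algebra_simps)

lemma lcomb_zero: "(\<forall>\<alpha>\<in>expts (length fs) D. b \<alpha> = 0) \<Longrightarrow> lcomb D b fs = 0"
  by (simp add: lcomb_def)

lemma const_notin_prime:
  fixes Q :: "(('v \<Rightarrow>\<^sub>0 nat) \<Rightarrow>\<^sub>0 'k::field) set"
  assumes "prime_set Q" "mpoly_const c \<in> Q"
  shows "c = 0"
proof (rule ccontr)
  assume "c \<noteq> 0"
  then have "mpoly_const (inverse c) * (mpoly_const c :: ('v \<Rightarrow>\<^sub>0 nat) \<Rightarrow>\<^sub>0 'k) = 1"
    by (simp add: mult_single)
  then show False using ideal_set.mult[OF prime_set.axioms(1)[OF assms(1)] assms(2), of "mpoly_const (inverse c)"]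
      prime_set.one_notin[OF assms(1)] by simp
qed

lemma alg_indep_mod_Nil:
  assumes "prime_set P"
  shows "alg_indep_mod P []"
  using const_notin_prime[OF assms]
  by (auto simp: alg_indep_mod_def lcomb_def)

text \<open>In a relation modulo \<open>P\<close>, the power of \<open>f\<close> in front of the
  lowest remaining coefficient cancels because \<open>f\<close> is outside \<open>P\<close>. Modulo
  the larger \<open>Q\<close>, which contains \<open>f\<close>, only that coefficient survives, and
  independence modulo \<open>Q\<close> kills it.\<close>

lemma alg_indep_mod_Cons:
  assumes "prime_set P" "prime_set Q" "P \<subseteq> Q" "f \<notin> P" "f \<in> Q" "alg_indep_mod Q fs"
  shows "alg_indep_mod P (f # fs)"
  unfolding alg_indep_mod_def
proof (intro allI impI)
  interpret P: prime_set P by fact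
  interpret Q: prime_set Q by fact
  fix D b
  let ?G = "\<lambda>a. lcomb D (\<lambda>\<alpha>. b (a # \<alpha>)) fs"
  assume "lcomb D b (f # fs) \<in> P"
  then have inP: "(\<Sum>a\<le>D. f ^ a * ?G a) \<in> P" by (simp add: lcomb_Cons)
  have G0: "\<forall>\<alpha>\<in>expts (length fs) D. b (a # \<alpha>) = 0" if "?G a \<in> Q" for a
    using assms(6) that unfolding alg_indep_mod_def by blast
  have "\<forall>\<alpha>\<in>expts (length fs) D. b (a # \<alpha>) = 0" if "a \<le> D" for a
    using that
  proof (induction a rule: less_induct)
    case (less a)
    \<comment> \<open>The terms below \<open>a\<close> vanish by the induction hypothesis, so
      \<open>f ^ a\<close> can be factored out.\<close>
    have "(\<Sum>i\<le>D. f ^ i * ?G i) = (\<Sum>i\<in>{a..D}. f ^ i * ?G i)"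
    proof (rule sum.mono_neutral_right)
      show "\<forall>i\<in>{..D} - {a..D}. f ^ i * ?G i = 0"
      proof
        fix i assume i: "i \<in> {..D} - {a..D}"
        then have "i < a" "i \<le> D" by auto
        then have "?G i = 0" by (rule lcomb_zero[OF less.IH])
        then show "f ^ i * ?G i = 0" by (simp only: mult_zero_right)
      qed
    qed auto
    also have "\<dots> = (\<Sum>i\<in>{a..D}. f ^ a * (f ^ (i - a) * ?G i))"
      by (intro sum.cong refl) (simp add: mult.assoc[symmetric] power_add[symmetric])
    also have "\<dots> = f ^ a * (\<Sum>i\<in>{a..D}. f ^ (i - a) * ?G i)"
      by (simp add: sum_distrib_left)
    finally have "(\<Sum>i\<in>{a..D}. f ^ (i - a) * ?G i) \<in> P"
      using inP P.prime[of "f ^ a"] P.power_notin[OF assms(4), of a] by simp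
    also have "(\<Sum>i\<in>{a..D}. f ^ (i - a) * ?G i) = (\<Sum>i\<in>{a<..D}. f ^ (i - a) * ?G i) + ?G a"
      using less.prems by (subst atLeastAtMost_insertL[symmetric]) (auto simp: ivl_disj_un sum.head add.commute atLeastSucAtMost_greaterThanAtMost)
    finally have "(\<Sum>i\<in>{a<..D}. f ^ (i - a) * ?G i) + ?G a \<in> Q" using assms(3) by blast
    moreover have "(\<Sum>i\<in>{a<..D}. f ^ (i - a) * ?G i) \<in> Q"
    proof (rule Q.sum)
      fix i assume "i \<in> {a<..D}"
      then have "Suc (i - a - 1) = i - a" by auto
      then have "f ^ (i - a) = f ^ (i - a - 1) * f" using power_Suc2[of f "i - a - 1"] by simp
      then show "f ^ (i - a) * ?G i \<in> Q" using Q.mult Q.mult' assms(5) by simp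
    qed
    ultimately show ?case using Q.add_cancel G0 by blast
  qed
  then show "\<forall>\<alpha>\<in>expts (length (f # fs)) D. b \<alpha> = 0"
    by (auto simp: expts_Suc)
qed

lemma chain_alg_indep_mod:
  assumes "\<And>i. i \<le> k \<Longrightarrow> prime_set (P i)" "\<And>i. i < k \<Longrightarrow> P i \<subset> P (Suc i)"
  shows "\<exists>fs. length fs = k \<and> alg_indep_mod (P 0) fs"
  using assms
proof (induction k arbitrary: P)
  case 0
  then show ?case using alg_indep_mod_Nil by blast
next
  case (Suc k)
  obtain fs where fs: "length fs = k" "alg_indep_mod (P (Suc 0)) fs"
    using Suc.IH[of "\<lambda>i. P (Suc i)"] Suc.prems by auto
  obtain f where "f \<in> P (Suc 0)" "f \<notin> P 0" using Suc.prems(2)[of 0] by auto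
  then have "alg_indep_mod (P 0) (f # fs)"
    using alg_indep_mod_Cons[of "P 0" "P (Suc 0)"] Suc.prems fs by blast
  then show ?case using fs by (intro exI[of _ "f # fs"]) simp
qed

section \<open>A counting bound for algebraic independence\<close>

text \<open>A homogeneous linear system with unknowns indexed by \<open>A\<close> and fewer
  equations, indexed by \<open>B\<close>. Each equation is spent on eliminating one unknown.\<close>

lemma exists_nonzero_solution:
  fixes a :: "'i \<Rightarrow> 'j \<Rightarrow> 'k::field"
  assumes "finite A" "finite B" "card B < card A"
  shows "\<exists>b. (\<exists>i\<in>A. b i \<noteq> 0) \<and> (\<forall>w\<in>B. (\<Sum>i\<in>A. b i * a i w) = 0)"
  using assms(2,1,3)
proof (induction B arbitrary: A a rule: finite_induct)
  case empty
  then have "A \<noteq> {}" by auto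
  then show ?case by (intro exI[of _ "\<lambda>_. 1"]) auto
next
  case (insert w B)
  show ?case
  proof (cases "\<forall>i\<in>A. a i w = 0")
    case True
    obtain b where "\<exists>i\<in>A. b i \<noteq> 0" "\<forall>w\<in>B. (\<Sum>i\<in>A. b i * a i w) = 0"
      using insert.IH[of A a] insert.prems insert.hyps by auto
    then show ?thesis using True by (intro exI[of _ b]) auto
  next
    case False
    then obtain i0 where i0: "i0 \<in> A" "a i0 w \<noteq> 0" by auto
    define A' where "A' = A - {i0}"
    have A': "finite A'" "card B < card A'" "i0 \<notin> A'" "A = insert i0 A'"
      using insert i0 by (auto simp: A'_def)
    obtain b where b: "\<exists>i\<in>A'. b i \<noteq> 0"
      "\<forall>u\<in>B. (\<Sum>i\<in>A'. b i * (a i u - a i w / a i0 w * a i0 u)) = 0"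
      using insert.IH[OF A'(1,2), of "\<lambda>i u. a i u - a i w / a i0 w * a i0 u"] by blast
    \<comment> \<open>The value that equation \<open>w\<close> forces on the eliminated unknown
      \<open>i0\<close>.\<close>
    define c where "c = - (\<Sum>i\<in>A'. b i * a i w) / a i0 w"
    let ?b = "b(i0 := c)"
    have sum: "(\<Sum>i\<in>A. ?b i * a i u) = c * a i0 u + (\<Sum>i\<in>A'. b i * a i u)" for u
    proof -
      have "(\<Sum>i\<in>A'. ?b i * a i u) = (\<Sum>i\<in>A'. b i * a i u)"
        using A'(3) by (intro sum.cong) auto
      then show ?thesis using A' by simp
    qed
    have "(\<Sum>i\<in>A. ?b i * a i u) = 0" if "u \<in> insert w B" for u
    proof (cases "u = w")
      case True
      have "(\<Sum>i\<in>A. ?b i * a i w) = c * a i0 w + (\<Sum>i\<in>A'. b i * a i w)" by (rule sum)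
      also have "\<dots> = 0" using i0 by (simp add: c_def)
      finally show ?thesis by (simp only: True)
    next
      case False
      then have "0 = (\<Sum>i\<in>A'. b i * (a i u - a i w / a i0 w * a i0 u))" using b that by auto
      also have "\<dots> = (\<Sum>i\<in>A'. b i * a i u - b i * a i w * (a i0 u / a i0 w))"
        by (intro sum.cong refl) (simp add: right_diff_distrib)
      also have "\<dots> = (\<Sum>i\<in>A'. b i * a i u) - (\<Sum>i\<in>A'. b i * a i w) * (a i0 u / a i0 w)"
        by (simp only: sum_subtractf sum_distrib_right)
      also have "\<dots> = c * a i0 u + (\<Sum>i\<in>A'. b i * a i u)" by (simp add: c_def)
      also have "\<dots> = (\<Sum>i\<in>A. ?b i * a i u)" by (rule sum[symmetric])
      finally show ?thesis by (rule sym)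
    qed
    moreover have "\<exists>i\<in>A. ?b i \<noteq> 0" using b(1) A' by auto
    ultimately show ?thesis by (intro exI[of _ ?b]) blast
  qed
qed

section \<open>Growth of spans modulo a prime\<close>

text \<open>After multiplication by \<open>\<delta> ^ M\<close>, polynomials of degree \<open>M\<close> in the variables lie modulo
  \<open>P\<close> in the span of a set \<open>W M\<close> of size \<open>(M + 1) ^ d\<close>; passing to \<open>\<delta> ^ M\<close> multiples replaces the
  fraction field of the residue ring.\<close>
locale span_growth = prime_set P
  for P :: "(('v \<Rightarrow>\<^sub>0 nat) \<Rightarrow>\<^sub>0 'k::field) set" +
  fixes \<delta> :: "('v \<Rightarrow>\<^sub>0 nat) \<Rightarrow>\<^sub>0 'k" and W :: "nat \<Rightarrow> (('v \<Rightarrow>\<^sub>0 nat) \<Rightarrow>\<^sub>0 'k) set" and d :: nat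
  assumes \<delta>_notin: "\<delta> \<notin> P"
    and finite_W: "finite (W M)"
    and card_W: "card (W M) \<le> (M + 1) ^ d"
    and W_mult: "p \<in> W M \<Longrightarrow> q \<in> W M' \<Longrightarrow> p * q \<in> W (M + M')"
    and one_W: "1 \<in> W 0"
    and \<delta>_W: "\<delta> \<in> W 1"
begin

definition Sp :: "nat \<Rightarrow> (('v \<Rightarrow>\<^sub>0 nat) \<Rightarrow>\<^sub>0 'k) set" where
  "Sp M = {p. \<exists>c. p - (\<Sum>w\<in>W M. mpoly_const (c w) * w) \<in> P}"

lemma Sp_zero: "0 \<in> Sp M"
  unfolding Sp_def by (auto intro!: exI[of _ "\<lambda>_. 0"] simp: zero)

lemma Sp_add: "p \<in> Sp M \<Longrightarrow> q \<in> Sp M \<Longrightarrow> p + q \<in> Sp M"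
proof -
  assume "p \<in> Sp M" "q \<in> Sp M"
  then obtain c c' where "p - (\<Sum>w\<in>W M. mpoly_const (c w) * w) \<in> P"
    "q - (\<Sum>w\<in>W M. mpoly_const (c' w) * w) \<in> P" unfolding Sp_def by auto
  from add[OF this] show ?thesis unfolding Sp_def
    by (auto intro!: exI[of _ "\<lambda>w. c w + c' w"] simp: single_add sum.distrib algebra_simps)
qed

lemma Sp_sum: "(\<And>i. i \<in> A \<Longrightarrow> f i \<in> Sp M) \<Longrightarrow> sum f A \<in> Sp M"
  by (induction A rule: infinite_finite_induct) (auto intro: Sp_zero Sp_add)

lemma Sp_W: "w \<in> W M \<Longrightarrow> mpoly_const c * w \<in> Sp M"
proof -
  assume "w \<in> W M"
  have "(\<Sum>u\<in>W M. mpoly_const (if u = w then c else 0) * u) = (\<Sum>u\<in>W M. if u = w then mpoly_const c * w else 0)"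
    by (intro sum.cong) auto
  then have "mpoly_const c * w - (\<Sum>u\<in>W M. mpoly_const (if u = w then c else 0) * u) = 0"
    using \<open>w \<in> W M\<close> by (simp add: finite_W)
  then show ?thesis unfolding Sp_def using zero by (intro CollectI exI[of _ "\<lambda>u. if u = w then c else 0"]) simp
qed

lemma Sp_cong: "p - q \<in> P \<Longrightarrow> q \<in> Sp M \<Longrightarrow> p \<in> Sp M"
  unfolding Sp_def using diff_trans by blast

lemma Sp_mult:
  assumes "p \<in> Sp M" "q \<in> Sp M'"
  shows "p * q \<in> Sp (M + M')"
proof -
  obtain c c' where c: "p - (\<Sum>w\<in>W M. mpoly_const (c w) * w) \<in> P"
    "q - (\<Sum>w\<in>W M'. mpoly_const (c' w) * w) \<in> P" using assms unfolding Sp_def by auto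
  have "(\<Sum>w\<in>W M. mpoly_const (c w) * w) * (\<Sum>w\<in>W M'. mpoly_const (c' w) * w) =
      (\<Sum>w\<in>W M. \<Sum>w'\<in>W M'. mpoly_const (c w * c' w') * (w * w'))"
  proof -
    have "(mpoly_const x * w) * (mpoly_const y * w') = mpoly_const (x * y) * (w * w')" for x y and w w' :: "('v \<Rightarrow>\<^sub>0 nat) \<Rightarrow>\<^sub>0 'k"
    proof -
      have "mpoly_const (x * y) = (mpoly_const x * mpoly_const y :: ('v \<Rightarrow>\<^sub>0 nat) \<Rightarrow>\<^sub>0 'k)" by (simp add: mult_single)
      then show ?thesis by (simp only: mult.assoc mult.left_commute)
    qed
    then show ?thesis by (simp only: sum_product)
  qed
  also have "\<dots> \<in> Sp (M + M')"
    by (intro Sp_sum Sp_W W_mult)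
  finally show ?thesis using Sp_cong diff_mult[OF c] by blast
qed

lemma Sp_delta_power: "\<delta> ^ e \<in> Sp e"
proof (induction e)
  case 0
  show ?case using Sp_W[OF one_W, of 1] by simp
next
  case (Suc e)
  show ?case using Sp_mult[OF Sp_W[OF \<delta>_W, of 1] Suc] by simp
qed

text \<open>The condition \<open>\<delta> ^ e * p \<in> Sp e\<close> says that \<open>p\<close> is a
  fraction with denominator \<open>\<delta> ^ e\<close>. Since powers of \<open>\<delta>\<close> lie
  in the spans themselves, the exponent can be enlarged, which provides common denominators.\<close>

lemma Sp_raise: "\<delta> ^ e * p \<in> Sp e \<Longrightarrow> e \<le> e' \<Longrightarrow> \<delta> ^ e' * p \<in> Sp e'"
  using Sp_mult[OF Sp_delta_power[of "e' - e"], of "\<delta> ^ e * p" e]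
  by (simp add: mult.assoc[symmetric] power_add[symmetric])

lemma Sp_mult_raise: "\<delta> ^ e * p \<in> Sp e \<Longrightarrow> \<delta> ^ e' * q \<in> Sp e' \<Longrightarrow> \<delta> ^ (e + e') * (p * q) \<in> Sp (e + e')"
  using Sp_mult[of "\<delta> ^ e * p" e "\<delta> ^ e' * q" e'] by (simp add: power_add algebra_simps)

lemma Sp_power_raise: "\<delta> ^ e * p \<in> Sp e \<Longrightarrow> \<delta> ^ (e * a) * p ^ a \<in> Sp (e * a)"
proof (induction a)
  case 0
  then show ?case using Sp_delta_power[of 0] by simp
next
  case (Suc a)
  then show ?case using Sp_mult_raise[of e p "e * a" "p ^ a"] by simp
qed

end

text \<open>Every variable is a fraction with denominator \<open>\<delta>\<close> and numerator of
  degree 1, so every polynomial is a fraction with some power of \<open>\<delta>\<close> as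
  denominator. The locale is separate because its assumption speaks of \<open>Sp\<close>.\<close>

locale poly_growth = span_growth P \<delta> W d
  for P :: "(('v \<Rightarrow>\<^sub>0 nat) \<Rightarrow>\<^sub>0 'k::field) set" and \<delta> W d +
  assumes var_Sp: "\<And>v. \<delta> * mpoly_var v \<in> Sp 1"
begin

lemma Sp_exists: "\<exists>e. \<delta> ^ e * p \<in> Sp e"
proof (induction p rule: mpoly_induct)
  case zero
  then show ?case using Sp_zero by auto
next
  case (monomial \<mu> c)
  have "\<exists>e. \<delta> ^ e * (\<Prod>v\<in>S. mpoly_var v ^ Poly_Mapping.lookup \<mu> v) \<in> Sp e" if "finite S" for S
    using that
  proof induction
    case empty
    show ?case using Sp_delta_power[of 0] by (intro exI[of _ 0]) simp
  next
    case (insert v S)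
    then obtain e where "\<delta> ^ e * (\<Prod>v\<in>S. mpoly_var v ^ Poly_Mapping.lookup \<mu> v) \<in> Sp e" by auto
    moreover have "\<delta> ^ 1 * mpoly_var v \<in> Sp 1" using var_Sp[of v] by simp
    from Sp_power_raise[OF this]
    have "\<delta> ^ (1 * Poly_Mapping.lookup \<mu> v) * mpoly_var v ^ Poly_Mapping.lookup \<mu> v \<in> Sp (1 * Poly_Mapping.lookup \<mu> v)" .
    ultimately show ?case using insert.hyps Sp_mult_raise by (simp del: mult_1) blast
  qed
  then obtain e where e: "\<delta> ^ e * (\<Prod>v\<in>Poly_Mapping.keys \<mu>. mpoly_var v ^ Poly_Mapping.lookup \<mu> v) \<in> Sp e"
    by (meson finite_keys)
  have "\<delta> ^ 0 * mpoly_const c \<in> Sp 0" using Sp_W[OF one_W, of c] by simp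
  from Sp_mult_raise[OF this e] show ?case
    unfolding single_eq_var_prod[of \<mu> c] by (intro exI[of _ e]) simp
next
  case (add p q)
  then obtain e e' where "\<delta> ^ e * p \<in> Sp e" "\<delta> ^ e' * q \<in> Sp e'" by auto
  then have "\<delta> ^ (max e e') * p \<in> Sp (max e e')" "\<delta> ^ (max e e') * q \<in> Sp (max e e')"
    using Sp_raise by simp_all
  from Sp_add[OF this] show ?case by (auto simp: distrib_left)
qed

lemma Sp_exists_uniform: "\<exists>e. \<forall>p\<in>set ps. \<delta> ^ e * p \<in> Sp e"
proof (induction ps)
  case (Cons p ps)
  then obtain e where e: "\<forall>p\<in>set ps. \<delta> ^ e * p \<in> Sp e" by auto
  obtain e' where e': "\<delta> ^ e' * p \<in> Sp e'" using Sp_exists by blast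
  show ?case using e e' Sp_raise by (intro exI[of _ "max e e'"]) auto
qed simp

text \<open>Each factor \<open>f ^ a\<close> with \<open>a \<le> D\<close> costs at most
  \<open>e * D\<close> powers of \<open>\<delta>\<close>. The total is linear in \<open>D\<close>,
  as the count below requires.\<close>

lemma Sp_pmon:
  assumes "\<forall>p\<in>set fs. \<delta> ^ e * p \<in> Sp e" "\<alpha> \<in> expts (length fs) D"
  shows "\<delta> ^ (e * D * length fs) * pmon \<alpha> fs \<in> Sp (e * D * length fs)"
  using assms
proof (induction fs arbitrary: \<alpha>)
  case Nil
  then show ?case using Sp_delta_power[of 0] by simp
next
  case (Cons f fs)
  then obtain a \<beta> where \<alpha>: "\<alpha> = a # \<beta>" "a \<le> D" "\<beta> \<in> expts (length fs) D" by (auto simp: expts_Suc)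
  have "\<delta> ^ (e * D) * f ^ a \<in> Sp (e * D)"
    using Sp_raise[OF Sp_power_raise[of e f a]] Cons.prems \<alpha> by simp
  from Sp_mult_raise[OF this Cons.IH[of \<beta>]] show ?case using Cons.prems \<alpha> by (simp add: algebra_simps)
qed

text \<open>Were there more than \<open>d\<close> elements, their monomials with exponents up to a
  large \<open>D\<close> would outnumber the spanning set \<open>W M\<close> that holds them after
  multiplication by \<open>\<delta> ^ M\<close>, and a linear dependence would result.\<close>

theorem length_alg_indep_le:
  assumes "alg_indep_mod P fs"
  shows "length fs \<le> d"
proof (rule ccontr)
  let ?k = "length fs"
  assume "\<not> ?thesis"
  then have k: "d + 1 \<le> ?k" by simp
  obtain e where e: "\<forall>p\<in>set fs. \<delta> ^ e * p \<in> Sp e" using Sp_exists_uniform by blast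
  \<comment> \<open>Chosen so that, with k the length of \<open>fs\<close>, M + 1 \<le> (e k + 1) (D
    + 1) gives (M + 1)^d \<le> D (D + 1)^d, which is below (D + 1)^(d + 1).\<close>
  define D where "D = (e * ?k + 1) ^ d"
  define M where "M = e * D * ?k"
  have "(M + 1) ^ d \<le> ((e * ?k + 1) * (D + 1)) ^ d"
    unfolding M_def by (rule power_mono) (auto simp: algebra_simps)
  also have "\<dots> = (e * ?k + 1) ^ d * (D + 1) ^ d" by (rule power_mult_distrib)
  also have "(e * ?k + 1) ^ d = D" by (rule D_def[symmetric])
  also have "D * (D + 1) ^ d < (D + 1) * (D + 1) ^ d" by (rule mult_strict_right_mono) simp_all
  also have "\<dots> = (D + 1) ^ (d + 1)" by simp
  also have "\<dots> \<le> (D + 1) ^ ?k" by (rule power_increasing) (use k in auto)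
  finally have "(M + 1) ^ d < card (expts ?k D)" by (simp only: card_expts)
  then have small: "card (W M) < card (expts ?k D)" using card_W[of M] by linarith
  have "\<forall>\<alpha>. \<exists>c. \<alpha> \<in> expts ?k D \<longrightarrow> \<delta> ^ M * pmon \<alpha> fs - (\<Sum>w\<in>W M. mpoly_const (c w) * w) \<in> P"
    using Sp_pmon[OF e] unfolding Sp_def M_def by blast
  then obtain c where c: "\<And>\<alpha>. \<alpha> \<in> expts ?k D \<Longrightarrow> \<delta> ^ M * pmon \<alpha> fs - (\<Sum>w\<in>W M. mpoly_const (c \<alpha> w) * w) \<in> P"
    using choice[of "\<lambda>\<alpha> c. \<alpha> \<in> expts ?k D \<longrightarrow> \<delta> ^ M * pmon \<alpha> fs - (\<Sum>w\<in>W M. mpoly_const (c w) * w) \<in> P"]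
    by blast
  obtain b where b: "\<exists>\<alpha>\<in>expts ?k D. b \<alpha> \<noteq> 0"
    "\<forall>w\<in>W M. (\<Sum>\<alpha>\<in>expts ?k D. b \<alpha> * c \<alpha> w) = 0"
    using exists_nonzero_solution[OF finite_expts finite_W small, of c] by blast
  have "(\<Sum>\<alpha>\<in>expts ?k D. mpoly_const (b \<alpha>) * (\<delta> ^ M * pmon \<alpha> fs - (\<Sum>w\<in>W M. mpoly_const (c \<alpha> w) * w))) \<in> P"
    by (intro sum mult c)
  also have "(\<Sum>\<alpha>\<in>expts ?k D. mpoly_const (b \<alpha>) * (\<delta> ^ M * pmon \<alpha> fs - (\<Sum>w\<in>W M. mpoly_const (c \<alpha> w) * w))) =
      \<delta> ^ M * lcomb D b fs - (\<Sum>\<alpha>\<in>expts ?k D. \<Sum>w\<in>W M. mpoly_const (b \<alpha> * c \<alpha> w) * w)"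
  proof -
    have "mpoly_const (b \<alpha>) * (\<delta> ^ M * pmon \<alpha> fs - (\<Sum>w\<in>W M. mpoly_const (c \<alpha> w) * w)) =
        \<delta> ^ M * (mpoly_const (b \<alpha>) * pmon \<alpha> fs) - (\<Sum>w\<in>W M. mpoly_const (b \<alpha> * c \<alpha> w) * w)" for \<alpha>
    proof -
      have "mpoly_const (b \<alpha>) * (\<Sum>w\<in>W M. mpoly_const (c \<alpha> w) * w) =
          (\<Sum>w\<in>W M. mpoly_const (b \<alpha> * c \<alpha> w) * w)"
        unfolding sum_distrib_left mult.assoc[symmetric] by (simp add: mult_single)
      then show ?thesis by (simp only: right_diff_distrib mult.left_commute)
    qed
    then show ?thesis by (simp only: sum_subtractf lcomb_def sum_distrib_left)
  qed
  also have "(\<Sum>\<alpha>\<in>expts ?k D. \<Sum>w\<in>W M. mpoly_const (b \<alpha> * c \<alpha> w) * w) =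
      (\<Sum>w\<in>W M. mpoly_const (\<Sum>\<alpha>\<in>expts ?k D. b \<alpha> * c \<alpha> w) * w)"
  proof -
    interpret h: comm_ring_hom "mpoly_const :: 'k \<Rightarrow> ('v \<Rightarrow>\<^sub>0 nat) \<Rightarrow>\<^sub>0 'k" by (rule comm_ring_hom_mpoly_const)
    show ?thesis by (subst sum.swap) (simp only: h.hom_sum sum_distrib_right)
  qed
  also have "\<dots> = 0" using b(2) by simp
  \<comment> \<open>The power of \<open>\<delta>\<close> is outside the prime and cancels, leaving a
    nontrivial relation among the \<open>fs\<close>.\<close>
  finally have "lcomb D b fs \<in> P" using prime power_notin[OF \<delta>_notin] by auto
  then show False using assms b(1) unfolding alg_indep_mod_def by blast
qed

end

section \<open>Minors and Cramer's rule modulo a prime\<close>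

lemma det_not_inj_rows:
  assumes "\<not> inj_on f {..<k}"
  shows "det (mat k k (\<lambda>(i, j). H (f i) j)) = (0 :: 'a::comm_ring_1)"
proof -
  obtain i j where ij: "i < k" "j < k" "i \<noteq> j" "f i = f j" using assms by (auto simp: inj_on_def)
  then have "row (mat k k (\<lambda>(i, j). H (f i) j)) i = row (mat k k (\<lambda>(i, j). H (f i) j)) j"
    by (intro eq_vecI) auto
  then show ?thesis using Determinant.det_identical_rows[OF _ ij(3,1,2)] by (metis mat_carrier)
qed

lemma det_not_inj_cols:
  assumes "\<not> inj_on g {..<k}"
  shows "det (mat k k (\<lambda>(i, j). H i (g j))) = (0 :: 'a::comm_ring_1)"
proof -
  have "transpose_mat (mat k k (\<lambda>(i, j). H i (g j))) = mat k k (\<lambda>(i, j). H j (g i))"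
    by (intro eq_matI) auto
  then have "det (mat k k (\<lambda>(i, j). H i (g j))) = det (mat k k (\<lambda>(i, j). H j (g i)))"
    using det_transpose[of "mat k k (\<lambda>(i, j). H i (g j))" k] by simp
  also have "\<dots> = 0" using det_not_inj_rows[OF assms, where H = "\<lambda>a j. H j a"] by simp
  finally show ?thesis .
qed

text \<open>\<open>submatrix\<close> lists the chosen rows in increasing order, whereas
  \<open>f\<close> lists them in any order. The two differ by a permutation, hence by a
  sign.\<close>

lemma det_reindex_rows:
  fixes H :: "nat \<Rightarrow> nat \<Rightarrow> 'a::comm_ring_1"
  assumes "inj_on f {..<k}"
  shows "\<exists>p. det (mat k k (\<lambda>(i, j). H (f i) j)) =
    signof p * det (mat k k (\<lambda>(i, j). H (pick (f ` {..<k}) i) j))"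
proof -
  define I where "I = f ` {..<k}"
  \<comment> \<open>The rank of \<open>f i\<close> in the image is the position at which
    \<open>pick\<close> returns \<open>f i\<close>; beyond \<open>k\<close> the map is the identity,
    as \<open>permutes\<close> demands.\<close>
  define p where "p i = (if i < k then card {a\<in>I. a < f i} else i)" for i
  have I: "card I = k" "finite I" using assms by (auto simp: I_def card_image)
  have pick: "pick I (p i) = f i" if "i < k" for i
    using that pick_card_in_set[of "f i" I] by (auto simp: p_def I_def)
  have "p permutes {0..<k}"
  proof (rule inj_on_nat_permutes)
    show "inj_on p {0..<k}"
      using pick assms unfolding inj_on_def by (metis atLeastLessThan_iff lessThan_iff)
    show "p \<in> {0..<k} \<rightarrow> {0..<k}"
    proof
      fix i assume i: "i \<in> {0..<k}"
      then have "f i \<in> I" by (auto simp: I_def)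
      then have "{a\<in>I. a < f i} \<subset> I" by auto
      then have "card {a\<in>I. a < f i} < k" using psubset_card_mono[OF I(2)] I(1) by metis
      then show "p i \<in> {0..<k}" using i by (simp add: p_def)
    qed
  qed (auto simp: p_def)
  then have "det (mat k k (\<lambda>(i, j). mat k k (\<lambda>(i, j). H (pick I i) j) $$ (p i, j))) =
      signof p * det (mat k k (\<lambda>(i, j). H (pick I i) j))"
    by (intro det_permute_rows) auto
  also have "mat k k (\<lambda>(i, j). mat k k (\<lambda>(i, j). H (pick I i) j) $$ (p i, j)) = mat k k (\<lambda>(i, j). H (f i) j)"
    by (intro eq_matI) (use pick \<open>p permutes {0..<k}\<close> in \<open>auto simp: permutes_in_image[of p "{0..<k}", simplified]\<close>)
  finally show ?thesis unfolding I_def by blast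
qed

lemma det_reindex_cols:
  fixes H :: "nat \<Rightarrow> nat \<Rightarrow> 'a::comm_ring_1"
  assumes "inj_on g {..<k}"
  shows "\<exists>p. det (mat k k (\<lambda>(i, j). H i (g j))) =
    signof p * det (mat k k (\<lambda>(i, j). H i (pick (g ` {..<k}) j)))"
proof -
  have T: "det (mat k k (\<lambda>(i, j). H i (g j))) = det (mat k k (\<lambda>(i, j). H j (g i)))" for g
  proof -
    have "transpose_mat (mat k k (\<lambda>(i, j). H i (g j))) = mat k k (\<lambda>(i, j). H j (g i))"
      by (intro eq_matI) auto
    then show ?thesis using det_transpose[of "mat k k (\<lambda>(i, j). H i (g j))" k] by simp
  qed
  show ?thesis
    unfolding T using det_reindex_rows[OF assms, of "\<lambda>a j. H j a"] by simp
qed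

text \<open>Frees the minors from sorted index sets: a repeated row or column makes the determinant
  zero, and another order changes only the sign.\<close>

lemma (in ideal_set) det_in_ideal:
  assumes "minors k A \<subseteq> Q"
    and f: "f \<in> {..<k} \<rightarrow> {..<dim_row A}" and g: "g \<in> {..<k} \<rightarrow> {..<dim_col A}"
  shows "det (mat k k (\<lambda>(i, j). A $$ (f i, g j))) \<in> Q"
proof (cases "inj_on f {..<k} \<and> inj_on g {..<k}")
  case False
  then have "det (mat k k (\<lambda>(i, j). A $$ (f i, g j))) = 0"
    using det_not_inj_rows[of f k "\<lambda>a j. A $$ (a, g j)"] det_not_inj_cols[of g k "\<lambda>i b. A $$ (f i, b)"] by auto
  then show ?thesis using zero by simp
next
  case True
  let ?I = "f ` {..<k}" and ?J = "g ` {..<k}"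
  have card: "card ?I = k" "card ?J = k" using True by (auto simp: card_image)
  have sub: "?I \<subseteq> {..<dim_row A}" "?J \<subseteq> {..<dim_col A}" using f g by auto
  then have eq: "{i. i < dim_row A \<and> i \<in> ?I} = ?I" "{i. i < dim_col A \<and> i \<in> ?J} = ?J" by auto
  have "submatrix A ?I ?J = mat k k (\<lambda>(i, j). A $$ (pick ?I i, pick ?J j))"
    unfolding submatrix_def eq card ..
  moreover have "det (submatrix A ?I ?J) \<in> Q"
    using assms(1) sub card unfolding minors_def by blast
  moreover obtain p where "det (mat k k (\<lambda>(i, j). A $$ (f i, g j))) =
      signof p * det (mat k k (\<lambda>(i, j). A $$ (pick ?I i, g j)))"
    using det_reindex_rows[of f k "\<lambda>a j. A $$ (a, g j)"] True by auto
  moreover obtain q where "det (mat k k (\<lambda>(i, j). A $$ (pick ?I i, g j))) =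
      signof q * det (mat k k (\<lambda>(i, j). A $$ (pick ?I i, pick ?J j)))"
    using det_reindex_cols[of g k "\<lambda>i b. A $$ (pick ?I i, b)"] True by auto
  ultimately show ?thesis by (simp add: mult)
qed

text \<open>A Schur complement without division: multiplication by \<open>L\<close> clears the lower
  left block with the help of the adjugate. The common factor \<open>det M\<close> is the
  determinant of \<open>L\<close>; it is cancelled later, modulo a prime that does not contain
  it.\<close>

lemma bordered_det:
  fixes M :: "'a::idom mat"
  assumes M: "M \<in> carrier_mat k k" and u: "u \<in> carrier_mat k 1" and v: "v \<in> carrier_mat 1 k"
    and w: "w \<in> carrier_mat 1 1"
  shows "det M * det (four_block_mat M u v w) =
    det M * (det M * w $$ (0, 0) - (v * adj_mat M * u) $$ (0, 0))"
proof -
  note adj = adj_mat[OF M]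
  define L where "L = four_block_mat (1\<^sub>m k) (0\<^sub>m k 1) (- (v * adj_mat M)) (det M \<cdot>\<^sub>m 1\<^sub>m 1)"
  have va: "v * adj_mat M \<in> carrier_mat 1 k" using v adj(1) by simp
  have "L * four_block_mat M u v w = four_block_mat (1\<^sub>m k * M + 0\<^sub>m k 1 * v) (1\<^sub>m k * u + 0\<^sub>m k 1 * w)
      (- (v * adj_mat M) * M + (det M \<cdot>\<^sub>m 1\<^sub>m 1) * v) (- (v * adj_mat M) * u + (det M \<cdot>\<^sub>m 1\<^sub>m 1) * w)"
    unfolding L_def using va by (intro mult_four_block_mat[OF _ _ _ _ M u v w]) auto
  also have "1\<^sub>m k * M + 0\<^sub>m k 1 * v = M" using M v by simp
  also have "1\<^sub>m k * u + 0\<^sub>m k 1 * w = u" using u w by simp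
  also have "- (v * adj_mat M) * M + (det M \<cdot>\<^sub>m 1\<^sub>m 1) * v = 0\<^sub>m 1 k"
  proof -
    have "v * adj_mat M * M = v * (det M \<cdot>\<^sub>m 1\<^sub>m k)" using assoc_mult_mat[OF v adj(1) M] adj(3) by simp
    also have "\<dots> = det M \<cdot>\<^sub>m v" unfolding mult_smult_distrib[OF v one_carrier_mat] using v by simp
    finally have "- (v * adj_mat M) * M = - (det M \<cdot>\<^sub>m v)" using uminus_mult_left_mat va M by (metis carrier_matD)
    moreover have "(det M \<cdot>\<^sub>m 1\<^sub>m 1) * v = det M \<cdot>\<^sub>m v" using v by (simp add: mult_smult_assoc_mat[of _ 1 1])
    ultimately show ?thesis using v by (intro eq_matI) auto
  qed
  finally have prod: "L * four_block_mat M u v w =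
     four_block_mat M u (0\<^sub>m 1 k) (- (v * adj_mat M) * u + (det M \<cdot>\<^sub>m 1\<^sub>m 1) * w)" .
  have vu: "v * adj_mat M * u \<in> carrier_mat 1 1" using va u by simp
  have W: "- (v * adj_mat M) * u + (det M \<cdot>\<^sub>m 1\<^sub>m 1) * w \<in> carrier_mat 1 1"
    by (rule carrier_matI) (use va u w in simp_all)
  have "det (L * four_block_mat M u v w) = det L * det (four_block_mat M u v w)"
    by (rule det_mult[of _ "k + 1"]) (use va M w in \<open>auto simp: L_def intro!: four_block_carrier_mat\<close>)
  moreover have "det L = det M"
    unfolding L_def using va
    by (subst det_four_block_mat_upper_right_zero[of _ k _ 1]) (auto simp: det_single)
  moreover have "det (L * four_block_mat M u v w) =
      det M * det (- (v * adj_mat M) * u + (det M \<cdot>\<^sub>m 1\<^sub>m 1) * w)"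
    unfolding prod by (rule det_four_block_mat_lower_left_zero[OF M u _ W]) simp
  moreover have "det (- (v * adj_mat M) * u + (det M \<cdot>\<^sub>m 1\<^sub>m 1) * w) =
      det M * w $$ (0, 0) - (v * adj_mat M * u) $$ (0, 0)"
  proof -
    have "- (v * adj_mat M) * u = - (v * adj_mat M * u)"
      using uminus_mult_left_mat va u by (metis carrier_matD)
    moreover have "(det M \<cdot>\<^sub>m 1\<^sub>m 1) * w = det M \<cdot>\<^sub>m w" using w by (simp add: mult_smult_assoc_mat[of _ 1 1])
    ultimately show ?thesis using W vu w v u by (simp add: det_single)
  qed
  ultimately show ?thesis by argo
qed

lemma mat_mult_index_sum:
  "A \<in> carrier_mat a b \<Longrightarrow> B \<in> carrier_mat b c \<Longrightarrow> i < a \<Longrightarrow> j < c \<Longrightarrow>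
    (A * B) $$ (i, j) = (\<Sum>l<b. A $$ (i, l) * B $$ (l, j))"
  by (auto simp: scalar_prod_def lessThan_atLeast0 intro!: sum.cong)

text \<open>Take a minor of the last size at which some minor is outside \<open>Q\<close>. Bordering
  it by any row \<open>i\<close> and column \<open>j\<close> gives a determinant in
  \<open>Q\<close>, whose expansion expresses row \<open>i\<close> through the chosen rows. The
  final clause records that the coefficients of the chosen rows are trivial, so that they need not
  be counted.\<close>

lemma cramer_mod_prime:
  fixes Q :: "'a::idom set" and h :: "nat \<Rightarrow> nat \<Rightarrow> 'a"
  assumes "prime_set Q"
    and minors: "\<And>f g. f \<in> {..<k} \<rightarrow> {..<nr} \<Longrightarrow> g \<in> {..<k} \<rightarrow> {..<nc} \<Longrightarrow>
      det (mat k k (\<lambda>(i, j). h (f i) (g j))) \<in> Q"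
  shows "\<exists>\<rho> f \<Delta> c. \<rho> < k \<and> \<rho> \<le> nc \<and> inj_on f {..<\<rho>} \<and> f \<in> {..<\<rho>} \<rightarrow> {..<nr} \<and> \<Delta> \<notin> Q \<and>
    (\<forall>i<nr. \<forall>j<nc. \<Delta> * h i j - (\<Sum>l<\<rho>. c i l * h (f l) j) \<in> Q) \<and>
    (\<forall>l'<\<rho>. \<forall>l<\<rho>. c (f l') l = (if l' = l then \<Delta> else 0))"
proof -
  interpret prime_set Q by fact
  define bad where "bad k \<longleftrightarrow> (\<forall>f g. f \<in> {..<k} \<rightarrow> {..<nr} \<longrightarrow> g \<in> {..<k} \<rightarrow> {..<nc} \<longrightarrow>
      det (mat k k (\<lambda>(i, j). h (f i) (g j))) \<in> Q)" for k
  have "bad k" unfolding bad_def using minors by blast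
  moreover have "\<not> bad 0" using one_notin by (auto simp: bad_def)
  ultimately obtain \<rho> where \<rho>: "\<rho> < k" "\<not> bad \<rho>" "bad (Suc \<rho>)"
    using ex_least_nat_less[of bad k] by (metis le_less_Suc_eq less_Suc_eq_le nless_le order_refl)
  then obtain f g where fg: "f \<in> {..<\<rho>} \<rightarrow> {..<nr}" "g \<in> {..<\<rho>} \<rightarrow> {..<nc}"
    "det (mat \<rho> \<rho> (\<lambda>(i, j). h (f i) (g j))) \<notin> Q" unfolding bad_def by blast
  define M where "M = mat \<rho> \<rho> (\<lambda>(i, j). h (f i) (g j))"
  define \<Delta> where "\<Delta> = det M"
  have M: "M \<in> carrier_mat \<rho> \<rho>" by (simp add: M_def)
  have \<Delta>: "\<Delta> \<notin> Q" using fg by (simp add: \<Delta>_def M_def)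
  have inj: "inj_on f {..<\<rho>}" "inj_on g {..<\<rho>}"
    using fg(3) det_not_inj_rows[of f \<rho> "\<lambda>a j. h a (g j)"] det_not_inj_cols[of g \<rho> "\<lambda>i b. h (f i) b"] zero
    by metis+
  have "\<rho> \<le> nc" using card_inj_on_le[OF inj(2), of "{..<nc}"] fg(2) by (auto simp: image_subset_iff_funcset)
  define v where "v i = mat 1 \<rho> (\<lambda>(_, j). h i (g j))" for i
  define c where "c i l = (v i * adj_mat M) $$ (0, l)" for i l
  have v: "v i \<in> carrier_mat 1 \<rho>" for i by (simp add: v_def)
  have cramer: "\<Delta> * h i j - (\<Sum>l<\<rho>. c i l * h (f l) j) \<in> Q" if ij: "i < nr" "j < nc" for i j
  proof -
    define u where "u = mat \<rho> 1 (\<lambda>(l, _). h (f l) j)"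
    define w where "w = mat 1 1 (\<lambda>_. h i j)"
    have uw: "u \<in> carrier_mat \<rho> 1" "w \<in> carrier_mat 1 1" by (auto simp: u_def w_def)
    have "four_block_mat M u (v i) w = mat (Suc \<rho>) (Suc \<rho>) (\<lambda>(a, b). h ((f(\<rho> := i)) a) ((g(\<rho> := j)) b))"
      by (intro eq_matI) (auto simp: M_def u_def v_def w_def less_Suc_eq)
    moreover have "det (mat (Suc \<rho>) (Suc \<rho>) (\<lambda>(a, b). h ((f(\<rho> := i)) a) ((g(\<rho> := j)) b))) \<in> Q"
    proof -
      have "f(\<rho> := i) \<in> {..<Suc \<rho>} \<rightarrow> {..<nr}" "g(\<rho> := j) \<in> {..<Suc \<rho>} \<rightarrow> {..<nc}"
        using fg ij by (auto simp: less_Suc_eq)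
      then show ?thesis using \<rho>(3) unfolding bad_def by blast
    qed
    ultimately have "\<Delta> * (\<Delta> * w $$ (0, 0) - (v i * adj_mat M * u) $$ (0, 0)) \<in> Q"
      using bordered_det[OF M uw(1) v uw(2), of i] mult unfolding \<Delta>_def by metis
    then have "\<Delta> * w $$ (0, 0) - (v i * adj_mat M * u) $$ (0, 0) \<in> Q" using prime \<Delta> by blast
    moreover have "(v i * adj_mat M * u) $$ (0, 0) = (\<Sum>l<\<rho>. c i l * h (f l) j)"
    proof -
      have "v i * adj_mat M \<in> carrier_mat 1 \<rho>" using v adj_mat(1)[OF M] by (meson mult_carrier_mat)
      from mat_mult_index_sum[OF this uw(1), of 0 0] show ?thesis by (simp add: c_def u_def)
    qed
    ultimately show ?thesis by (simp add: w_def)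
  qed
  \<comment> \<open>For a chosen row, \<open>v (f l')\<close> is row \<open>l'\<close> of
    \<open>M\<close>, so the coefficients form a row of \<open>M * adj_mat M\<close>, a scalar
    matrix.\<close>
  have diag: "c (f l') l = (if l' = l then \<Delta> else 0)" if l: "l' < \<rho>" "l < \<rho>" for l l'
  proof -
    have "c (f l') l = (\<Sum>a<\<rho>. v (f l') $$ (0, a) * adj_mat M $$ (a, l))"
      unfolding c_def by (rule mat_mult_index_sum[OF v adj_mat(1)[OF M]]) (use l in auto)
    also have "\<dots> = (\<Sum>a<\<rho>. M $$ (l', a) * adj_mat M $$ (a, l))"
      by (intro sum.cong refl) (use l in \<open>auto simp: v_def M_def\<close>)
    also have "\<dots> = (M * adj_mat M) $$ (l', l)"
      by (rule mat_mult_index_sum[OF M adj_mat(1)[OF M], symmetric]) (use l in auto)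
    also have "\<dots> = (if l' = l then \<Delta> else 0)" unfolding adj_mat(2)[OF M] \<Delta>_def using l by simp
    finally show ?thesis .
  qed
  show ?thesis
    using \<rho>(1) \<open>\<rho> \<le> nc\<close> inj(1) fg(1) \<Delta> cramer diag by blast
qed

section \<open>Counting over a determinantal prime\<close>

text \<open>The monomials of total degree exactly \<open>M\<close> in \<open>g0\<close> and
  \<open>gs\<close>. Since \<open>g0\<close> only fills up the missing degree, it does not enter the
  exponent of the bound on their number.\<close>

fun hmons :: "'a::comm_ring_1 \<Rightarrow> 'a list \<Rightarrow> nat \<Rightarrow> 'a set" where
  "hmons g0 [] M = {g0 ^ M}"
| "hmons g0 (g # gs) M = (\<Union>a\<le>M. (\<lambda>p. g ^ a * p) ` hmons g0 gs (M - a))"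

lemma finite_hmons [simp]: "finite (hmons g0 gs M)"
  by (induction gs arbitrary: M) auto

lemma card_hmons: "card (hmons g0 gs M) \<le> (M + 1) ^ length gs"
proof (induction gs arbitrary: M)
  case (Cons g gs)
  have "card (hmons g0 (g # gs) M) \<le> (\<Sum>a\<le>M. card ((\<lambda>p. g ^ a * p) ` hmons g0 gs (M - a)))"
    by (simp add: card_UN_le)
  also have "\<dots> \<le> (\<Sum>a\<le>M. (M + 1) ^ length gs)"
  proof (rule sum_mono)
    fix a
    have "card ((\<lambda>p. g ^ a * p) ` hmons g0 gs (M - a)) \<le> card (hmons g0 gs (M - a))"
      by (rule card_image_le) simp
    also have "\<dots> \<le> (M - a + 1) ^ length gs" by (rule Cons)
    also have "\<dots> \<le> (M + 1) ^ length gs" by (rule power_mono) auto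
    finally show "card ((\<lambda>p. g ^ a * p) ` hmons g0 gs (M - a)) \<le> (M + 1) ^ length gs" .
  qed
  finally show ?case by simp
qed simp

lemma hmons_mult: "p \<in> hmons g0 gs M \<Longrightarrow> q \<in> hmons g0 gs M' \<Longrightarrow> p * q \<in> hmons g0 gs (M + M')"
proof (induction gs arbitrary: p q M M')
  case Nil
  then show ?case by (simp add: power_add)
next
  case (Cons g gs)
  then obtain a b p' q' where *: "a \<le> M" "b \<le> M'" "p = g ^ a * p'" "q = g ^ b * q'"
    "p' \<in> hmons g0 gs (M - a)" "q' \<in> hmons g0 gs (M' - b)" by auto
  have "p' * q' \<in> hmons g0 gs (M - a + (M' - b))" using Cons.IH * by blast
  also have "M - a + (M' - b) = M + M' - (a + b)" using * by simp
  finally have "p' * q' \<in> hmons g0 gs (M + M' - (a + b))" .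
  moreover have "p * q = g ^ (a + b) * (p' * q')" using * by (simp add: power_add algebra_simps)
  ultimately show ?case using * by (auto intro!: bexI[of _ "a + b"])
qed

lemma hmons_base: "g0 ^ M \<in> hmons g0 gs M"
  by (induction gs) (auto intro!: bexI[of _ 0] image_eqI)

lemma hmons_gen: "g \<in> set gs \<Longrightarrow> g \<in> hmons g0 gs 1"
proof (induction gs)
  case (Cons g' gs)
  show ?case
  proof (cases "g = g'")
    case True
    then show ?thesis using hmons_base[of g0 0 gs] by (auto intro!: bexI[of _ 1] image_eqI[of _ _ 1])
  next
    case False
    then show ?thesis using Cons by (auto intro!: bexI[of _ 0] image_eqI)
  qed
qed simp

text \<open>Homogeneous of degree \<open>M\<close> in \<open>\<Delta>1\<close> with
  \<open>cs\<close> and, separately, in \<open>\<Delta>2\<close> with \<open>ds\<close>. In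
  \<open>xs\<close> the filling element is 1, so only a degree bound remains. The product of the two
  minors thus has degree 1 and adds nothing to the exponent in the count.\<close>

definition hmons3 where
  "hmons3 \<Delta>1 cs \<Delta>2 ds xs M = (\<lambda>(p, q, z). p * q * z) ` (hmons \<Delta>1 cs M \<times> hmons \<Delta>2 ds M \<times> hmons 1 xs M)"

lemma hmons3_memI:
  "p \<in> hmons \<Delta>1 cs M \<Longrightarrow> q \<in> hmons \<Delta>2 ds M \<Longrightarrow> z \<in> hmons 1 xs M \<Longrightarrow> p * q * z \<in> hmons3 \<Delta>1 cs \<Delta>2 ds xs M"
  unfolding hmons3_def by (intro image_eqI[of _ _ "(p, q, z)"]) auto

lemma span_growth_hmons3:
  fixes P :: "(('v \<Rightarrow>\<^sub>0 nat) \<Rightarrow>\<^sub>0 'k::field) set"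
  assumes "prime_set P" "\<Delta>1 \<notin> P" "\<Delta>2 \<notin> P"
  shows "span_growth P (\<Delta>1 * \<Delta>2) (hmons3 \<Delta>1 cs \<Delta>2 ds xs) (length cs + length ds + length xs)"
proof -
  interpret prime_set P by fact
  show ?thesis
  proof
    show "\<Delta>1 * \<Delta>2 \<notin> P" using assms mult_notin by blast
    show "finite (hmons3 \<Delta>1 cs \<Delta>2 ds xs M)" for M by (simp add: hmons3_def)
    show "card (hmons3 \<Delta>1 cs \<Delta>2 ds xs M) \<le> (M + 1) ^ (length cs + length ds + length xs)" for M
    proof -
      have "card (hmons3 \<Delta>1 cs \<Delta>2 ds xs M) \<le> card (hmons \<Delta>1 cs M \<times> hmons \<Delta>2 ds M \<times> hmons (1 :: ('v \<Rightarrow>\<^sub>0 nat) \<Rightarrow>\<^sub>0 'k) xs M)"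
        unfolding hmons3_def by (rule card_image_le) simp
      also have "\<dots> = card (hmons \<Delta>1 cs M) * (card (hmons \<Delta>2 ds M) * card (hmons (1 :: ('v \<Rightarrow>\<^sub>0 nat) \<Rightarrow>\<^sub>0 'k) xs M))"
        by (simp only: card_cartesian_product)
      also have "\<dots> \<le> (M + 1) ^ length cs * ((M + 1) ^ length ds * (M + 1) ^ length xs)"
        by (intro mult_le_mono card_hmons)
      finally show ?thesis by (simp only: power_add mult.assoc)
    qed
    show "p * q \<in> hmons3 \<Delta>1 cs \<Delta>2 ds xs (M + M')"
      if "p \<in> hmons3 \<Delta>1 cs \<Delta>2 ds xs M" "q \<in> hmons3 \<Delta>1 cs \<Delta>2 ds xs M'" for p q M M'
    proof -
      obtain p1 p2 p3 where p: "p = p1 * p2 * p3" "p1 \<in> hmons \<Delta>1 cs M" "p2 \<in> hmons \<Delta>2 ds M" "p3 \<in> hmons 1 xs M"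
        using \<open>p \<in> _\<close> unfolding hmons3_def by auto
      obtain q1 q2 q3 where q: "q = q1 * q2 * q3" "q1 \<in> hmons \<Delta>1 cs M'" "q2 \<in> hmons \<Delta>2 ds M'" "q3 \<in> hmons 1 xs M'"
        using \<open>q \<in> _\<close> unfolding hmons3_def by auto
      have "p * q = (p1 * q1) * (p2 * q2) * (p3 * q3)" by (simp add: p q algebra_simps)
      then show ?thesis using hmons3_memI hmons_mult p q by metis
    qed
    show "1 \<in> hmons3 \<Delta>1 cs \<Delta>2 ds xs 0"
      using hmons3_memI[OF hmons_base[of \<Delta>1 0 cs] hmons_base[of \<Delta>2 0 ds] hmons_base[of 1 0 xs]] by simp
    show "\<Delta>1 * \<Delta>2 \<in> hmons3 \<Delta>1 cs \<Delta>2 ds xs 1"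
      using hmons3_memI[OF hmons_base[of \<Delta>1 1 cs] hmons_base[of \<Delta>2 1 ds] hmons_base[of 1 1 xs]] by simp
  qed
qed

text \<open>The growth count with denominator 1 and the variables of \<open>V\<close> as generators.
  It bounds the length of every chain of primes in the ring.\<close>

lemma alg_indep_le_card_vars:
  fixes P :: "(('v \<Rightarrow>\<^sub>0 nat) \<Rightarrow>\<^sub>0 'k::field) set"
  assumes "prime_set P" "finite V" "\<And>v. v \<notin> V \<Longrightarrow> mpoly_var v \<in> P" "alg_indep_mod P fs"
  shows "length fs \<le> card V"
proof -
  obtain vs where vs: "set vs = V" "distinct vs" using finite_distinct_list[OF assms(2)] by blast
  let ?xs = "map mpoly_var vs :: (('v \<Rightarrow>\<^sub>0 nat) \<Rightarrow>\<^sub>0 'k) list"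
  interpret prime_set P by fact
  interpret span_growth P "1 * 1" "hmons3 1 [] 1 [] ?xs" "card V"
    using span_growth_hmons3[OF assms(1) one_notin one_notin, of "[]" "[]" ?xs] vs distinct_card[of vs]
    by simp
  have "poly_growth P (1 * 1) (hmons3 1 [] 1 [] ?xs) (card V)"
  proof
    fix v
    show "1 * 1 * mpoly_var v \<in> Sp 1"
    proof (cases "v \<in> V")
      case True
      then have "mpoly_var v \<in> hmons 1 ?xs 1" using vs by (intro hmons_gen) auto
      then have "1 * 1 * mpoly_var v \<in> hmons3 1 [] 1 [] ?xs 1" by (intro hmons3_memI) auto
      from Sp_W[OF this, of 1] show ?thesis by simp
    next
      case False
      then show ?thesis using Sp_cong[OF _ Sp_zero] assms(3)[of v] by simp
    qed
  qed
  from poly_growth.length_alg_indep_le[OF this assms(4)] show ?thesis .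
qed

text \<open>Cramer's rule is applied twice: to the rows of the horizontal concatenation, and then to
  the columns of the vertical concatenation of the chosen rows alone. The second matrix has only
  \<open>r * \<rho>\<close> rows, whence \<open>\<sigma> \<le> r * \<rho>\<close>.\<close>

lemma alg_indep_le_determinantal:
  fixes P :: "((nat \<times> nat \<times> nat \<Rightarrow>\<^sub>0 nat) \<Rightarrow>\<^sub>0 'k::field) set"
  assumes "prime_set P"
    and outside: "\<And>v. v \<notin> {..<r} \<times> {..<m} \<times> {..<n} \<Longrightarrow> mpoly_var v \<in> P"
    and horiz: "minors s (horizontal_concat m n r (generic_matrix m n)) \<subseteq> P"
    and vert: "minors t (vertical_concat m n r (generic_matrix m n)) \<subseteq> P"
  shows "\<exists>\<rho> \<sigma>. \<rho> < s \<and> \<rho> \<le> m \<and> \<sigma> < t \<and> \<sigma> \<le> n \<and> \<sigma> \<le> r * \<rho> \<and>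
    (\<forall>fs. alg_indep_mod P fs \<longrightarrow> length fs \<le> (m - \<rho>) * \<rho> + (n - \<sigma>) * \<sigma> + r * \<rho> * \<sigma>)"
proof -
  interpret prime_set P by fact
  let ?H = "horizontal_concat m n r (generic_matrix m n) :: ((nat \<times> nat \<times> nat \<Rightarrow>\<^sub>0 nat) \<Rightarrow>\<^sub>0 'k) mat"
  let ?V = "vertical_concat m n r (generic_matrix m n) :: ((nat \<times> nat \<times> nat \<Rightarrow>\<^sub>0 nat) \<Rightarrow>\<^sub>0 'k) mat"
  define x :: "nat \<Rightarrow> nat \<Rightarrow> nat \<Rightarrow> (nat \<times> nat \<times> nat \<Rightarrow>\<^sub>0 nat) \<Rightarrow>\<^sub>0 'k" where "x q i j = mpoly_var (q, i, j)" for q i j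
  have dimH: "dim_row ?H = m" "dim_col ?H = r * n" by (auto simp: horizontal_concat_def)
  have dimV: "dim_row ?V = r * m" "dim_col ?V = n" by (auto simp: vertical_concat_def)
  have H: "?H $$ (i, c) = x (c div n) i (c mod n)" if "i < m" "c < r * n" for i c
  proof -
    have "n > 0" using that by (cases n) auto
    then show ?thesis using that by (simp add: horizontal_concat_def generic_matrix_def x_def)
  qed
  have V: "?V $$ (c, j) = x (c div m) (c mod m) j" if "c < r * m" "j < n" for c j
  proof -
    have "m > 0" using that by (cases m) auto
    then show ?thesis using that by (simp add: vertical_concat_def generic_matrix_def x_def)
  qed
  have "\<exists>\<rho> f \<Delta> c. \<rho> < s \<and> \<rho> \<le> r * n \<and> inj_on f {..<\<rho>} \<and> f \<in> {..<\<rho>} \<rightarrow> {..<m} \<and> \<Delta> \<notin> P \<and>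
    (\<forall>i<m. \<forall>j<r * n. \<Delta> * x (j div n) i (j mod n) - (\<Sum>l<\<rho>. c i l * x (j div n) (f l) (j mod n)) \<in> P) \<and>
    (\<forall>l'<\<rho>. \<forall>l<\<rho>. c (f l') l = (if l' = l then \<Delta> else 0))"
  proof (rule cramer_mod_prime[OF assms(1), where h = "\<lambda>i j. x (j div n) i (j mod n)"])
    fix f g :: "nat \<Rightarrow> nat" assume fg: "f \<in> {..<s} \<rightarrow> {..<m}" "g \<in> {..<s} \<rightarrow> {..<r * n}"
    have "mat s s (\<lambda>(i, j). x (g j div n) (f i) (g j mod n)) = mat s s (\<lambda>(i, j). ?H $$ (f i, g j))"
    proof (intro eq_matI, goal_cases)
      case (1 i j)
      then have "f i < m" "g j < r * n" using fg by auto
      then show ?case using 1 H[of "f i" "g j"] by simp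
    qed auto
    then show "det (mat s s (\<lambda>(i, j). x (g j div n) (f i) (g j mod n))) \<in> P"
      using det_in_ideal[OF horiz, of f g] fg by (simp add: dimH)
  qed
  then obtain \<rho> f \<Delta> c where 1: "\<rho> < s" "inj_on f {..<\<rho>}" "f \<in> {..<\<rho>} \<rightarrow> {..<m}" "\<Delta> \<notin> P"
    "\<And>i j. i < m \<Longrightarrow> j < r * n \<Longrightarrow> \<Delta> * x (j div n) i (j mod n) - (\<Sum>l<\<rho>. c i l * x (j div n) (f l) (j mod n)) \<in> P"
    "\<And>l' l. l' < \<rho> \<Longrightarrow> l < \<rho> \<Longrightarrow> c (f l') l = (if l' = l then \<Delta> else 0)"
    by blast
  \<comment> \<open>The index \<open>u\<close> encodes block \<open>u div \<rho>\<close> and chosen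
    row \<open>u mod \<rho>\<close>. The matrix is transposed, so that its columns are the ones
    expressed through \<open>\<sigma>\<close> of them.\<close>
  have "\<exists>\<sigma> f2 \<Delta>2 c2. \<sigma> < t \<and> \<sigma> \<le> r * \<rho> \<and> inj_on f2 {..<\<sigma>} \<and> f2 \<in> {..<\<sigma>} \<rightarrow> {..<n} \<and> \<Delta>2 \<notin> P \<and>
    (\<forall>j<n. \<forall>u<r * \<rho>. \<Delta>2 * x (u div \<rho>) (f (u mod \<rho>)) j - (\<Sum>l<\<sigma>. c2 j l * x (u div \<rho>) (f (u mod \<rho>)) (f2 l)) \<in> P) \<and>
    (\<forall>l'<\<sigma>. \<forall>l<\<sigma>. c2 (f2 l') l = (if l' = l then \<Delta>2 else 0))"
  proof (rule cramer_mod_prime[OF assms(1), where h = "\<lambda>j u. x (u div \<rho>) (f (u mod \<rho>)) j"])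
    fix a b :: "nat \<Rightarrow> nat" assume ab: "a \<in> {..<t} \<rightarrow> {..<n}" "b \<in> {..<t} \<rightarrow> {..<r * \<rho>}"
    \<comment> \<open>Translates \<open>u\<close> into a row of the full vertical concatenation, so
      that the determinants needed here come from its \<open>t\<close>-minors.\<close>
    define F where "F u = (u div \<rho>) * m + f (u mod \<rho>)" for u
    have F: "F u < r * m" "F u div m = u div \<rho>" "F u mod m = f (u mod \<rho>)" if "u < r * \<rho>" for u
    proof -
      have "\<rho> > 0" using that by (cases \<rho>) auto
      then have "f (u mod \<rho>) < m" using 1(3) by auto
      moreover have "u div \<rho> < r" using that \<open>\<rho> > 0\<close> by (simp add: less_mult_imp_div_less)
      ultimately show "F u div m = u div \<rho>" "F u mod m = f (u mod \<rho>)" by (auto simp: F_def)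
      have "F u < (u div \<rho> + 1) * m" using \<open>f (u mod \<rho>) < m\<close> by (simp add: F_def)
      also have "\<dots> \<le> r * m" using \<open>u div \<rho> < r\<close> by (intro mult_right_mono) auto
      finally show "F u < r * m" .
    qed
    have "mat t t (\<lambda>(i, j). ?V $$ ((F \<circ> b) i, a j)) = transpose_mat (mat t t (\<lambda>(i, j). x (b j div \<rho>) (f (b j mod \<rho>)) (a i)))"
    proof (intro eq_matI, goal_cases)
      case (1 i j)
      then have "b i < r * \<rho>" "a j < n" using ab by auto
      then show ?case using 1 by (simp add: V F)
    qed auto
    moreover have "det (mat t t (\<lambda>(i, j). ?V $$ ((F \<circ> b) i, a j))) \<in> P"
      using det_in_ideal[OF vert, of "F \<circ> b" a] ab F(1) by (force simp: dimV)
    ultimately show "det (mat t t (\<lambda>(i, j). x (b j div \<rho>) (f (b j mod \<rho>)) (a i))) \<in> P"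
      using det_transpose[of "mat t t (\<lambda>(i, j). x (b j div \<rho>) (f (b j mod \<rho>)) (a i))" t] by simp
  qed
  then obtain \<sigma> f2 \<Delta>2 c2 where 2: "\<sigma> < t" "\<sigma> \<le> r * \<rho>" "inj_on f2 {..<\<sigma>}" "f2 \<in> {..<\<sigma>} \<rightarrow> {..<n}" "\<Delta>2 \<notin> P"
    "\<And>j u. j < n \<Longrightarrow> u < r * \<rho> \<Longrightarrow> \<Delta>2 * x (u div \<rho>) (f (u mod \<rho>)) j - (\<Sum>l<\<sigma>. c2 j l * x (u div \<rho>) (f (u mod \<rho>)) (f2 l)) \<in> P"
    "\<And>l' l. l' < \<sigma> \<Longrightarrow> l < \<sigma> \<Longrightarrow> c2 (f2 l') l = (if l' = l then \<Delta>2 else 0)"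
    by blast
  have \<rho>m: "\<rho> \<le> m" using card_inj_on_le[OF 1(2), of "{..<m}"] 1(3) by (auto simp: image_subset_iff_funcset)
  have \<sigma>n: "\<sigma> \<le> n" using card_inj_on_le[OF 2(3), of "{..<n}"] 2(4) by (auto simp: image_subset_iff_funcset)
  have expand: "\<Delta> * \<Delta>2 * x q i j - (\<Sum>l<\<rho>. \<Sum>l'<\<sigma>. c i l * c2 j l' * x q (f l) (f2 l')) \<in> P"
    if "q < r" "i < m" "j < n" for q i j
  proof -
    have qj: "q * n + j < r * n"
    proof -
      have "q * n + j < (q + 1) * n" using that by simp
      also have "\<dots> \<le> r * n" using that by (intro mult_right_mono) auto
      finally show ?thesis .
    qed
    have A: "\<Delta> * x q i j - (\<Sum>l<\<rho>. c i l * x q (f l) j) \<in> P"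
      using 1(5)[OF that(2) qj] that by simp
    have B: "\<Delta>2 * x q (f l) j - (\<Sum>l'<\<sigma>. c2 j l' * x q (f l) (f2 l')) \<in> P" if l: "l < \<rho>" for l
    proof -
      have "q * \<rho> + l < (q + 1) * \<rho>" using l by simp
      also have "\<dots> \<le> r * \<rho>" using \<open>q < r\<close> by (intro mult_right_mono) auto
      finally show ?thesis using 2(6)[OF \<open>j < n\<close>, of "q * \<rho> + l"] l by simp
    qed
    have "\<Delta>2 * (\<Delta> * x q i j - (\<Sum>l<\<rho>. c i l * x q (f l) j)) +
        (\<Sum>l<\<rho>. c i l * (\<Delta>2 * x q (f l) j - (\<Sum>l'<\<sigma>. c2 j l' * x q (f l) (f2 l')))) \<in> P"
      by (intro add mult A sum B) auto
    also have "\<Delta>2 * (\<Delta> * x q i j - (\<Sum>l<\<rho>. c i l * x q (f l) j)) +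
        (\<Sum>l<\<rho>. c i l * (\<Delta>2 * x q (f l) j - (\<Sum>l'<\<sigma>. c2 j l' * x q (f l) (f2 l')))) =
        \<Delta> * \<Delta>2 * x q i j - (\<Sum>l<\<rho>. \<Sum>l'<\<sigma>. c i l * c2 j l' * x q (f l) (f2 l'))"
      by (simp add: right_diff_distrib sum_subtractf sum_distrib_left mult.assoc mult.left_commute)
    finally show ?thesis .
  qed
  \<comment> \<open>Coefficients at chosen rows or columns are zero or the minor itself; only those
    at the other indices count as generators. This is the source of the factors
    \<open>m - \<rho>\<close> and \<open>n - \<sigma>\<close>.\<close>
  define I where "I = ({..<m} - f ` {..<\<rho>}) \<times> {..<\<rho>}"
  define J where "J = ({..<n} - f2 ` {..<\<sigma>}) \<times> {..<\<sigma>}"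
  define K where "K = {..<r} \<times> {..<\<rho>} \<times> {..<\<sigma>}"
  have "card ({..<m} - f ` {..<\<rho>}) = m - \<rho>"
    using 1 by (subst card_Diff_subset) (auto simp: card_image)
  then have cI: "card I = (m - \<rho>) * \<rho>" by (simp add: I_def)
  have "card ({..<n} - f2 ` {..<\<sigma>}) = n - \<sigma>"
    using 2 by (subst card_Diff_subset) (auto simp: card_image)
  then have cJ: "card J = (n - \<sigma>) * \<sigma>" by (simp add: J_def)
  have cK: "card K = r * \<rho> * \<sigma>" by (simp add: K_def)
  obtain il where il: "set il = I" "length il = (m - \<rho>) * \<rho>"
    using finite_distinct_list[of I] distinct_card cI by (metis I_def finite_Diff finite_SigmaI finite_lessThan)
  obtain jl where jl: "set jl = J" "length jl = (n - \<sigma>) * \<sigma>"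
    using finite_distinct_list[of J] distinct_card cJ by (metis J_def finite_Diff finite_SigmaI finite_lessThan)
  obtain kl where kl: "set kl = K" "length kl = r * \<rho> * \<sigma>"
    using finite_distinct_list[of K] distinct_card cK by (metis K_def finite_SigmaI finite_lessThan)
  define cs where "cs = map (\<lambda>(i, l). c i l) il"
  define ds where "ds = map (\<lambda>(i, l). c2 i l) jl"
  define xs where "xs = map (\<lambda>(q, l, l'). x q (f l) (f2 l')) kl"
  have cmem: "c i l = 0 \<or> c i l \<in> hmons \<Delta> cs 1" if "i < m" "l < \<rho>" for i l
  proof (cases "i \<in> f ` {..<\<rho>}")
    case True
    then show ?thesis using 1(6) that hmons_base[of \<Delta> 1 cs] by auto
  next
    case False
    then have "c i l \<in> set cs" using that il by (force simp: cs_def I_def)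
    then show ?thesis using hmons_gen by blast
  qed
  have dmem: "c2 i l = 0 \<or> c2 i l \<in> hmons \<Delta>2 ds 1" if "i < n" "l < \<sigma>" for i l
  proof (cases "i \<in> f2 ` {..<\<sigma>}")
    case True
    then show ?thesis using 2(7) that hmons_base[of \<Delta>2 1 ds] by auto
  next
    case False
    then have "c2 i l \<in> set ds" using that jl by (force simp: ds_def J_def)
    then show ?thesis using hmons_gen by blast
  qed
  have xmem: "x q (f l) (f2 l') \<in> hmons 1 xs 1" if "q < r" "l < \<rho>" "l' < \<sigma>" for q l l'
    by (rule hmons_gen) (use that kl in \<open>force simp: xs_def K_def\<close>)
  interpret span_growth P "\<Delta> * \<Delta>2" "hmons3 \<Delta> cs \<Delta>2 ds xs" "length cs + length ds + length xs"
    by (rule span_growth_hmons3) (use assms 1 2 in auto)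
  have "poly_growth P (\<Delta> * \<Delta>2) (hmons3 \<Delta> cs \<Delta>2 ds xs) (length cs + length ds + length xs)"
  proof
    fix v :: "nat \<times> nat \<times> nat"
    obtain q i j where v: "v = (q, i, j)" by (cases v)
    show "\<Delta> * \<Delta>2 * mpoly_var v \<in> Sp 1"
    proof (cases "q < r \<and> i < m \<and> j < n")
      case True
      have "c i l * c2 j l' * x q (f l) (f2 l') \<in> Sp 1" if l: "l < \<rho>" "l' < \<sigma>" for l l'
      proof (cases "c i l = 0 \<or> c2 j l' = 0")
        case True
        then show ?thesis using Sp_zero by auto
      next
        case False
        then have "c i l * c2 j l' * x q (f l) (f2 l') \<in> hmons3 \<Delta> cs \<Delta>2 ds xs 1"
          using \<open>q < r \<and> i < m \<and> j < n\<close> l cmem dmem xmem by (intro hmons3_memI) blast+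
        from Sp_W[OF this, of 1] show ?thesis by simp
      qed
      then have "(\<Sum>l<\<rho>. \<Sum>l'<\<sigma>. c i l * c2 j l' * x q (f l) (f2 l')) \<in> Sp 1"
        by (intro Sp_sum) auto
      then show ?thesis using Sp_cong expand True unfolding v x_def by blast
    next
      case False
      then have "\<Delta> * \<Delta>2 * mpoly_var v \<in> P" using outside[of v] v mult by auto
      then show ?thesis using Sp_cong[OF _ Sp_zero] by simp
    qed
  qed
  then have "length fs \<le> length cs + length ds + length xs" if "alg_indep_mod P fs" for fs
    using poly_growth.length_alg_indep_le that by blast
  then show ?thesis
    using 1(1) \<rho>m 2(1,2) \<sigma>n unfolding cs_def ds_def xs_def length_map il jl kl by blast
qed

section \<open>Chains of primes below a given prime\<close>

lemma peval_closed:
  fixes h :: "'k::comm_ring_1 \<Rightarrow> 'a::comm_ring_1" and \<phi> :: "'v \<Rightarrow> 'a"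
  assumes "0 \<in> S" "1 \<in> S" "\<And>a b. a \<in> S \<Longrightarrow> b \<in> S \<Longrightarrow> a + b \<in> S" "\<And>a b. a \<in> S \<Longrightarrow> b \<in> S \<Longrightarrow> a * b \<in> S"
    and "\<And>c. h c \<in> S" "\<And>v. \<phi> v \<in> S"
  shows "peval h \<phi> p \<in> S"
proof -
  have pow: "a ^ k \<in> S" if "a \<in> S" for a k
    using that by (induction k) (use assms in auto)
  have prod: "(\<And>i. i \<in> A \<Longrightarrow> f i \<in> S) \<Longrightarrow> prod f A \<in> S" for f :: "'v \<Rightarrow> 'a" and A
    by (induction A rule: infinite_finite_induct) (auto intro: assms)
  have sum: "(\<And>i. i \<in> A \<Longrightarrow> f i \<in> S) \<Longrightarrow> sum f A \<in> S" for f :: "('v \<Rightarrow>\<^sub>0 nat) \<Rightarrow> 'a" and A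
    by (induction A rule: infinite_finite_induct) (auto intro: assms)
  show ?thesis unfolding peval_def by (intro sum assms(4) prod pow assms(5,6))
qed

lemma single_power:
  "(Poly_Mapping.single \<mu> (1::'c::comm_ring_1) :: 'm::comm_monoid_add \<Rightarrow>\<^sub>0 'c) ^ k =
    Poly_Mapping.single (\<Sum>i<k. \<mu>) 1"
  by (induction k) (auto simp: mult_single add.commute)

text \<open>\<open>split_vars U\<close> regards a polynomial as a polynomial in the variables outside \<open>U\<close> with
  coefficients in the variables from \<open>U\<close>.\<close>
definition split_vars :: "'v set \<Rightarrow> (('v \<Rightarrow>\<^sub>0 nat) \<Rightarrow>\<^sub>0 'k::field) \<Rightarrow>
    (('v \<Rightarrow>\<^sub>0 nat) \<Rightarrow>\<^sub>0 (('v \<Rightarrow>\<^sub>0 nat) \<Rightarrow>\<^sub>0 'k))" where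
  "split_vars U = peval (Poly_Mapping.single 0 \<circ> mpoly_const)
     (\<lambda>v. if v \<in> U then Poly_Mapping.single 0 (mpoly_var v) else Poly_Mapping.single (Poly_Mapping.single v 1) 1)"

lemma comm_ring_hom_comp: "comm_ring_hom f \<Longrightarrow> comm_ring_hom g \<Longrightarrow> comm_ring_hom (g \<circ> f)"
proof -
  assume "comm_ring_hom f" "comm_ring_hom g"
  interpret f: comm_ring_hom f by fact
  interpret g: comm_ring_hom g by fact
  show ?thesis by unfold_locales (auto simp: f.hom_add g.hom_add f.hom_mult g.hom_mult)
qed

lemma hom_split_coeff: "comm_ring_hom (Poly_Mapping.single 0 \<circ> mpoly_const ::
    'k::field \<Rightarrow> ('v \<Rightarrow>\<^sub>0 nat) \<Rightarrow>\<^sub>0 (('v \<Rightarrow>\<^sub>0 nat) \<Rightarrow>\<^sub>0 'k))"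
  by (rule comm_ring_hom_comp[OF comm_ring_hom_mpoly_const comm_ring_hom_single0])

lemma comm_ring_hom_split_vars: "comm_ring_hom (split_vars U)"
  unfolding split_vars_def by (rule comm_ring_hom_peval[OF hom_split_coeff])

lemma split_vars_var:
  "split_vars U (mpoly_var v) =
    (if v \<in> U then Poly_Mapping.single 0 (mpoly_var v) else Poly_Mapping.single (Poly_Mapping.single v 1) 1)"
  unfolding split_vars_def by (rule peval_var[OF hom_split_coeff])

lemma split_vars_const: "split_vars U (mpoly_const c) = Poly_Mapping.single 0 (mpoly_const c)"
  unfolding split_vars_def by (simp add: peval_const[OF hom_split_coeff])

text \<open>\<open>sub_poly U\<close> is the polynomial ring in the variables \<open>U\<close>.\<close>
definition sub_poly :: "'v set \<Rightarrow> (('v \<Rightarrow>\<^sub>0 nat) \<Rightarrow>\<^sub>0 'k::field) set" where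
  "sub_poly U = {p. split_vars U p = Poly_Mapping.single 0 p}"

text \<open>Membership is the agreement of two ring homomorphisms at a point, which makes the
  closure properties immediate.\<close>

lemma sub_poly_closed:
  "0 \<in> sub_poly U" "1 \<in> sub_poly U" "mpoly_const c \<in> sub_poly U"
  "a \<in> sub_poly U \<Longrightarrow> b \<in> sub_poly U \<Longrightarrow> a + b \<in> sub_poly U"
  "a \<in> sub_poly U \<Longrightarrow> b \<in> sub_poly U \<Longrightarrow> a * b \<in> sub_poly U"
  "v \<in> U \<Longrightarrow> mpoly_var v \<in> sub_poly U"
proof -
  interpret h: comm_ring_hom "split_vars U" by (rule comm_ring_hom_split_vars)
  show "0 \<in> sub_poly U" "1 \<in> sub_poly U" "mpoly_const c \<in> sub_poly U"
    "a \<in> sub_poly U \<Longrightarrow> b \<in> sub_poly U \<Longrightarrow> a + b \<in> sub_poly U"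
    "a \<in> sub_poly U \<Longrightarrow> b \<in> sub_poly U \<Longrightarrow> a * b \<in> sub_poly U"
    "v \<in> U \<Longrightarrow> mpoly_var v \<in> sub_poly U"
    by (auto simp: sub_poly_def h.hom_add h.hom_mult split_vars_var split_vars_const single_add mult_single)
qed

lemma sub_poly_power: "a \<in> sub_poly U \<Longrightarrow> a ^ k \<in> sub_poly U"
  by (induction k) (auto intro: sub_poly_closed)

lemma sub_poly_sum: "(\<And>i. i \<in> A \<Longrightarrow> f i \<in> sub_poly U) \<Longrightarrow> sum f A \<in> sub_poly U"
  by (induction A rule: infinite_finite_induct) (auto intro: sub_poly_closed)

lemma sub_poly_UNIV:
  fixes p :: "('v \<Rightarrow>\<^sub>0 nat) \<Rightarrow>\<^sub>0 'k::field"
  shows "p \<in> sub_poly UNIV"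
proof -
  have "(Poly_Mapping.single 0 p :: ('v \<Rightarrow>\<^sub>0 nat) \<Rightarrow>\<^sub>0 _) = Poly_Mapping.single 0 (peval mpoly_const mpoly_var p)"
    by (simp add: peval_id)
  also have "\<dots> = peval (Poly_Mapping.single 0 \<circ> mpoly_const) (Poly_Mapping.single 0 \<circ> mpoly_var) p"
    by (rule hom_peval[OF comm_ring_hom_single0])
  finally show ?thesis by (simp add: sub_poly_def split_vars_def comp_def)
qed

lemma split_vars_coeffs_sub_poly:
  fixes p :: "('v \<Rightarrow>\<^sub>0 nat) \<Rightarrow>\<^sub>0 'k::field"
  assumes "U \<subseteq> U'"
  shows "Poly_Mapping.lookup (split_vars U p) \<mu> \<in> sub_poly U'"
proof -
  let ?S = "{F :: ('v \<Rightarrow>\<^sub>0 nat) \<Rightarrow>\<^sub>0 (('v \<Rightarrow>\<^sub>0 nat) \<Rightarrow>\<^sub>0 'k). \<forall>\<mu>. Poly_Mapping.lookup F \<mu> \<in> sub_poly U'}"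
  have "split_vars U p \<in> ?S"
    unfolding split_vars_def
  proof (rule peval_closed)
    fix F G assume FG: "F \<in> ?S" "G \<in> ?S"
    show "F * G \<in> ?S"
      using FG by (auto simp: lookup_times_sum intro!: sub_poly_sum sub_poly_closed)
  qed (use assms in \<open>auto simp: lookup_add lookup_one lookup_single when_def intro: sub_poly_closed\<close>)
  then show ?thesis by blast
qed

lemma sub_poly_mono: "U \<subseteq> U' \<Longrightarrow> p \<in> sub_poly U \<Longrightarrow> p \<in> sub_poly U'"
  using split_vars_coeffs_sub_poly[of U U' p 0] by (simp add: sub_poly_def)

text \<open>The ideal generated by the contraction of \<open>P\<close> to the polynomials in
  \<open>U\<close>: the coefficients are themselves such polynomials, so lying in \<open>P\<close>
  means lying in the contraction. In this form primality follows from
  \<open>prime_set_coeffs\<close>.\<close>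

definition contract_extend :: "(('v \<Rightarrow>\<^sub>0 nat) \<Rightarrow>\<^sub>0 'k::field) set \<Rightarrow> 'v set \<Rightarrow> (('v \<Rightarrow>\<^sub>0 nat) \<Rightarrow>\<^sub>0 'k) set" where
  "contract_extend P U = {p. \<forall>\<mu>. Poly_Mapping.lookup (split_vars U p) \<mu> \<in> P}"

lemma prime_contract_extend:
  fixes P :: "(('v::linorder \<Rightarrow>\<^sub>0 nat) \<Rightarrow>\<^sub>0 'k::field) set"
  assumes "prime_set P"
  shows "prime_set (contract_extend P U)"
proof -
  have "contract_extend P U = split_vars U -` {F. \<forall>\<mu>. Poly_Mapping.lookup F \<mu> \<in> P}"
    by (auto simp: contract_extend_def)
  then show ?thesis
    using prime_set_vimage[OF comm_ring_hom_split_vars prime_set_coeffs[OF assms]] by simp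
qed

lemma contract_extend_sub_poly:
  assumes "prime_set P" "p \<in> sub_poly U"
  shows "p \<in> contract_extend P U \<longleftrightarrow> p \<in> P"
  using assms prime_set.axioms(1)[OF assms(1)] ideal_set.zero[of P]
  by (auto simp: contract_extend_def sub_poly_def lookup_single when_def dest: spec[of _ 0])

lemma merge_split_vars:
  fixes p :: "('v \<Rightarrow>\<^sub>0 nat) \<Rightarrow>\<^sub>0 'k::field"
  shows "peval id mpoly_var (split_vars U p) = p"
proof -
  have id: "comm_ring_hom (id :: (('v \<Rightarrow>\<^sub>0 nat) \<Rightarrow>\<^sub>0 'k) \<Rightarrow> _)" by unfold_locales auto
  have "peval id mpoly_var (split_vars U p) =
      peval (peval id mpoly_var \<circ> (Poly_Mapping.single 0 \<circ> mpoly_const)) (peval id mpoly_var \<circ>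
        (\<lambda>v. if v \<in> U then Poly_Mapping.single 0 (mpoly_var v) else Poly_Mapping.single (Poly_Mapping.single v 1) 1)) p"
    unfolding split_vars_def by (rule hom_peval[OF comm_ring_hom_peval[OF id]])
  also have "\<dots> = peval mpoly_const mpoly_var p"
  proof -
    have "peval id mpoly_var \<circ> (Poly_Mapping.single 0 \<circ> mpoly_const) = (mpoly_const :: 'k \<Rightarrow> ('v \<Rightarrow>\<^sub>0 nat) \<Rightarrow>\<^sub>0 'k)"
      by (auto simp: peval_const[OF id])
    moreover have "peval id mpoly_var \<circ>
        (\<lambda>v. if v \<in> U then Poly_Mapping.single 0 (mpoly_var v) else Poly_Mapping.single (Poly_Mapping.single v 1) 1) =
        (mpoly_var :: 'v \<Rightarrow> ('v \<Rightarrow>\<^sub>0 nat) \<Rightarrow>\<^sub>0 'k)"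
      by (rule ext) (simp add: peval_const[OF id] peval_single_var[OF id, unfolded One_nat_def])
    ultimately show ?thesis by simp
  qed
  finally show ?thesis by (simp add: peval_id)
qed

text \<open>The coefficients over \<open>U\<close> are polynomials in \<open>U'\<close> that lie in
  \<open>P\<close>, hence in the larger ideal, and \<open>p\<close> is recovered from them by
  substituting the variables back.\<close>

lemma contract_extend_mono:
  fixes P :: "(('v::linorder \<Rightarrow>\<^sub>0 nat) \<Rightarrow>\<^sub>0 'k::field) set"
  assumes "prime_set P" "U \<subseteq> U'"
  shows "contract_extend P U \<subseteq> contract_extend P U'"
proof
  fix p assume p: "p \<in> contract_extend P U"
  interpret C: prime_set "contract_extend P U'" by (rule prime_contract_extend[OF assms(1)])
  have "Poly_Mapping.lookup (split_vars U p) \<mu> \<in> contract_extend P U'" for \<mu>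
    using p contract_extend_sub_poly[OF assms(1) split_vars_coeffs_sub_poly[OF assms(2)]]
    by (simp add: contract_extend_def)
  then have "peval id mpoly_var (split_vars U p) \<in> contract_extend P U'"
    unfolding peval_def by (auto intro!: C.sum C.mult')
  then show "p \<in> contract_extend P U'" by (simp add: merge_split_vars)
qed

lemma lcomb_sub_poly:
  assumes "set fs \<subseteq> sub_poly U"
  shows "lcomb D b fs \<in> sub_poly U"
proof -
  have "pmon \<alpha> fs \<in> sub_poly U" for \<alpha>
    using assms by (induction \<alpha> fs rule: pmon.induct) (auto intro: sub_poly_closed sub_poly_power)
  then show ?thesis unfolding lcomb_def by (intro sub_poly_sum sub_poly_closed)
qed

text \<open>A relation for \<open>v\<close> and \<open>fs\<close> is a polynomial in
  \<open>insert v U\<close> lying in \<open>P\<close>. If \<open>v\<close> does not enlarge the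
  extended contraction, the coefficients of the powers of \<open>v\<close> already lie in
  \<open>P\<close>, and these are relations among the \<open>fs\<close>.\<close>

lemma alg_indep_mod_var:
  fixes P :: "(('v::linorder \<Rightarrow>\<^sub>0 nat) \<Rightarrow>\<^sub>0 'k::field) set"
  assumes P: "prime_set P" and "v \<notin> U" and eq: "contract_extend P (insert v U) = contract_extend P U"
    and fs: "set fs \<subseteq> sub_poly U" "alg_indep_mod P fs"
  shows "alg_indep_mod P (mpoly_var v # fs)"
  unfolding alg_indep_mod_def
proof (intro allI impI)
  fix D b
  let ?G = "\<lambda>a. lcomb D (\<lambda>\<alpha>. b (a # \<alpha>)) fs"
  let ?p = "lcomb D b (mpoly_var v # fs)"
  interpret h: comm_ring_hom "split_vars U" by (rule comm_ring_hom_split_vars)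
  assume "?p \<in> P"
  moreover have "set (mpoly_var v # fs) \<subseteq> sub_poly (insert v U)"
    using fs(1) sub_poly_mono[of U "insert v U"] sub_poly_closed(6)[of v "insert v U"] by auto
  then have "?p \<in> sub_poly (insert v U)" by (rule lcomb_sub_poly)
  ultimately have "?p \<in> contract_extend P U"
    using contract_extend_sub_poly[OF P] eq by blast
  then have coeffs: "Poly_Mapping.lookup (split_vars U ?p) \<mu> \<in> P" for \<mu>
    by (simp add: contract_extend_def)
  have G: "split_vars U (?G a) = Poly_Mapping.single 0 (?G a)" for a
    using lcomb_sub_poly[OF fs(1)] by (simp add: sub_poly_def)
  have sum_single: "(\<Sum>i<a. Poly_Mapping.single v (1::nat)) = Poly_Mapping.single v a" for a
    by (induction a) (auto simp: single_add[symmetric])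
  have "split_vars U ?p = (\<Sum>a\<le>D. Poly_Mapping.single (Poly_Mapping.single v a) (?G a))"
    unfolding lcomb_Cons h.hom_sum h.hom_mult h.hom_power G split_vars_var
    using \<open>v \<notin> U\<close> sum_single by (simp add: single_power mult_single)
  then have "Poly_Mapping.lookup (split_vars U ?p) (Poly_Mapping.single v a) = ?G a" if "a \<le> D" for a
    using that by (simp add: lookup_sum lookup_single when_def inj_single[THEN inj_eq])
  then have "?G a \<in> P" if "a \<le> D" for a
    using coeffs[of "Poly_Mapping.single v a"] that by simp
  then have "\<forall>\<alpha>\<in>expts (length fs) D. b (a # \<alpha>) = 0" if "a \<le> D" for a
    using fs(2) that unfolding alg_indep_mod_def by blast
  then show "\<forall>\<alpha>\<in>expts (length (mpoly_var v # fs)) D. b \<alpha> = 0"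
    by (auto simp: expts_Suc)
qed

text \<open>Each variable is charged once: either it enlarges the extended contraction and lengthens
  the chain, or it joins the independent elements. Which variables occur in \<open>fs\<close> is
  tracked because \<open>alg_indep_mod_var\<close> needs it.\<close>

lemma prime_chain_below_aux:
  fixes P :: "(('v::linorder \<Rightarrow>\<^sub>0 nat) \<Rightarrow>\<^sub>0 'k::field) set"
  assumes P: "prime_set P" and "distinct vs" "set vs \<inter> U = {}"
  shows "\<exists>fs n Q. n + length fs = length vs \<and> alg_indep_mod P fs \<and> set fs \<subseteq> sub_poly (U \<union> set vs) \<and>
    Q n = contract_extend P (U \<union> set vs) \<and>
    (\<forall>i\<le>n. prime_set (Q i) \<and> contract_extend P U \<subseteq> Q i) \<and> (\<forall>i<n. Q i \<subset> Q (Suc i))"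
  using assms(2,3)
proof (induction vs)
  case Nil
  show ?case
    by (rule exI[of _ "[]"], rule exI[of _ 0], rule exI[of _ "\<lambda>_. contract_extend P U"])
       (auto simp: alg_indep_mod_Nil[OF P] prime_contract_extend[OF P])
next
  case (Cons v vs)
  let ?U = "U \<union> set vs"
  obtain fs n Q where IH: "n + length fs = length vs" "alg_indep_mod P fs" "set fs \<subseteq> sub_poly ?U"
    "Q n = contract_extend P ?U" "\<forall>i\<le>n. prime_set (Q i) \<and> contract_extend P U \<subseteq> Q i" "\<forall>i<n. Q i \<subset> Q (Suc i)"
    using Cons by auto
  have U': "U \<union> set (v # vs) = insert v ?U" "v \<notin> ?U" using Cons.prems by auto
  show ?case
  proof (cases "contract_extend P (insert v ?U) = contract_extend P ?U")
    case True
    have "alg_indep_mod P (mpoly_var v # fs)"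
      by (rule alg_indep_mod_var[OF P U'(2) True IH(3,2)])
    moreover have "set (mpoly_var v # fs) \<subseteq> sub_poly (insert v ?U)"
      using IH(3) sub_poly_mono[of ?U "insert v ?U"] sub_poly_closed(6)[of v "insert v ?U"] by auto
    ultimately show ?thesis unfolding U' using IH True
      by (intro exI[of _ "mpoly_var v # fs"] exI[of _ n] exI[of _ Q]) auto
  next
    case False
    have sub: "contract_extend P ?U \<subset> contract_extend P (insert v ?U)"
      using False contract_extend_mono[OF P, of ?U "insert v ?U"] by auto
    have "contract_extend P U \<subseteq> contract_extend P (insert v ?U)"
      by (rule contract_extend_mono[OF P]) auto
    moreover have "set fs \<subseteq> sub_poly (insert v ?U)"
    proof
      fix f assume "f \<in> set fs"
      then have "f \<in> sub_poly ?U" using IH(3) by (rule subsetD[rotated])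
      then show "f \<in> sub_poly (insert v ?U)" by (rule sub_poly_mono[OF subset_insertI])
    qed
    moreover define Q' where "Q' = Q(Suc n := contract_extend P (insert v ?U))"
    have Q'_Suc: "Q' (Suc n) = contract_extend P (insert v ?U)" by (simp add: Q'_def)
    have Q'_le: "Q' i = Q i" if "i \<le> n" for i using that by (simp add: Q'_def)
    moreover have "\<forall>i\<le>Suc n. prime_set (Q' i) \<and> contract_extend P U \<subseteq> Q' i"
    proof (intro allI impI)
      fix i assume "i \<le> Suc n"
      then consider "i = Suc n" | "i \<le> n" by linarith
      then show "prime_set (Q' i) \<and> contract_extend P U \<subseteq> Q' i"
      proof cases
        case 1
        then show ?thesis using Q'_Suc prime_contract_extend[OF P] calculation(1) by simp
      next
        case 2
        then show ?thesis using Q'_le IH(5) by simp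
      qed
    qed
    moreover have "\<forall>i<Suc n. Q' i \<subset> Q' (Suc i)"
    proof (intro allI impI)
      fix i assume "i < Suc n"
      then consider "i = n" | "i < n" by linarith
      then show "Q' i \<subset> Q' (Suc i)"
        by cases (use Q'_Suc Q'_le sub IH(4,6) in simp_all)
    qed
    ultimately show ?thesis unfolding U' using IH(1,2) Q'_Suc
      by (intro exI[of _ fs] exI[of _ "Suc n"] exI[of _ Q'] conjI) simp_all
  qed
qed

lemma chain_mono:
  assumes "\<forall>i<n. Q i \<subset> Q (Suc i)" "i \<le> j" "j \<le> n"
  shows "Q i \<subseteq> Q j"
  using assms(2,3) by (induction j rule: dec_induct) (use assms(1) in \<open>auto simp: Suc_le_eq\<close>)

text \<open>Starting the process at \<open>- V\<close> puts the outside variables into the bottom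
  prime, and so into all of them; the process ends with all variables, where the extended
  contraction is \<open>P\<close> itself.\<close>

theorem prime_chain_below:
  fixes P :: "(('v::linorder \<Rightarrow>\<^sub>0 nat) \<Rightarrow>\<^sub>0 'k::field) set"
  assumes P: "prime_set P" and "finite V" and out: "\<And>v. v \<notin> V \<Longrightarrow> mpoly_var v \<in> P"
  shows "\<exists>fs n Q. n + length fs = card V \<and> alg_indep_mod P fs \<and>
    (\<forall>i\<le>n. prime_set (Q i) \<and> Q i \<subseteq> P \<and> (\<forall>v. v \<notin> V \<longrightarrow> mpoly_var v \<in> Q i)) \<and> (\<forall>i<n. Q i \<subset> Q (Suc i))"
proof -
  obtain vs where vs: "set vs = V" "distinct vs" using finite_distinct_list[OF assms(2)] by blast
  obtain fs n Q where *: "n + length fs = length vs" "alg_indep_mod P fs"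
    "Q n = contract_extend P (- V \<union> set vs)"
    "\<forall>i\<le>n. prime_set (Q i) \<and> contract_extend P (- V) \<subseteq> Q i" "\<forall>i<n. Q i \<subset> Q (Suc i)"
    using prime_chain_below_aux[OF P vs(2), of "- V"] vs by auto
  have "Q n = contract_extend P UNIV" using * vs by simp
  then have "Q n = P" using contract_extend_sub_poly[OF P sub_poly_UNIV] by auto
  then have "Q i \<subseteq> P" if "i \<le> n" for i using chain_mono[OF *(5) that] by auto
  moreover have "mpoly_var v \<in> contract_extend P (- V)" if "v \<notin> V" for v
    using contract_extend_sub_poly[OF P sub_poly_closed(6)[of v "- V"]] out that by auto
  moreover have "length vs = card V" using vs distinct_card by metis
  ultimately show ?thesis using * by (intro exI[of _ fs] exI[of _ n] exI[of _ Q]) (auto 4 4)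
qed

section \<open>Chains of primes above the kernel of a parametrization\<close>

definition kill :: "'v set \<Rightarrow> (('v \<Rightarrow>\<^sub>0 nat) \<Rightarrow>\<^sub>0 'k::field) \<Rightarrow> ('v \<Rightarrow>\<^sub>0 nat) \<Rightarrow>\<^sub>0 'k" where
  "kill E = peval mpoly_const (\<lambda>v. if v \<in> E then 0 else mpoly_var v)"

lemma comm_ring_hom_kill: "comm_ring_hom (kill E)"
  unfolding kill_def by (rule comm_ring_hom_peval[OF comm_ring_hom_mpoly_const])

lemma kill_var: "kill E (mpoly_var v) = (if v \<in> E then 0 else mpoly_var v)"
  unfolding kill_def by (rule peval_var[OF comm_ring_hom_mpoly_const])

lemma kill_const: "kill E (mpoly_const c) = mpoly_const c"
  unfolding kill_def by (rule peval_const[OF comm_ring_hom_mpoly_const])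

lemma kill_kill: "E \<subseteq> E' \<Longrightarrow> kill E' (kill E p) = kill E' p"
proof -
  assume "E \<subseteq> E'"
  then have eq: "kill E' \<circ> (\<lambda>v. if v \<in> E then 0 else mpoly_var v) =
      (\<lambda>v. if v \<in> E' then 0 else mpoly_var v :: ('a \<Rightarrow>\<^sub>0 nat) \<Rightarrow>\<^sub>0 'b)"
  proof -
    interpret k: comm_ring_hom "kill E' :: (('a \<Rightarrow>\<^sub>0 nat) \<Rightarrow>\<^sub>0 'b) \<Rightarrow> _" by (rule comm_ring_hom_kill)
    show ?thesis using \<open>E \<subseteq> E'\<close> by (intro ext) (auto simp: kill_var)
  qed
  have "kill E' (kill E p) = peval (kill E' \<circ> mpoly_const) (kill E' \<circ> (\<lambda>v. if v \<in> E then 0 else mpoly_var v)) p"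
    unfolding kill_def[of E] by (rule hom_peval[OF comm_ring_hom_kill])
  also have "\<dots> = kill E' p"
    unfolding eq by (simp add: comp_def kill_const kill_def[symmetric, abs_def])
  finally show ?thesis .
qed

text \<open>The primes are the kernels of \<open>\<psi>\<close> followed by setting the first
  \<open>j\<close> variables of \<open>ys\<close> to zero. As \<open>\<psi>\<close> need not be
  onto, strictness is not automatic, and a witness in its image is required for each step.\<close>

lemma prime_chain_above:
  fixes \<psi> :: "'a::comm_ring_1 \<Rightarrow> ('w::linorder \<Rightarrow>\<^sub>0 nat) \<Rightarrow>\<^sub>0 'k::field"
  assumes \<psi>: "comm_ring_hom \<psi>"
    and e: "\<And>j. j < length ys \<Longrightarrow> \<exists>e. kill (set (take j ys)) (\<psi> e) \<noteq> 0 \<and> kill (set (take (Suc j) ys)) (\<psi> e) = 0"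
  shows "\<exists>P. (\<forall>j\<le>length ys. prime_set (P j) \<and> {p. \<psi> p = 0} \<subseteq> P j) \<and> (\<forall>j<length ys. P j \<subset> P (Suc j))"
proof (intro exI[of _ "\<lambda>j. (kill (set (take j ys)) \<circ> \<psi>) -` {0}"] conjI allI impI)
  fix j
  interpret k: comm_ring_hom "kill (set (take j ys)) :: (('w \<Rightarrow>\<^sub>0 nat) \<Rightarrow>\<^sub>0 'k) \<Rightarrow> _" by (rule comm_ring_hom_kill)
  show "prime_set ((kill (set (take j ys)) \<circ> \<psi>) -` {0})"
    by (rule prime_set_vimage[OF comm_ring_hom_comp[OF \<psi> comm_ring_hom_kill] prime_set_zero])
  show "{p. \<psi> p = 0} \<subseteq> (kill (set (take j ys)) \<circ> \<psi>) -` {0}" by auto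
  assume j: "j < length ys"
  have "set (take j ys) \<subseteq> set (take (Suc j) ys)" by (rule set_take_subset_set_take) simp
  then have "kill (set (take (Suc j) ys)) (\<psi> p) = 0" if "kill (set (take j ys)) (\<psi> p) = 0" for p
  proof -
    interpret k': comm_ring_hom "kill (set (take (Suc j) ys)) :: (('w \<Rightarrow>\<^sub>0 nat) \<Rightarrow>\<^sub>0 'k) \<Rightarrow> _" by (rule comm_ring_hom_kill)
    show ?thesis using kill_kill[OF \<open>set (take j ys) \<subseteq> _\<close>, of "\<psi> p"] that by simp
  qed
  then show "(kill (set (take j ys)) \<circ> \<psi>) -` {0} \<subset> (kill (set (take (Suc j) ys)) \<circ> \<psi>) -` {0}"
    using e[OF j] by auto
qed

section \<open>A parametrized component\<close>

text \<open>Generic matrices of horizontal rank \<open>a\<close> and vertical rank \<open>b\<close> have, up to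
  row and column permutations, the form \<open>X\<^sub>q = A Y\<^sub>q B\<close>, where the \<open>a\<close> columns of \<open>A\<close> and the \<open>b\<close>
  rows of \<open>B\<close> start with an identity block. The entries of \<open>Y\<^sub>q\<close> are the variables
  \<open>(q, k, l)\<close>; the free entries of \<open>A\<close> and \<open>B\<close> are the variables \<open>(r, i, k)\<close> and \<open>(r + 1, l, j)\<close>,
  which do not occur in the generic matrices number \<open>0, ..., r - 1\<close>.\<close>

type_synonym 'k gpoly = "(nat \<times> nat \<times> nat \<Rightarrow>\<^sub>0 nat) \<Rightarrow>\<^sub>0 'k"

definition row_coeff :: "nat \<Rightarrow> nat \<Rightarrow> nat \<Rightarrow> nat \<Rightarrow> 'k::field gpoly" where
  "row_coeff r a i k = (if i < a then (if i = k then 1 else 0) else mpoly_var (r, i, k))"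

definition col_coeff :: "nat \<Rightarrow> nat \<Rightarrow> nat \<Rightarrow> nat \<Rightarrow> 'k::field gpoly" where
  "col_coeff r b l j = (if j < b then (if l = j then 1 else 0) else mpoly_var (Suc r, l, j))"

definition param_entry :: "nat \<Rightarrow> nat \<Rightarrow> nat \<Rightarrow> nat \<Rightarrow> nat \<Rightarrow> nat \<Rightarrow> 'k::field gpoly" where
  "param_entry r a b q i j =
     (\<Sum>k<a. \<Sum>l<b. row_coeff r a i k * mpoly_var (q, k, l) * col_coeff r b l j)"

definition param :: "nat \<Rightarrow> nat \<Rightarrow> nat \<Rightarrow> nat \<Rightarrow> nat \<Rightarrow> 'k::field gpoly \<Rightarrow> 'k gpoly" where
  "param m n r a b = peval mpoly_const
     (\<lambda>(q, i, j). if q < r \<and> i < m \<and> j < n then param_entry r a b q i j else 0)"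

lemma comm_ring_hom_param: "comm_ring_hom (param m n r a b)"
  unfolding param_def by (rule comm_ring_hom_peval[OF comm_ring_hom_mpoly_const])

lemma param_var:
  "param m n r a b (mpoly_var (q, i, j)) = (if q < r \<and> i < m \<and> j < n then param_entry r a b q i j else 0)"
  unfolding param_def by (simp add: peval_var[OF comm_ring_hom_mpoly_const])

lemma param_entry_row:
  assumes "i < a"
  shows "param_entry r a b q i j = (\<Sum>l<b. mpoly_var (q, i, l) * col_coeff r b l j)"
proof -
  have "param_entry r a b q i j =
      (\<Sum>k<a. if k = i then (\<Sum>l<b. mpoly_var (q, i, l) * col_coeff r b l j) else 0)"
    unfolding param_entry_def by (intro sum.cong) (use assms in \<open>auto simp: row_coeff_def\<close>)
  then show ?thesis using assms by simp
qed

lemma param_entry_col: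
  assumes "j < b"
  shows "(param_entry r a b q i j :: 'k::field gpoly) = (\<Sum>k<a. row_coeff r a i k * mpoly_var (q, k, j))"
proof -
  have "(\<Sum>l<b. row_coeff r a i k * mpoly_var (q, k, l) * col_coeff r b l j) =
      (\<Sum>l<b. if l = j then row_coeff r a i k * mpoly_var (q, k, j) else 0 :: 'k gpoly)" for k
    by (intro sum.cong) (use assms in \<open>auto simp: col_coeff_def\<close>)
  then show ?thesis unfolding param_entry_def using assms by simp
qed

lemma param_entry_corner: "i < a \<Longrightarrow> j < b \<Longrightarrow> param_entry r a b q i j = mpoly_var (q, i, j)"
proof -
  assume ij: "i < a" "j < b"
  have "(\<Sum>l<b. mpoly_var (q, i, l) * col_coeff r b l j) = (\<Sum>l<b. if l = j then mpoly_var (q, i, j) else 0 :: 'a gpoly)"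
    by (intro sum.cong) (use ij in \<open>auto simp: col_coeff_def\<close>)
  then show ?thesis using ij by (simp add: param_entry_row)
qed

section \<open>Vanishing of the minors under the parametrization\<close>

lemma det_low_rank:
  fixes F G :: "nat \<Rightarrow> nat \<Rightarrow> 'a::comm_ring_1"
  assumes "p < k"
  shows "det (mat k k (\<lambda>(i, j). \<Sum>l<p. F i l * G l j)) = 0"
proof -
  define A where "A = mat k k (\<lambda>(i, l). if l < p then F i l else 0)"
  define B where "B = mat k k (\<lambda>(l, j). if l < p then G l j else 0)"
  have AB: "A \<in> carrier_mat k k" "B \<in> carrier_mat k k" by (auto simp: A_def B_def)
  have "mat k k (\<lambda>(i, j). \<Sum>l<p. F i l * G l j) = A * B"
  proof (intro eq_matI, goal_cases)
    case (1 i j)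
    then have ij: "i < k" "j < k" using AB by auto
    have "(A * B) $$ (i, j) = (\<Sum>l<k. A $$ (i, l) * B $$ (l, j))"
      by (rule mat_mult_index_sum[OF AB ij])
    also have "\<dots> = (\<Sum>l<p. A $$ (i, l) * B $$ (l, j))"
      by (rule sum.mono_neutral_right) (use assms ij in \<open>auto simp: A_def\<close>)
    also have "\<dots> = (\<Sum>l<p. F i l * G l j)"
      by (intro sum.cong) (use assms ij in \<open>auto simp: A_def B_def\<close>)
    finally show ?case using ij by simp
  qed (use AB in auto)
  \<comment> \<open>The padding has made column \<open>p\<close> of \<open>A\<close> zero.\<close>
  moreover have "det A = 0"
  proof -
    have "det A = (\<Sum>i<k. A $$ (i, p) * cofactor A i p)"
      by (rule laplace_expansion_column[OF AB(1) assms])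
    also have "\<dots> = 0" using assms by (intro sum.neutral) (auto simp: A_def)
    finally show ?thesis .
  qed
  ultimately show ?thesis using det_mult[OF AB] by simp
qed

lemma hom_minors_zero:
  fixes A :: "'a::comm_ring_1 mat" and g :: "'a \<Rightarrow> 'b::comm_ring_1"
  assumes g: "comm_ring_hom g" and "p < k"
    and entry: "\<And>i j. i < dim_row A \<Longrightarrow> j < dim_col A \<Longrightarrow> g (A $$ (i, j)) = (\<Sum>l<p. F i l * G l j)"
    and x: "x \<in> minors k A"
  shows "g x = 0"
proof -
  interpret comm_ring_hom g by fact
  obtain I J where IJ: "x = det (submatrix A I J)" "I \<subseteq> {..<dim_row A}" "J \<subseteq> {..<dim_col A}" "card I = k" "card J = k"
    using x unfolding minors_def by auto
  have eq: "{i. i < dim_row A \<and> i \<in> I} = I" "{i. i < dim_col A \<and> i \<in> J} = J" using IJ by auto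
  have pick: "i < k \<Longrightarrow> pick I i < dim_row A" "i < k \<Longrightarrow> pick J i < dim_col A" for i
    using pick_in_set_le[of i I] pick_in_set_le[of i J] IJ by auto
  have "map_mat g (submatrix A I J) = mat k k (\<lambda>(i, j). \<Sum>l<p. F (pick I i) l * G l (pick J j))"
    unfolding submatrix_def eq IJ(4,5) by (intro eq_matI) (auto simp: entry pick)
  then have "g x = det (mat k k (\<lambda>(i, j). \<Sum>l<p. F (pick I i) l * G l (pick J j)))"
    unfolding IJ(1) hom_det[symmetric] by simp
  then show ?thesis using det_low_rank[OF assms(2), of "\<lambda>i. F (pick I i)" "\<lambda>l j. G l (pick J j)"] by simp
qed

text \<open>The horizontal concatenation of the A Y_q B factors as A times the concatenated Y_q B,
  with inner size \<open>a\<close>. For the vertical one, the stacked A Y_q times B has inner size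
  \<open>b\<close>.\<close>

lemma param_horizontal_minors:
  assumes "a < s" "x \<in> minors s (horizontal_concat m n r (generic_matrix m n))"
  shows "param m n r a b x = 0"
proof (rule hom_minors_zero[OF comm_ring_hom_param assms(1) _ assms(2)])
  fix i c assume ic: "i < dim_row (horizontal_concat m n r (generic_matrix m n))"
    "c < dim_col (horizontal_concat m n r (generic_matrix m n))"
  then have "i < m" "c < r * n" by (auto simp: horizontal_concat_def)
  then have "n > 0" by (cases n) auto
  then have cr: "c div n < r" "c mod n < n" using \<open>c < r * n\<close> by (auto simp: less_mult_imp_div_less)
  then show "param m n r a b (horizontal_concat m n r (generic_matrix m n) $$ (i, c)) =
      (\<Sum>k<a. row_coeff r a i k * (\<Sum>l<b. mpoly_var (c div n, k, l) * col_coeff r b l (c mod n)))"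
    using \<open>i < m\<close> \<open>c < r * n\<close>
    by (simp add: horizontal_concat_def generic_matrix_def param_var param_entry_def sum_distrib_left mult.assoc)
qed

lemma param_vertical_minors:
  assumes "b < t" "x \<in> minors t (vertical_concat m n r (generic_matrix m n))"
  shows "param m n r a b x = 0"
proof (rule hom_minors_zero[OF comm_ring_hom_param assms(1) _ assms(2)])
  fix c j assume ic: "c < dim_row (vertical_concat m n r (generic_matrix m n))"
    "j < dim_col (vertical_concat m n r (generic_matrix m n))"
  then have "j < n" "c < r * m" by (auto simp: vertical_concat_def)
  then have "m > 0" by (cases m) auto
  then have cr: "c div m < r" "c mod m < m" using \<open>c < r * m\<close> by (auto simp: less_mult_imp_div_less)
  have "param_entry r a b (c div m) (c mod m) j =
      (\<Sum>l<b. (\<Sum>k<a. row_coeff r a (c mod m) k * mpoly_var (c div m, k, l)) * col_coeff r b l j)"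
    unfolding param_entry_def sum_distrib_right by (rule sum.swap)
  then show "param m n r a b (vertical_concat m n r (generic_matrix m n) $$ (c, j)) =
      (\<Sum>l<b. (\<Sum>k<a. row_coeff r a (c mod m) k * mpoly_var (c div m, k, l)) * col_coeff r b l j)"
    using \<open>j < n\<close> \<open>c < r * m\<close> cr
    by (simp add: vertical_concat_def generic_matrix_def param_var)
qed

section \<open>Recovering the parameters up to a minor\<close>

lemma (in comm_ring_hom) hom_adj_mat:
  assumes A: "A \<in> carrier_mat n n"
  shows "adj_mat (map_mat hom A) = map_mat hom (adj_mat A)"
proof (intro eq_matI, goal_cases)
  case (1 i j)
  then have ij: "i < n" "j < n" using A by (auto simp: adj_mat_def)
  have "mat_delete (map_mat hom A) j i = map_mat hom (mat_delete A j i)"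
    using A ij by (intro eq_matI) (auto simp: mat_delete_def)
  then show ?case using A ij by (simp add: adj_mat_def cofactor_def hom_mult hom_power hom_uminus)
qed (use A in \<open>auto simp: adj_mat_def\<close>)

definition var_mat :: "nat \<Rightarrow> (nat \<Rightarrow> nat \<Rightarrow> 'v) \<Rightarrow> (('v \<Rightarrow>\<^sub>0 nat) \<Rightarrow>\<^sub>0 'k::field) mat" where
  "var_mat k F = mat k k (\<lambda>(i, j). mpoly_var (F i j))"

lemma var_mat_carrier [simp]: "var_mat k F \<in> carrier_mat k k"
  by (simp add: var_mat_def)

text \<open>Specialize the matrix to the identity matrix.\<close>
lemma det_var_mat_nonzero:
  assumes inj: "\<And>i j i' j'. i < k \<Longrightarrow> j < k \<Longrightarrow> i' < k \<Longrightarrow> j' < k \<Longrightarrow> F i j = F i' j' \<Longrightarrow> i = i' \<and> j = j'"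
  shows "det (var_mat k F :: (('v \<Rightarrow>\<^sub>0 nat) \<Rightarrow>\<^sub>0 'k::field) mat) \<noteq> 0"
proof
  let ?g = "peval mpoly_const (\<lambda>v. if \<exists>i<k. v = F i i then 1 else 0) :: _ \<Rightarrow> ('v \<Rightarrow>\<^sub>0 nat) \<Rightarrow>\<^sub>0 'k"
  interpret comm_ring_hom ?g by (rule comm_ring_hom_peval[OF comm_ring_hom_mpoly_const])
  assume "det (var_mat k F :: (('v \<Rightarrow>\<^sub>0 nat) \<Rightarrow>\<^sub>0 'k) mat) = 0"
  then have "det (map_mat ?g (var_mat k F)) = 0" unfolding hom_det by simp
  also have "map_mat ?g (var_mat k F) = 1\<^sub>m k"
  proof (intro eq_matI, goal_cases)
    case (1 i j)
    then have "(\<exists>l<k. F i j = F l l) \<longleftrightarrow> i = j" using inj[of i j] by auto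
    then show ?case using 1 by (simp add: var_mat_def peval_var[OF comm_ring_hom_mpoly_const])
  qed (auto simp: var_mat_def)
  finally show False by simp
qed

lemma mpoly_var_nonzero: "(mpoly_var v :: ('v \<Rightarrow>\<^sub>0 nat) \<Rightarrow>\<^sub>0 'k::field) \<noteq> 0"
proof
  assume "(mpoly_var v :: ('v \<Rightarrow>\<^sub>0 nat) \<Rightarrow>\<^sub>0 'k) = 0"
  then have "Poly_Mapping.lookup (mpoly_var v :: ('v \<Rightarrow>\<^sub>0 nat) \<Rightarrow>\<^sub>0 'k) (Poly_Mapping.single v 1) = 0" by simp
  then show False by (simp add: mpoly_var_def)
qed

lemma kill_det_var_mat:
  assumes "\<And>i j. i < k \<Longrightarrow> j < k \<Longrightarrow> F i j \<notin> E"
  shows "kill E (det (var_mat k F)) = det (var_mat k F :: (('v \<Rightarrow>\<^sub>0 nat) \<Rightarrow>\<^sub>0 'k::field) mat)"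
proof -
  interpret comm_ring_hom "kill E :: (('v \<Rightarrow>\<^sub>0 nat) \<Rightarrow>\<^sub>0 'k) \<Rightarrow> _" by (rule comm_ring_hom_kill)
  have "map_mat (kill E) (var_mat k F) = (var_mat k F :: (('v \<Rightarrow>\<^sub>0 nat) \<Rightarrow>\<^sub>0 'k) mat)"
    by (intro eq_matI) (use assms in \<open>auto simp: var_mat_def kill_var\<close>)
  then show ?thesis using hom_det[of "var_mat k F"] by simp
qed

text \<open>Recovers an entry of \<open>c\<close> from the row vector c M, up to the factor
  \<open>det M\<close>, without inverting \<open>M\<close>. This is how an entry of A is read off
  from entries of the image matrices.\<close>

lemma adj_row_relation:
  fixes c :: "nat \<Rightarrow> 'a::comm_ring_1"
  assumes M: "M \<in> carrier_mat p p" and k: "k < p"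
  shows "(\<Sum>l<p. (\<Sum>u<p. c u * M $$ (u, l)) * adj_mat M $$ (l, k)) = c k * det M"
proof -
  have "(\<Sum>l<p. (\<Sum>u<p. c u * M $$ (u, l)) * adj_mat M $$ (l, k)) =
      (\<Sum>u<p. c u * (\<Sum>l<p. M $$ (u, l) * adj_mat M $$ (l, k)))"
    unfolding sum_distrib_right sum_distrib_left by (subst sum.swap) (simp add: mult.assoc)
  also have "\<dots> = (\<Sum>u<p. if u = k then c k * det M else 0)"
  proof (intro sum.cong refl)
    fix u assume "u \<in> {..<p}"
    then have "(\<Sum>l<p. M $$ (u, l) * adj_mat M $$ (l, k)) = (M * adj_mat M) $$ (u, k)"
      using mat_mult_index_sum[OF M adj_mat(1)[OF M]] k by simp
    also have "\<dots> = (if u = k then det M else 0)"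
      unfolding adj_mat(2)[OF M] using k \<open>u \<in> _\<close> by simp
    finally show "c u * (\<Sum>l<p. M $$ (u, l) * adj_mat M $$ (l, k)) = (if u = k then c k * det M else 0)" by simp
  qed
  also have "\<dots> = c k * det M" using k by simp
  finally show ?thesis .
qed

lemma adj_col_relation:
  fixes c :: "nat \<Rightarrow> 'a::comm_ring_1"
  assumes M: "M \<in> carrier_mat p p" and k: "k < p"
  shows "(\<Sum>l<p. adj_mat M $$ (k, l) * (\<Sum>u<p. M $$ (l, u) * c u)) = det M * c k"
proof -
  have "(\<Sum>l<p. adj_mat M $$ (k, l) * (\<Sum>u<p. M $$ (l, u) * c u)) =
      (\<Sum>u<p. (\<Sum>l<p. adj_mat M $$ (k, l) * M $$ (l, u)) * c u)"
    unfolding sum_distrib_right sum_distrib_left by (subst sum.swap) (simp add: mult.assoc)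
  also have "\<dots> = (\<Sum>u<p. if u = k then det M * c k else 0)"
  proof (intro sum.cong refl)
    fix u assume "u \<in> {..<p}"
    then have "(\<Sum>l<p. adj_mat M $$ (k, l) * M $$ (l, u)) = (adj_mat M * M) $$ (k, u)"
      using mat_mult_index_sum[OF adj_mat(1)[OF M] M] k by simp
    also have "\<dots> = (if u = k then det M else 0)"
      unfolding adj_mat(3)[OF M] using k \<open>u \<in> _\<close> by simp
    finally show "(\<Sum>l<p. adj_mat M $$ (k, l) * M $$ (l, u)) * c u = (if u = k then det M * c k else 0)" by simp
  qed
  also have "\<dots> = det M * c k" using k by simp
  finally show ?thesis .
qed

text \<open>The assumption \<open>a \<le> b\<close> gives an a-by-a block inside Y_0, which serves
  to recover A. The assumption \<open>b \<le> r * a\<close> gives b rows in the vertical stack of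
  the Y_q, which serve to recover B.\<close>

context
  fixes m n r a b :: nat
  assumes am: "a \<le> m" and bn: "b \<le> n" and ab: "a \<le> b" and bra: "b \<le> r * a"
begin

lemma param_map_var_mat:
  assumes "\<And>i j. i < k \<Longrightarrow> j < k \<Longrightarrow> F i j \<in> {..<r} \<times> {..<a} \<times> {..<b}"
  shows "map_mat (param m n r a b) (var_mat k F) = (var_mat k F :: 'k::field gpoly mat)"
proof (intro eq_matI, goal_cases)
  case (1 i j)
  then have ij: "i < k" "j < k" by (auto simp: var_mat_def)
  obtain q u v where F: "F i j = (q, u, v)" by (cases "F i j")
  have "q < r" "u < a" "v < b" using assms[OF ij] F by auto
  then show ?case using ij am bn by (simp add: var_mat_def F param_var param_entry_corner)
qed (auto simp: var_mat_def)

text \<open>The first \<open>a\<close> entries of row \<open>i\<close> of X_0 are row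
  \<open>i\<close> of A times the block \<open>M\<close> of Y_0, and \<open>M\<close> is fixed by
  the parametrization. Multiplying by the adjugate isolates the parameter times
  \<open>det M\<close>, which involves only entries of Y_0 and so survives while these are not
  killed.\<close>

lemma row_parameter:
  assumes i: "a \<le> i" "i < m" and k: "k < a"
  shows "\<exists>e \<Delta>. param m n r a b e = mpoly_var (r, i, k) * (\<Delta> :: 'k::field gpoly) \<and>
    (\<forall>E. E \<inter> {..<r} \<times> {..<a} \<times> {..<b} = {} \<longrightarrow> kill E \<Delta> \<noteq> 0)"
proof -
  have "r > 0" using bra ab k by (cases r) auto
  define M where "M = (var_mat a (\<lambda>i j. (0, i, j)) :: 'k gpoly mat)"
  have M: "M \<in> carrier_mat a a" by (simp add: M_def)
  interpret comm_ring_hom "param m n r a b :: 'k gpoly \<Rightarrow> _" by (rule comm_ring_hom_param)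
  have mapM: "map_mat (param m n r a b) M = M"
    unfolding M_def by (rule param_map_var_mat) (use \<open>r > 0\<close> ab in auto)
  have adj: "param m n r a b (adj_mat M $$ (l, k)) = adj_mat M $$ (l, k)" if "l < a" for l
  proof -
    have "adj_mat M $$ (l, k) = map_mat (param m n r a b) (adj_mat M) $$ (l, k)"
      using hom_adj_mat[OF M] mapM by simp
    then show ?thesis using that k adj_mat(1)[OF M] by simp
  qed
  define e where "e = (\<Sum>l<a. mpoly_var (0, i, l) * adj_mat M $$ (l, k))"
  have "param m n r a b e = (\<Sum>l<a. param_entry r a b 0 i l * adj_mat M $$ (l, k))"
    unfolding e_def hom_sum hom_mult using \<open>r > 0\<close> i ab bn by (intro sum.cong) (auto simp: param_var adj)
  also have "\<dots> = (\<Sum>l<a. (\<Sum>u<a. row_coeff r a i u * M $$ (u, l)) * adj_mat M $$ (l, k))"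
    using ab by (intro sum.cong) (auto simp: param_entry_col M_def var_mat_def)
  also have "\<dots> = row_coeff r a i k * det M" by (rule adj_row_relation[OF M k])
  finally have "param m n r a b e = mpoly_var (r, i, k) * det M" using i by (simp add: row_coeff_def)
  moreover have "kill E (det M) \<noteq> 0" if "E \<inter> {..<r} \<times> {..<a} \<times> {..<b} = {}" for E
  proof -
    have "(0, i, j) \<notin> E" if "i < a" "j < a" for i j
      using \<open>E \<inter> _ = {}\<close> that \<open>r > 0\<close> ab by fastforce
    then have "kill E (det M) = det M" unfolding M_def by (rule kill_det_var_mat)
    moreover have "det M \<noteq> 0" unfolding M_def by (rule det_var_mat_nonzero) auto
    ultimately show ?thesis by simp
  qed
  ultimately show ?thesis by blast
qed

text \<open>Dual to the rows: \<open>M\<close> consists of the first \<open>b\<close> rows of the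
  stacked Y_q, where row \<open>u\<close> is row \<open>u mod a\<close> of block
  \<open>u div a\<close>. Several blocks are involved because one block has only \<open>a\<close>
  rows.\<close>

lemma col_parameter:
  assumes j: "b \<le> j" "j < n" and l: "l < b"
  shows "\<exists>e \<Delta>. param m n r a b e = mpoly_var (Suc r, l, j) * (\<Delta> :: 'k::field gpoly) \<and>
    (\<forall>E. E \<inter> {..<r} \<times> {..<a} \<times> {..<b} = {} \<longrightarrow> kill E \<Delta> \<noteq> 0)"
proof -
  have "a > 0" using bra l by (cases a) auto
  have div: "u div a < r" "u mod a < a" if "u < b" for u
    using that bra \<open>a > 0\<close> by (auto simp: less_mult_imp_div_less)
  define M where "M = (var_mat b (\<lambda>u j. (u div a, u mod a, j)) :: 'k gpoly mat)"
  have M: "M \<in> carrier_mat b b" by (simp add: M_def)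
  interpret comm_ring_hom "param m n r a b :: 'k gpoly \<Rightarrow> _" by (rule comm_ring_hom_param)
  have mapM: "map_mat (param m n r a b) M = M"
    unfolding M_def by (rule param_map_var_mat) (use div in auto)
  have adj: "param m n r a b (adj_mat M $$ (l, u)) = adj_mat M $$ (l, u)" if "u < b" for u
  proof -
    have "adj_mat M $$ (l, u) = map_mat (param m n r a b) (adj_mat M) $$ (l, u)"
      using hom_adj_mat[OF M] mapM by simp
    then show ?thesis using that l adj_mat(1)[OF M] by simp
  qed
  define e where "e = (\<Sum>u<b. adj_mat M $$ (l, u) * mpoly_var (u div a, u mod a, j))"
  have "param m n r a b e = (\<Sum>u<b. adj_mat M $$ (l, u) * param_entry r a b (u div a) (u mod a) j)"
    unfolding e_def hom_sum hom_mult
  proof (intro sum.cong refl)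
    fix u assume "u \<in> {..<b}"
    then have "u div a < r" "u mod a < m" using div[of u] am by auto
    then show "param m n r a b (adj_mat M $$ (l, u)) * param m n r a b (mpoly_var (u div a, u mod a, j)) =
        adj_mat M $$ (l, u) * param_entry r a b (u div a) (u mod a) j"
      using \<open>u \<in> _\<close> j by (simp add: adj param_var)
  qed
  also have "\<dots> = (\<Sum>u<b. adj_mat M $$ (l, u) * (\<Sum>v<b. M $$ (u, v) * col_coeff r b v j))"
    using div by (intro sum.cong) (auto simp: param_entry_row M_def var_mat_def)
  also have "\<dots> = det M * col_coeff r b l j" by (rule adj_col_relation[OF M l])
  finally have "param m n r a b e = mpoly_var (Suc r, l, j) * det M"
    using j by (simp add: col_coeff_def mult.commute)
  moreover have "kill E (det M) \<noteq> 0" if "E \<inter> {..<r} \<times> {..<a} \<times> {..<b} = {}" for E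
  proof -
    have "(u div a, u mod a, v) \<notin> E" if "u < b" "v < b" for u v
      using \<open>E \<inter> _ = {}\<close> that div[of u] by fastforce
    then have "kill E (det M) = det M" unfolding M_def by (rule kill_det_var_mat)
    moreover have "det M \<noteq> 0" unfolding M_def
      by (rule det_var_mat_nonzero) (metis Pair_inject div_mult_mod_eq)
    ultimately show ?thesis by simp
  qed
  ultimately show ?thesis by blast
qed

theorem param_chain:
  shows "\<exists>P. (\<forall>j\<le>(m - a) * a + (n - b) * b + r * a * b. prime_set (P j) \<and>
        {p :: 'k::field gpoly. param m n r a b p = 0} \<subseteq> P j) \<and>
     (\<forall>j<(m - a) * a + (n - b) * b + r * a * b. P j \<subset> P (Suc j))"
proof -
  define Y where "Y = {..<r} \<times> {..<a} \<times> {..<b}"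
  define A where "A = (\<lambda>(i, k). (r, i, k)) ` ({a..<m} \<times> {..<a})"
  define B where "B = (\<lambda>(l, j). (Suc r, l, j)) ` ({..<b} \<times> {b..<n})"
  have "inj_on (\<lambda>(i, k). (r, i, k)) ({a..<m} \<times> {..<a})" "inj_on (\<lambda>(l, j). (Suc r, l, j)) ({..<b} \<times> {b..<n})"
    by (auto simp: inj_on_def)
  then have card: "card A = (m - a) * a" "card B = (n - b) * b" "card Y = r * a * b"
    by (simp_all add: A_def B_def Y_def card_image)
  have fin: "finite A" "finite B" "finite Y" by (auto simp: A_def B_def Y_def)
  obtain zl where zl: "set zl = A \<union> B" "distinct zl" using finite_distinct_list[of "A \<union> B"] fin by blast
  obtain yl where yl: "set yl = Y" "distinct yl" using finite_distinct_list fin by blast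
  have disj: "(A \<union> B) \<inter> Y = {}" "A \<inter> B = {}" by (auto simp: A_def B_def Y_def)
  define ys where "ys = zl @ yl"
  have ys: "distinct ys" using zl yl disj by (simp add: ys_def)
  have "length zl = card A + card B" using zl distinct_card[of zl] card_Un_disjoint[OF fin(1,2) disj(2)] by simp
  moreover have "length yl = card Y" using yl distinct_card[of yl] by simp
  ultimately have len: "length ys = (m - a) * a + (n - b) * b + r * a * b" using card by (simp add: ys_def)
  interpret pr: comm_ring_hom "param m n r a b :: 'k gpoly \<Rightarrow> _" by (rule comm_ring_hom_param)
  have elem: "\<exists>e. kill (set (take j ys)) (param m n r a b e) \<noteq> 0 \<and>
      kill (set (take (Suc j) ys)) (param m n r a b (e :: 'k gpoly)) = 0" if j: "j < length ys" for j
  proof -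
    interpret k1: comm_ring_hom "kill (set (take j ys)) :: 'k gpoly \<Rightarrow> _" by (rule comm_ring_hom_kill)
    interpret k2: comm_ring_hom "kill (set (take (Suc j) ys)) :: 'k gpoly \<Rightarrow> _" by (rule comm_ring_hom_kill)
    define y where "y = ys ! j"
    have new: "y \<notin> set (take j ys)"
    proof
      assume "y \<in> set (take j ys)"
      then obtain i where "i < j" "ys ! i = ys ! j" by (auto simp: in_set_conv_nth y_def)
      then show False using nth_eq_iff_index_eq[OF ys, of i j] j by simp
    qed
    have in_Suc: "y \<in> set (take (Suc j) ys)" using j by (simp add: take_Suc_conv_app_nth y_def)
    have var: "kill (set (take j ys)) (mpoly_var y :: 'k gpoly) \<noteq> 0" "kill (set (take (Suc j) ys)) (mpoly_var y :: 'k gpoly) = 0"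
      using new in_Suc by (auto simp: kill_var mpoly_var_nonzero)
    show ?thesis
    proof (cases "j < length zl")
      case True
      then have "y = zl ! j" by (simp add: y_def ys_def nth_append)
      then have "y \<in> A \<union> B" using nth_mem[OF True] zl(1) by simp
      then have "\<exists>e \<Delta>. param m n r a b e = mpoly_var y * (\<Delta> :: 'k gpoly) \<and>
          (\<forall>E. E \<inter> Y = {} \<longrightarrow> kill E \<Delta> \<noteq> 0)"
      proof
        assume "y \<in> A"
        then obtain p where "p \<in> {a..<m} \<times> {..<a}" "y = (\<lambda>(i, k). (r, i, k)) p"
          unfolding A_def by (rule imageE)
        then obtain i k where y: "y = (r, i, k)" "a \<le> i" "i < m" "k < a" by (cases p) simp
        show ?thesis unfolding y(1) Y_def by (rule row_parameter[OF y(2-4)])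
      next
        assume "y \<in> B"
        then obtain p where "p \<in> {..<b} \<times> {b..<n}" "y = (\<lambda>(l, j). (Suc r, l, j)) p"
          unfolding B_def by (rule imageE)
        then obtain l j where y: "y = (Suc r, l, j)" "b \<le> j" "j < n" "l < b" by (cases p) simp
        show ?thesis unfolding y(1) Y_def by (rule col_parameter[OF y(2-4)])
      qed
      then obtain e \<Delta> where e: "param m n r a b e = mpoly_var y * (\<Delta> :: 'k gpoly)"
        "\<And>E. E \<inter> Y = {} \<Longrightarrow> kill E \<Delta> \<noteq> 0"
        by blast
      \<comment> \<open>At this stage only entries of A and B have been killed, so the factor
        \<open>\<Delta>\<close> survives.\<close>
      have "set (take j ys) \<subseteq> A \<union> B" using True zl set_take_subset[of j zl] by (simp add: ys_def)
      then have "set (take j ys) \<inter> Y = {}" using disj(1) by blast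
      then have "kill (set (take j ys)) \<Delta> \<noteq> 0" by (rule e(2))
      then have "kill (set (take j ys)) (param m n r a b e) \<noteq> 0"
        unfolding e(1) k1.hom_mult using var(1) by (simp only: mult_eq_0_iff simp_thms)
      moreover have "kill (set (take (Suc j) ys)) (param m n r a b e) = 0"
        unfolding e(1) k2.hom_mult var(2) by (rule mult_zero_left)
      ultimately show ?thesis by blast
    next
      case False
      then have "y = yl ! (j - length zl)" "j - length zl < length yl"
        using j by (auto simp: y_def ys_def nth_append)
      then have "y \<in> Y" using nth_mem[of "j - length zl" yl] yl(1) by simp
      then obtain q k l where y: "y = (q, k, l)" "q < r" "k < a" "l < b" by (auto simp: Y_def)
      \<comment> \<open>An entry of Y_q is its own witness, because the identity blocks of A and B
        make it an entry of X_q.\<close>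
      then have "param m n r a b (mpoly_var y) = (mpoly_var y :: 'k gpoly)"
        using am bn by (simp add: param_var param_entry_corner)
      then show ?thesis using var by (intro exI[of _ "mpoly_var y"]) simp
    qed
  qed
  show ?thesis
    using prime_chain_above[OF comm_ring_hom_param elem] unfolding len by blast
qed

end

section \<open>Optimizing the dimension over the ranks\<close>

text \<open>Parameters of the stratum of ranks \<open>\<rho>\<close> and \<open>\<sigma>\<close>: a
  Grassmannian for the common column space, one for the common row space, and \<open>r\<close> core
  matrices of size \<open>\<rho>\<close> by \<open>\<sigma>\<close>.\<close>

definition stratum_dim :: "nat \<Rightarrow> nat \<Rightarrow> nat \<Rightarrow> nat \<Rightarrow> nat \<Rightarrow> nat" where
  "stratum_dim m n r \<rho> \<sigma> = (m - \<rho>) * \<rho> + (n - \<sigma>) * \<sigma> + r * \<rho> * \<sigma>"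

text \<open>The increment is (n - \<sigma> - 1) + (r \<rho> - \<sigma>). For a step in
  \<open>\<rho>\<close> it is, symmetrically, (m - \<rho> - 1) + (r \<sigma> - \<rho>).\<close>

lemma stratum_dim_step_col:
  assumes "\<sigma> < n" "\<sigma> \<le> r * \<rho>"
  shows "stratum_dim m n r \<rho> \<sigma> \<le> stratum_dim m n r \<rho> (Suc \<sigma>)"
proof -
  obtain c where n: "n = Suc \<sigma> + c" using assms(1) less_iff_Suc_add by auto
  show ?thesis using assms(2) by (simp add: stratum_dim_def n algebra_simps)
qed

lemma stratum_dim_step_row:
  assumes "\<rho> < m" "\<rho> \<le> r * \<sigma>"
  shows "stratum_dim m n r \<rho> \<sigma> \<le> stratum_dim m n r (Suc \<rho>) \<sigma>"
proof -
  obtain c where m: "m = Suc \<rho> + c" using assms(1) less_iff_Suc_add by auto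
  show ?thesis using assms(2) by (simp add: stratum_dim_def m algebra_simps)
qed

lemma stratum_dim_mono_col:
  assumes "\<sigma> \<le> \<sigma>'" "\<sigma>' \<le> n" "\<sigma>' \<le> r * \<rho>"
  shows "stratum_dim m n r \<rho> \<sigma> \<le> stratum_dim m n r \<rho> \<sigma>'"
  using assms
proof (induction \<sigma>' rule: dec_induct)
  case (step i)
  then show ?case using stratum_dim_step_col[of i n r \<rho> m] by simp
qed simp

text \<open>The path must stay where both kinds of steps increase the value. So
  \<open>\<sigma>\<close> is first raised to the maximum allowed by \<open>\<rho>\<close>;
  afterwards each step in \<open>\<rho>\<close> is followed by raising \<open>\<sigma>\<close> to
  its new maximum.\<close>

lemma stratum_dim_le:
  assumes "\<rho> \<le> a" "a \<le> m" "a \<le> c" "c \<le> n" "\<sigma> \<le> c" "\<sigma> \<le> r * \<rho>" "r \<ge> 1"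
  shows "stratum_dim m n r \<rho> \<sigma> \<le> stratum_dim m n r a (min c (r * a))"
proof -
  have "stratum_dim m n r \<rho> \<sigma> \<le> stratum_dim m n r \<rho> (min c (r * \<rho>))"
    by (rule stratum_dim_mono_col) (use assms in auto)
  also have "\<dots> \<le> stratum_dim m n r a (min c (r * a))"
    using assms(1,2,3)
  proof (induction a rule: dec_induct)
    case (step i)
    let ?\<sigma> = "min c (r * i)"
    \<comment> \<open>The condition for the step in \<open>\<rho>\<close> is checked for both
      possible values of the minimum.\<close>
    have "1 * i \<le> r * c" by (rule mult_le_mono) (use assms(7) step in auto)
    moreover have "1 * (1 * i) \<le> r * (r * i)" by (intro mult_le_mono) (use assms(7) in auto)
    ultimately have "i \<le> r * ?\<sigma>" by (cases "c \<le> r * i") (auto simp: min_def)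
    have "stratum_dim m n r \<rho> (min c (r * \<rho>)) \<le> stratum_dim m n r i ?\<sigma>" using step by simp
    also have "\<dots> \<le> stratum_dim m n r (Suc i) ?\<sigma>"
      using step \<open>i \<le> r * ?\<sigma>\<close> by (intro stratum_dim_step_row) auto
    also have "\<dots> \<le> stratum_dim m n r (Suc i) (min c (r * Suc i))"
      by (rule stratum_dim_mono_col) (use assms(4) in \<open>auto simp: min_def\<close>)
    finally show ?case .
  qed simp
  finally show ?thesis .
qed

text \<open>The sum telescopes: its q-th term is min c (q a) - min c ((q - 1) a). At the lower end
  min c a equals a, by \<open>a \<le> c\<close>.\<close>

lemma sum_rank_increments:
  fixes a c :: int
  assumes "0 \<le> a" "a \<le> c" "r \<ge> 1"
  shows "(\<Sum>q=2..r. min a (max 0 (c - a * (int q - 1)))) = min c (int r * a) - a"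
  using assms(3)
proof (induction r rule: nat_induct_at_least)
  case base
  then show ?case using assms by simp
next
  case (Suc r)
  have "int r * a \<ge> 0" using assms by simp
  have "(\<Sum>q=2..Suc r. min a (max 0 (c - a * (int q - 1)))) =
      (\<Sum>q=2..r. min a (max 0 (c - a * (int q - 1)))) + min a (max 0 (c - a * int r))"
    using Suc.hyps by (simp add: sum.cl_ivl_Suc)
  also have "\<dots> = min c (int r * a) - a + min a (max 0 (c - int r * a))"
    unfolding Suc.IH by (simp add: mult.commute)
  also have "\<dots> = min c (int r * a + a) - a" using assms \<open>int r * a \<ge> 0\<close> by linarith
  finally show ?case by (simp add: algebra_simps)
qed

text \<open>With e = min c (r a), the two sums over q are r a - e and e - a. The count and the
  stated dimension then differ by (r a - e) (e - c).\<close>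

lemma stratum_dim_formula:
  fixes m n r s t :: nat
  assumes "r \<ge> 1" "1 \<le> s" "s \<le> m" "t \<le> n" "s \<le> t"
  defines "d \<equiv> stratum_dim m n r (s - 1) (min (t - 1) (r * (s - 1)))"
  shows "int d =
      (int s - 1) * (int m + int n - int s + 1)
      + (int t - 1) * (\<Sum>q=2..r. (int s - 1) - min (int s - 1) (max 0 (int t - (int s - 1) * (int q - 1) - 1)))
      + int n * (\<Sum>q=2..r. min (int s - 1) (max 0 (int t - (int s - 1) * (int q - 1) - 1)))"
    (is "_ = ?D")
    and "int (r * m * n) - int d =
      (int m - int s + 1) * (int n - int s + 1)
      + (int r - 1) * int n * (int m - int s + 1)
      + (int n - int t + 1) * (\<Sum>q=2..r. (int s - 1) - min (int s - 1) (max 0 (int t - (int s - 1) * (int q - 1) - 1)))"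
    (is "_ = ?H")
proof -
  define a where "a = int s - 1"
  define c where "c = int t - 1"
  define e where "e = min c (int r * a)"
  have ac: "0 \<le> a" "a \<le> c" using assms by (auto simp: a_def c_def)
  have S1: "(\<Sum>q=2..r. min (int s - 1) (max 0 (int t - (int s - 1) * (int q - 1) - 1))) = e - a"
    using sum_rank_increments[OF ac assms(1)] by (simp add: a_def c_def e_def algebra_simps)
  have S2: "(\<Sum>q=2..r. (int s - 1) - min (int s - 1) (max 0 (int t - (int s - 1) * (int q - 1) - 1))) = int r * a - e"
    unfolding sum_subtractf S1 using assms(1) by (simp add: a_def of_nat_diff algebra_simps)
  have st: "int s = a + 1" "int t = c + 1" by (auto simp: a_def c_def)
  have "int d = (int m - a) * a + (int n - e) * e + int r * a * e"
  proof -
    define \<sigma> where "\<sigma> = min (t - 1) (r * (s - 1))"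
    have e: "int \<sigma> = e"
      using assms by (simp add: \<sigma>_def e_def c_def a_def of_nat_diff of_nat_min)
    have "\<sigma> \<le> n" using assms by (auto simp: \<sigma>_def)
    then have "int (n - \<sigma>) = int n - e" by (simp add: of_nat_diff e)
    moreover have "int (s - 1) = a" "int (m - (s - 1)) = int m - a"
      using assms by (simp_all add: of_nat_diff a_def)
    ultimately show ?thesis
      unfolding d_def stratum_dim_def \<sigma>_def[symmetric] by (simp only: of_nat_add of_nat_mult e)
  qed
  \<comment> \<open>Either value annihilates the product by which the two sides differ.\<close>
  moreover have "e = c \<or> e = int r * a" by (auto simp: e_def min_def)
  ultimately show "int d = ?D" "int (r * m * n) - int d = ?H"
    unfolding S1 S2 unfolding st by (auto simp: algebra_simps)
qed

section \<open>Transfer to the ring of the generic matrices\<close>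

text \<open>The retraction onto the polynomials in \<open>V\<close>. Preimages under it turn prime
  ideals of the carrier into primes of the whole type that contain the outside variables;
  intersecting with the carrier leads back.\<close>

definition restrict_vars :: "'v set \<Rightarrow> (('v \<Rightarrow>\<^sub>0 nat) \<Rightarrow>\<^sub>0 'k::field) \<Rightarrow> ('v \<Rightarrow>\<^sub>0 nat) \<Rightarrow>\<^sub>0 'k" where
  "restrict_vars V = kill (- V)"

lemma comm_ring_hom_restrict_vars: "comm_ring_hom (restrict_vars V)"
  unfolding restrict_vars_def by (rule comm_ring_hom_kill)

lemma mpoly_ring_simps:
  "p \<in> carrier (mpoly_ring V) \<longleftrightarrow> (\<forall>\<mu>\<in>Poly_Mapping.keys p. Poly_Mapping.keys \<mu> \<subseteq> V)"
  "p \<otimes>\<^bsub>mpoly_ring V\<^esub> q = p * q" "p \<oplus>\<^bsub>mpoly_ring V\<^esub> q = p + q"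
  "\<one>\<^bsub>mpoly_ring V\<^esub> = 1" "\<zero>\<^bsub>mpoly_ring V\<^esub> = 0"
  by (simp_all add: mpoly_ring_def)

lemma restrict_vars_carrier: "restrict_vars V p \<in> carrier (mpoly_ring V)"
proof -
  interpret cring "mpoly_ring V :: (('a \<Rightarrow>\<^sub>0 nat) \<Rightarrow>\<^sub>0 'b) ring" by (rule mpoly_ring_cring)
  show ?thesis
    unfolding restrict_vars_def kill_def
  proof (rule peval_closed)
    show "0 \<in> carrier (mpoly_ring V)" "1 \<in> carrier (mpoly_ring V)"
      using zero_closed one_closed by (simp_all add: mpoly_ring_simps)
    show "p + q \<in> carrier (mpoly_ring V)" "p * q \<in> carrier (mpoly_ring V)"
      if "p \<in> carrier (mpoly_ring V)" "q \<in> carrier (mpoly_ring V)" for p q :: "('a \<Rightarrow>\<^sub>0 nat) \<Rightarrow>\<^sub>0 'b"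
      using a_closed[OF that] m_closed[OF that] by (simp_all only: mpoly_ring_simps(2,3))
  qed (auto simp: mpoly_ring_simps mpoly_var_def)
qed

lemma restrict_vars_id:
  assumes "p \<in> carrier (mpoly_ring V)"
  shows "restrict_vars V p = p"
proof -
  have "restrict_vars V p = peval mpoly_const mpoly_var p"
    unfolding restrict_vars_def kill_def by (rule peval_cong) (use assms in \<open>auto simp: mpoly_ring_simps\<close>)
  then show ?thesis by (simp add: peval_id)
qed

lemma prime_set_restrict:
  assumes "primeideal P (mpoly_ring V)"
  shows "prime_set (restrict_vars V -` P :: (('v \<Rightarrow>\<^sub>0 nat) \<Rightarrow>\<^sub>0 'k::field) set)"
proof -
  interpret primeideal P "mpoly_ring V" by fact
  interpret h: comm_ring_hom "restrict_vars V :: (('v \<Rightarrow>\<^sub>0 nat) \<Rightarrow>\<^sub>0 'k) \<Rightarrow> _" by (rule comm_ring_hom_restrict_vars)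
  show ?thesis
  proof
    show "0 \<in> restrict_vars V -` P" using additive_subgroup.zero_closed[OF additive_subgroup_axioms]
      by (simp add: mpoly_ring_simps(5))
    show "x + y \<in> restrict_vars V -` P" if "x \<in> restrict_vars V -` P" "y \<in> restrict_vars V -` P" for x y
      using additive_subgroup.a_closed[OF additive_subgroup_axioms] that
      by (simp add: mpoly_ring_simps(3) h.hom_add)
    show "y * x \<in> restrict_vars V -` P" if "x \<in> restrict_vars V -` P" for x y
      using I_l_closed[of "restrict_vars V x" "restrict_vars V y"] restrict_vars_carrier[of V y] that by (simp add: mpoly_ring_simps(2) h.hom_mult)
    show "1 \<notin> restrict_vars V -` P"
      using I_notcarr one_imp_carrier by (auto simp: mpoly_ring_simps(4))
    show "x \<in> restrict_vars V -` P \<or> y \<in> restrict_vars V -` P" if "x * y \<in> restrict_vars V -` P" for x y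
      using I_prime[of "restrict_vars V x" "restrict_vars V y"] restrict_vars_carrier[of V x] restrict_vars_carrier[of V y] that by (simp add: mpoly_ring_simps(2) h.hom_mult)
  qed
qed

lemma restrict_vars_vimage_Int:
  assumes "P \<subseteq> carrier (mpoly_ring V)"
  shows "restrict_vars V -` P \<inter> carrier (mpoly_ring V) = P"
  using assms restrict_vars_id by fastforce

lemma outside_restrict:
  assumes "prime_set (restrict_vars V -` P)" "v \<notin> V"
  shows "mpoly_var v \<in> restrict_vars V -` P"
proof -
  interpret prime_set "restrict_vars V -` P" by fact
  interpret h: comm_ring_hom "restrict_vars V" by (rule comm_ring_hom_restrict_vars)
  have "0 \<in> P" using zero by simp
  then show ?thesis using assms(2) by (simp add: restrict_vars_def kill_var)
qed

lemma primeideal_Int_carrier: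
  assumes "prime_set (Q :: (('v \<Rightarrow>\<^sub>0 nat) \<Rightarrow>\<^sub>0 'k::field) set)"
  shows "primeideal (Q \<inter> carrier (mpoly_ring V)) (mpoly_ring V)"
proof -
  interpret prime_set Q by fact
  interpret R: cring "mpoly_ring V :: (('v \<Rightarrow>\<^sub>0 nat) \<Rightarrow>\<^sub>0 'k) ring" by (rule mpoly_ring_cring)
  let ?R = "mpoly_ring V :: (('v \<Rightarrow>\<^sub>0 nat) \<Rightarrow>\<^sub>0 'k) ring"
  have minus: "\<ominus>\<^bsub>?R\<^esub> x = - x" if "x \<in> carrier ?R" for x
  proof -
    have "- x \<in> carrier ?R" using that by (simp add: mpoly_ring_simps)
    then show ?thesis using R.minus_equality[of "- x" x] that by (simp add: mpoly_ring_simps(3,5))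
  qed
  show ?thesis
  proof (rule primeidealI2)
    show "additive_subgroup (Q \<inter> carrier ?R) ?R"
    proof (rule additive_subgroup.intro, rule R.add.subgroupI)
      show "Q \<inter> carrier ?R \<noteq> {}" using zero R.zero_closed by (auto simp: mpoly_ring_simps(5))
      show "\<ominus>\<^bsub>?R\<^esub> x \<in> Q \<inter> carrier ?R" if "x \<in> Q \<inter> carrier ?R" for x
        using that minus[of x] uminus R.a_inv_closed[of x] by auto
      show "x \<oplus>\<^bsub>?R\<^esub> y \<in> Q \<inter> carrier ?R" if "x \<in> Q \<inter> carrier ?R" "y \<in> Q \<inter> carrier ?R" for x y
        using that add R.a_closed[of x y] by (auto simp: mpoly_ring_simps(3))
    qed auto
    show "x \<otimes>\<^bsub>?R\<^esub> a \<in> Q \<inter> carrier ?R" "a \<otimes>\<^bsub>?R\<^esub> x \<in> Q \<inter> carrier ?R"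
      if "a \<in> Q \<inter> carrier ?R" "x \<in> carrier ?R" for a x
      using that mult mult' R.m_closed[of a x] R.m_closed[of x a] by (auto simp: mpoly_ring_simps(2))
    show "carrier ?R \<noteq> Q \<inter> carrier ?R" using one_notin R.one_closed by (auto simp: mpoly_ring_simps(4))
    show "a \<in> Q \<inter> carrier ?R \<or> b \<in> Q \<inter> carrier ?R"
      if "a \<in> carrier ?R" "b \<in> carrier ?R" "a \<otimes>\<^bsub>?R\<^esub> b \<in> Q \<inter> carrier ?R" for a b
      using that prime by (auto simp: mpoly_ring_simps(2))
  qed (rule mpoly_ring_cring)
qed

lemma restrict_vars_diff:
  fixes Q :: "(('v \<Rightarrow>\<^sub>0 nat) \<Rightarrow>\<^sub>0 'k::field) set"
  assumes "prime_set Q" and out: "\<And>v. v \<notin> V \<Longrightarrow> mpoly_var v \<in> Q"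
  shows "restrict_vars V p - p \<in> Q"
proof -
  interpret prime_set Q by fact
  interpret h: comm_ring_hom "restrict_vars V :: (('v \<Rightarrow>\<^sub>0 nat) \<Rightarrow>\<^sub>0 'k) \<Rightarrow> _" by (rule comm_ring_hom_restrict_vars)
  have var: "restrict_vars V (mpoly_var v) - mpoly_var v \<in> Q" for v
    using out[of v] zero uminus by (auto simp: restrict_vars_def kill_var)
  show ?thesis
  proof (induction p rule: mpoly_induct)
    case (monomial \<mu> c)
    have pow: "restrict_vars V (mpoly_var v ^ k) - mpoly_var v ^ k \<in> Q" for v k
    proof (induction k)
      case (Suc k)
      show ?case using diff_mult[OF var Suc] by (simp add: h.hom_mult)
    qed (simp add: zero)
    have "restrict_vars V (\<Prod>v\<in>S. mpoly_var v ^ Poly_Mapping.lookup \<mu> v) -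
        (\<Prod>v\<in>S. mpoly_var v ^ Poly_Mapping.lookup \<mu> v) \<in> Q" if "finite S" for S
      using that
    proof induction
      case (insert v S)
      then show ?case using diff_mult[OF pow insert.IH] by (simp add: h.hom_mult)
    qed (simp add: zero)
    moreover have "restrict_vars V (mpoly_const c) - mpoly_const c \<in> Q"
      by (simp add: restrict_vars_def kill_const zero)
    ultimately show ?case unfolding single_eq_var_prod[of \<mu> c] h.hom_mult
      by (intro diff_mult) auto
  next
    case (add p q)
    then have "(restrict_vars V p - p) + (restrict_vars V q - q) \<in> Q" by (rule ideal_set.add[OF ideal_set_axioms])
    then show ?case by (simp add: h.hom_add algebra_simps)
  qed (simp add: zero)
qed

text \<open>A polynomial separating the two primes can be replaced by its restriction to
  \<open>V\<close>, which is congruent to it modulo the smaller prime because the outside variables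
  lie there.\<close>

lemma Int_carrier_psubset:
  fixes Q Q' :: "(('v \<Rightarrow>\<^sub>0 nat) \<Rightarrow>\<^sub>0 'k::field) set"
  assumes Q: "prime_set Q" "\<And>v. v \<notin> V \<Longrightarrow> mpoly_var v \<in> Q" and Q': "prime_set Q'" and sub: "Q \<subset> Q'"
  shows "Q \<inter> carrier (mpoly_ring V) \<subset> Q' \<inter> carrier (mpoly_ring V)"
proof -
  obtain p where p: "p \<in> Q'" "p \<notin> Q" using sub by auto
  have "restrict_vars V p - p \<in> Q" by (rule restrict_vars_diff[OF Q])
  then have "restrict_vars V p \<notin> Q" "restrict_vars V p \<in> Q'"
    using p sub ideal_set.diff_cong[OF prime_set.axioms(1)] Q(1) Q' by blast+
  then show ?thesis using sub restrict_vars_carrier[of V p] by blast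
qed

lemma vimage_restrict_psubset:
  assumes "P \<subset> P'" "P' \<subseteq> carrier (mpoly_ring V)"
  shows "restrict_vars V -` P \<subset> restrict_vars V -` P'"
proof -
  obtain p where "p \<in> P'" "p \<notin> P" using assms by auto
  then have "p \<in> restrict_vars V -` P'" "p \<notin> restrict_vars V -` P"
    using assms(2) restrict_vars_id[of p V] by auto
  then show ?thesis using assms(1) by auto
qed

section \<open>Chains of prime ideals in the polynomial ring over V\<close>

lemma primeideal_chain_alg_indep:
  fixes P :: "nat \<Rightarrow> (('v \<Rightarrow>\<^sub>0 nat) \<Rightarrow>\<^sub>0 'k::field) set"
  assumes P: "\<forall>i\<le>k. primeideal (P i) (mpoly_ring V)" "\<forall>i<k. P i \<subset> P (Suc i)"
  shows "\<exists>fs. length fs = k \<and> alg_indep_mod (restrict_vars V -` P 0) fs"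
proof (rule chain_alg_indep_mod[of k "\<lambda>i. restrict_vars V -` P i"])
  show "prime_set (restrict_vars V -` P i)" if "i \<le> k" for i
    using prime_set_restrict P(1) that by blast
  show "restrict_vars V -` P i \<subset> restrict_vars V -` P (Suc i)" if "i < k" for i
  proof (rule vimage_restrict_psubset)
    have "primeideal (P (Suc i)) (mpoly_ring V)" using P(1) that by auto
    then interpret primeideal "P (Suc i)" "mpoly_ring V" .
    show "P (Suc i) \<subseteq> carrier (mpoly_ring V)" using a_subset by auto
  qed (use P(2) that in auto)
qed

lemma primeideal_chain_length_le:
  fixes P :: "nat \<Rightarrow> (('v \<Rightarrow>\<^sub>0 nat) \<Rightarrow>\<^sub>0 'k::field) set"
  assumes "finite V" "\<forall>i\<le>k. primeideal (P i) (mpoly_ring V)" "\<forall>i<k. P i \<subset> P (Suc i)"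
  shows "k \<le> card V"
proof -
  obtain fs where "length fs = k" "alg_indep_mod (restrict_vars V -` P 0) fs"
    using primeideal_chain_alg_indep assms(2,3) by blast
  moreover have "prime_set (restrict_vars V -` P 0)" using prime_set_restrict assms(2) by blast
  ultimately show ?thesis using alg_indep_le_card_vars[OF _ assms(1) outside_restrict] by blast
qed

lemma prime_height_ge:
  fixes P :: "(('v::linorder \<Rightarrow>\<^sub>0 nat) \<Rightarrow>\<^sub>0 'k::field) set"
  assumes P: "primeideal P (mpoly_ring V)" and "finite V"
    and bound: "\<And>fs. alg_indep_mod (restrict_vars V -` P) fs \<Longrightarrow> length fs \<le> d"
  shows "enat (card V - d) \<le> prime_height (mpoly_ring V) P"
proof -
  let ?P = "restrict_vars V -` P" and ?C = "carrier (mpoly_ring V) :: (('v \<Rightarrow>\<^sub>0 nat) \<Rightarrow>\<^sub>0 'k) set"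
  have prime: "prime_set ?P" by (rule prime_set_restrict[OF P])
  obtain fs N Q where Q: "N + length fs = card V" "alg_indep_mod ?P fs"
    "\<forall>i\<le>N. prime_set (Q i) \<and> Q i \<subseteq> ?P \<and> (\<forall>v. v \<notin> V \<longrightarrow> mpoly_var v \<in> Q i)" "\<forall>i<N. Q i \<subset> Q (Suc i)"
    using prime_chain_below[OF prime assms(2) outside_restrict[OF prime]] by blast
  have sub: "P \<subseteq> ?C" using additive_subgroup.a_subset[OF ideal.axioms(1)[OF primeideal.axioms(1)[OF P]]] .
  have "card V - d \<le> N" using bound[OF Q(2)] Q(1) by simp
  also have "enat N \<le> prime_height (mpoly_ring V) P"
    unfolding prime_height_def chain_dim_def
  proof (rule Sup_upper, intro CollectI exI[of _ N] conjI exI[of _ "\<lambda>i. Q i \<inter> ?C"] refl allI impI)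
    fix i
    show "primeideal (Q i \<inter> ?C) (mpoly_ring V)" if "i \<le> N" using primeideal_Int_carrier Q(3) that by blast
    show "Q i \<inter> ?C \<subseteq> P" if "i \<le> N" using Q(3) that restrict_vars_vimage_Int[OF sub] by blast
    show "Q i \<inter> ?C \<subset> Q (Suc i) \<inter> ?C" if "i < N"
      by (rule Int_carrier_psubset) (use Q(3,4) that in auto)
  qed
  finally show ?thesis by simp
qed

lemma chain_dim_le:
  assumes "\<And>k P. \<forall>i\<le>k. P i \<in> \<P> \<Longrightarrow> \<forall>i<k. P i \<subset> P (Suc i) \<Longrightarrow> k \<le> d"
  shows "chain_dim \<P> \<le> enat d"
  unfolding chain_dim_def by (rule Sup_least) (use assms in auto)

lemma chain_dim_ge:
  assumes "\<forall>i\<le>k. P i \<in> \<P>" "\<forall>i<k. P i \<subset> P (Suc i)"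
  shows "enat k \<le> chain_dim \<P>"
  unfolding chain_dim_def by (rule Sup_upper) (use assms in auto)

text \<open>Any chain ending inside \<open>P 0\<close>, continued by the given chain of length
  \<open>d\<close>, is a chain of primes of the ring, so its length is at most
  \<open>card V\<close>.\<close>

lemma prime_height_le:
  fixes P :: "nat \<Rightarrow> (('v \<Rightarrow>\<^sub>0 nat) \<Rightarrow>\<^sub>0 'k::field) set"
  assumes "finite V" and P: "\<forall>i\<le>d. primeideal (P i) (mpoly_ring V)" "\<forall>i<d. P i \<subset> P (Suc i)"
  shows "prime_height (mpoly_ring V) (P 0) \<le> enat (card V - d)"
  unfolding prime_height_def
proof (rule chain_dim_le)
  fix k Q
  assume Q: "\<forall>i\<le>k. Q i \<in> {Q. primeideal Q (mpoly_ring V) \<and> Q \<subseteq> P 0}" "\<forall>i<k. Q i \<subset> Q (Suc i)"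
  \<comment> \<open>The top \<open>Q k\<close> of the lower chain may equal \<open>P 0\<close>, so
    it is dropped in favour of \<open>P 0\<close>; the spliced chain then has length
    \<open>k + d\<close>.\<close>
  define Z where "Z i = (if i < k then Q i else P (i - k))" for i
  have "k + d \<le> card V"
  proof (rule primeideal_chain_length_le[OF assms(1), of _ Z])
    show "\<forall>i\<le>k + d. primeideal (Z i) (mpoly_ring V)" using P(1) Q(1) by (auto simp: Z_def)
    show "\<forall>i<k + d. Z i \<subset> Z (Suc i)"
    proof (intro allI impI)
      fix i assume i: "i < k + d"
      consider "Suc i < k" | "Suc i = k" | "k \<le> i" by linarith
      then show "Z i \<subset> Z (Suc i)"
      proof cases
        case 2
        then have "Q i \<subset> Q k" "Q k \<subseteq> P 0" using Q by auto
        then show ?thesis using 2 by (auto simp: Z_def)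
      next
        case 3
        then show ?thesis using P(2) i by (auto simp: Z_def Suc_diff_le)
      qed (use Q(2) in \<open>auto simp: Z_def\<close>)
    qed
  qed
  then show "k \<le> card V - d" by simp
qed

text \<open>The carrier consists of the fixed points of \<open>restrict_vars V\<close>, and a ring
  homomorphism commutes with determinants.\<close>

lemma minors_carrier:
  fixes A :: "(('v \<Rightarrow>\<^sub>0 nat) \<Rightarrow>\<^sub>0 'k::field) mat"
  assumes A: "\<And>i j. i < dim_row A \<Longrightarrow> j < dim_col A \<Longrightarrow> A $$ (i, j) \<in> carrier (mpoly_ring V)"
  shows "minors k A \<subseteq> carrier (mpoly_ring V)"
proof
  fix x assume "x \<in> minors k A"
  then obtain I J where IJ: "x = det (submatrix A I J)" "I \<subseteq> {..<dim_row A}" "J \<subseteq> {..<dim_col A}" "card I = k" "card J = k"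
    unfolding minors_def by auto
  interpret h: comm_ring_hom "restrict_vars V :: (('v \<Rightarrow>\<^sub>0 nat) \<Rightarrow>\<^sub>0 'k) \<Rightarrow> _" by (rule comm_ring_hom_restrict_vars)
  have eq: "{i. i < dim_row A \<and> i \<in> I} = I" "{i. i < dim_col A \<and> i \<in> J} = J" using IJ by auto
  have pick: "i < k \<Longrightarrow> pick I i < dim_row A" "i < k \<Longrightarrow> pick J i < dim_col A" for i
    using pick_in_set_le[of i I] pick_in_set_le[of i J] IJ by auto
  have "map_mat (restrict_vars V) (submatrix A I J) = submatrix A I J"
    unfolding submatrix_def eq IJ(4,5)
    by (intro eq_matI) (auto simp: pick intro!: restrict_vars_id A)
  then have "restrict_vars V x = x" using h.hom_det[of "submatrix A I J"] IJ(1) by simp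
  then show "x \<in> carrier (mpoly_ring V)" using restrict_vars_carrier[of V x] by simp
qed

section \<open>Height and dimension\<close>

theorem corollary4p5:
  fixes m n r s t :: nat
    and J :: "((nat \<times> nat \<times> nat \<Rightarrow>\<^sub>0 nat) \<Rightarrow>\<^sub>0 'k::field) set"
  assumes "perfect_field TYPE('k)"
    and "r \<ge> 2" and "1 \<le> s" "s \<le> m" and "1 \<le> t" "t \<le> n" and "s \<le> t"
  defines "J \<equiv> double_det_ideal m n r s t"
  shows "(\<exists>h. ideal_height (generic_ring m n r) J = enat h \<and>
           int h =
             (int m - int s + 1) * (int n - int s + 1)
             + (int r - 1) * int n * (int m - int s + 1)
             + (int n - int t + 1) *
                 (\<Sum>q=2..r. (int s - 1)
                    - min (int s - 1) (max 0 (int t - (int s - 1) * (int q - 1) - 1))))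
       \<and> (\<exists>d. chain_dim (zero_locus (generic_ring m n r) J) = enat d \<and>
           int d =
             (int s - 1) * (int m + int n - int s + 1)
             + (int t - 1) *
                 (\<Sum>q=2..r. (int s - 1)
                    - min (int s - 1) (max 0 (int t - (int s - 1) * (int q - 1) - 1)))
             + int n *
                 (\<Sum>q=2..r. min (int s - 1) (max 0 (int t - (int s - 1) * (int q - 1) - 1))))"
proof -
  define a where "a = s - 1"
  define b where "b = min (t - 1) (r * a)"
  define d where "d = stratum_dim m n r a b"
  define V where "V = {..<r} \<times> {..<m} \<times> {..<n}"
  let ?R = "mpoly_ring V :: 'k gpoly ring"
  let ?H = "horizontal_concat m n r (generic_matrix m n) :: 'k gpoly mat"
  let ?V = "vertical_concat m n r (generic_matrix m n) :: 'k gpoly mat"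
  have R: "generic_ring m n r = ?R" by (simp add: generic_ring_def V_def)
  have V: "finite V" "card V = r * m * n" by (auto simp: V_def)
  have J: "J = Idl\<^bsub>?R\<^esub> (minors s ?H \<union> minors t ?V)" unfolding J_def double_det_ideal_def R ..
  have minors_J: "minors s ?H \<subseteq> J" "minors t ?V \<subseteq> J" unfolding J genideal_def by auto
  interpret R: cring ?R by (rule mpoly_ring_cring)

  have var: "mpoly_var v \<in> carrier ?R" if "v \<in> V" for v
    using that by (simp add: mpoly_ring_simps mpoly_var_def)
  have "minors s ?H \<subseteq> carrier ?R"
  proof (rule minors_carrier)
    fix i c assume "i < dim_row ?H" "c < dim_col ?H"
    then have ic: "i < m" "c < r * n" by (auto simp: horizontal_concat_def)
    then have "n > 0" by (cases n) auto
    then show "?H $$ (i, c) \<in> carrier ?R"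
      using ic var[of "(c div n, i, c mod n)"]
      by (simp add: horizontal_concat_def generic_matrix_def less_mult_imp_div_less V_def)
  qed
  moreover have "minors t ?V \<subseteq> carrier ?R"
  proof (rule minors_carrier)
    fix c j assume "c < dim_row ?V" "j < dim_col ?V"
    then have ic: "j < n" "c < r * m" by (auto simp: vertical_concat_def)
    then have "m > 0" by (cases m) auto
    then show "?V $$ (c, j) \<in> carrier ?R"
      using ic var[of "(c div m, c mod m, j)"]
      by (simp add: vertical_concat_def generic_matrix_def less_mult_imp_div_less V_def)
  qed
  ultimately have minors_carr: "minors s ?H \<union> minors t ?V \<subseteq> carrier ?R" by simp

  \<comment> \<open>One bound for all primes above \<open>J\<close>: at the bottom of a chain it
    bounds the dimension, and at every single prime it bounds the height from below.\<close>
  have indep_le: "length fs \<le> d"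
    if P: "primeideal P ?R" "J \<subseteq> P" and fs: "alg_indep_mod (restrict_vars V -` P) fs" for P fs
  proof -
    have prime: "prime_set (restrict_vars V -` P)" by (rule prime_set_restrict[OF P(1)])
    have pull: "S \<subseteq> restrict_vars V -` P" if "S \<subseteq> J" "S \<subseteq> carrier ?R" for S
    proof
      fix x assume "x \<in> S"
      then have "restrict_vars V x = x" "x \<in> P" using that P(2) restrict_vars_id[of x V] by auto
      then show "x \<in> restrict_vars V -` P" by simp
    qed
    have horiz: "minors s ?H \<subseteq> restrict_vars V -` P" by (rule pull) (use minors_J minors_carr in simp_all)
    have vert: "minors t ?V \<subseteq> restrict_vars V -` P" by (rule pull) (use minors_J minors_carr in simp_all)
    have outside: "mpoly_var v \<in> restrict_vars V -` P" if "v \<notin> {..<r} \<times> {..<m} \<times> {..<n}" for v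
      by (rule outside_restrict[OF prime]) (use that in \<open>simp only: V_def not_False_eq_True\<close>)
    have "\<exists>\<rho> \<sigma>. \<rho> < s \<and> \<rho> \<le> m \<and> \<sigma> < t \<and> \<sigma> \<le> n \<and> \<sigma> \<le> r * \<rho> \<and>
        (\<forall>fs. alg_indep_mod (restrict_vars V -` P) fs \<longrightarrow> length fs \<le> stratum_dim m n r \<rho> \<sigma>)"
      unfolding stratum_dim_def by (rule alg_indep_le_determinantal[OF prime outside horiz vert])
    then obtain \<rho> \<sigma> where \<rho>\<sigma>: "\<rho> < s" "\<rho> \<le> m" "\<sigma> < t" "\<sigma> \<le> n" "\<sigma> \<le> r * \<rho>"
      and le: "\<forall>fs. alg_indep_mod (restrict_vars V -` P) fs \<longrightarrow> length fs \<le> stratum_dim m n r \<rho> \<sigma>"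
      by (elim exE conjE) (rule that)
    have "length fs \<le> stratum_dim m n r \<rho> \<sigma>" using le fs by simp
    moreover have "stratum_dim m n r \<rho> \<sigma> \<le> d"
      unfolding d_def b_def by (rule stratum_dim_le) (use \<rho>\<sigma> assms in \<open>auto simp: a_def\<close>)
    ultimately show ?thesis by simp
  qed

  have "a \<le> m" "b \<le> n" "b \<le> r * a" "a < s" "b < t" using assms by (auto simp: a_def b_def)
  moreover have "a \<le> b"
  proof -
    have "1 * a \<le> r * a" by (rule mult_le_mono) (use assms in auto)
    then show ?thesis using assms by (auto simp: b_def a_def)
  qed
  ultimately obtain P where P: "\<forall>j\<le>d. prime_set (P j) \<and> {p :: 'k gpoly. param m n r a b p = 0} \<subseteq> P j"
    "\<forall>j<d. P j \<subset> P (Suc j)"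
    using param_chain[of a m b n r] unfolding d_def stratum_dim_def by blast
  define P' where "P' j = P j \<inter> carrier ?R" for j
  \<comment> \<open>As arguments of \<open>param\<close>, variables outside \<open>V\<close> are
    sent to zero, even those that reappear in its values as entries of A and B.\<close>
  have outP: "mpoly_var v \<in> P j" if "v \<notin> V" "j \<le> d" for v j
  proof -
    obtain q i k where v: "v = (q, i, k)" by (cases v)
    then have "param m n r a b (mpoly_var v :: 'k gpoly) = 0"
      using that(1) by (auto simp: V_def param_var)
    then show ?thesis using P(1) that(2) by blast
  qed
  have P': "\<forall>j\<le>d. primeideal (P' j) ?R" "\<forall>j<d. P' j \<subset> P' (Suc j)"
  proof -
    show "\<forall>j\<le>d. primeideal (P' j) ?R" using primeideal_Int_carrier P(1) unfolding P'_def by blast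
    show "\<forall>j<d. P' j \<subset> P' (Suc j)"
    proof (intro allI impI)
      fix j assume j: "j < d"
      show "P' j \<subset> P' (Suc j)"
        unfolding P'_def by (rule Int_carrier_psubset) (use P j outP in auto)
    qed
  qed
  have JP: "J \<subseteq> P' j" if "j \<le> d" for j
  proof -
    have "minors s ?H \<union> minors t ?V \<subseteq> P j"
      using param_horizontal_minors[OF \<open>a < s\<close>] param_vertical_minors[OF \<open>b < t\<close>] P(1) that by blast
    then have "minors s ?H \<union> minors t ?V \<subseteq> P' j" using minors_carr by (auto simp: P'_def)
    moreover have "ideal (P' j) ?R" using P'(1) that primeideal.axioms(1) by blast
    ultimately show ?thesis unfolding J by (intro R.genideal_minimal)
  qed

  have dim: "chain_dim (zero_locus ?R J) = enat d"
  proof (rule antisym)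
    show "chain_dim (zero_locus ?R J) \<le> enat d"
    proof (rule chain_dim_le)
      fix k Q
      assume Q: "\<forall>i\<le>k. Q i \<in> zero_locus ?R J" "\<forall>i<k. Q i \<subset> Q (Suc i)"
      then obtain fs where "length fs = k" "alg_indep_mod (restrict_vars V -` Q 0) fs"
        using primeideal_chain_alg_indep[of k Q V] unfolding zero_locus_def by blast
      then show "k \<le> d" using indep_le[of "Q 0" fs] Q(1) unfolding zero_locus_def by blast
    qed
    show "enat d \<le> chain_dim (zero_locus ?R J)"
      by (rule chain_dim_ge[of d P']) (use P' JP in \<open>auto simp: zero_locus_def\<close>)
  qed
  have height: "ideal_height ?R J = enat (card V - d)"
  proof (rule antisym)
    have "ideal_height ?R J \<le> prime_height ?R (P' 0)"
      unfolding ideal_height_def by (rule INF_lower) (use P'(1) JP[of 0] in auto)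
    also have "\<dots> \<le> enat (card V - d)" by (rule prime_height_le[OF V(1) P'])
    finally show "ideal_height ?R J \<le> enat (card V - d)" .
    show "enat (card V - d) \<le> ideal_height ?R J"
      unfolding ideal_height_def
      by (rule INF_greatest) (use prime_height_ge[OF _ V(1)] indep_le in blast)
  qed
  \<comment> \<open>Ensures that the subtraction of natural numbers in the height is not
    truncated.\<close>
  have "d \<le> card V" by (rule primeideal_chain_length_le[OF V(1) P'])
  then have codim: "int (card V - d) = int (r * m * n) - int d" using V(2) by (simp add: of_nat_diff)
  have d: "d = stratum_dim m n r (s - 1) (min (t - 1) (r * (s - 1)))"
    by (simp only: d_def b_def a_def)
  have "r \<ge> 1" using assms by simp
  note formula = stratum_dim_formula[OF \<open>r \<ge> 1\<close> \<open>1 \<le> s\<close> \<open>s \<le> m\<close> \<open>t \<le> n\<close> \<open>s \<le> t\<close>, folded d]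
  show ?thesis
    unfolding R
    by (intro conjI exI[of _ "card V - d"] exI[of _ d] height dim formula(1) codim[THEN trans] formula(2))
qed

end
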